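(* Let $Q(x,y)=0$ be a non-degenerate conic that is not a circumference, let $\Gamma=\{(x,y)\in\mathbb{R}^2: Q(x,y)=0\}$, let $D$ be the region enclosed by $\Gamma$, let $P$ be a polynomial in $x$ and $y$ with complex coefficients, and let $A\in W^{1,q}(D)$ with $q>2$. Then the Dirichlet problem $$\begin{cases}\left(\dfrac{\partial}{\partial\bar z}-A\right)^2 w=0, & \text{in } D,\\[2mm] w=e^{T_D[A]}P, & \text{on }\Gamma,\end{cases}$$ for a complex-valued function $w$, has a unique solution.
   Context: Identify $\mathbb{R}^2$ with $\mathbb{C}$ via $z=x+iy$, and let $\frac{\partial}{\partial\bar z}=\frac12\left(\frac{\partial}{\partial x}+i\frac{\partial}{\partial y}\right)$. A conic is given by $Q(x,y)=ax^2+bxy+cy^2+dx+ey+f=0$ with $a,b,c,d,e,f\in\mathbb{R}$; that it is not a circumference means that the case $a=c$, $b=0$ is excluded. Domains are bounded and simply connected with smooth boundary. $W^{1,q}(D)$ is the Sobolev space of complex-valued functions on $D$ in $L^q(D)$ whose first-order derivatives are in $L^q(D)$. The operator $\left(\frac{\partial}{\partial\bar z}-A\right)^2$ is the operator $w\mapsto\frac{\partial w}{\partial\bar z}-Aw$ composed with itself. The integral operator $T_D$ is $$T_D[A](z)=-\frac1\pi\iint_D\frac{A(\zeta)}{\zeta-z}\,d\xi\,d\eta,\qquad \zeta=\xi+i\eta.$$ The boundary condition prescribes the boundary values of $w$ in the usual sense of the Dirichlet problem. *)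

theory Defs
  imports "HOL-Analysis.Analysis" "HOL-Computational_Algebra.Polynomial"
begin

text \<open>
  The plane is the type \<^typ>\<open>complex\<close>, a point being \<open>z = x + \<i> y\<close> with
  \<open>x = Re z\<close>, \<open>y = Im z\<close>. Measure and integration are with respect to Lebesgue measure on it.
\<close>

subsection \<open>Conics and polynomials in two real variables\<close>

definition conic_poly :: "real \<Rightarrow> real \<Rightarrow> real \<Rightarrow> real \<Rightarrow> real \<Rightarrow> real \<Rightarrow> real \<Rightarrow> real \<Rightarrow> real" where
  "conic_poly a b c d e f x y = a * x\<^sup>2 + b * x * y + c * y\<^sup>2 + d * x + e * y + f"

definition conic_curve :: "real \<Rightarrow> real \<Rightarrow> real \<Rightarrow> real \<Rightarrow> real \<Rightarrow> real \<Rightarrow> complex set" where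
  "conic_curve a b c d e f = {z. conic_poly a b c d e f (Re z) (Im z) = 0}"

text \<open>
  A conic is non-degenerate if the symmetric matrix of its homogenisation
  \<open>a x\<^sup>2 + b x y + c y\<^sup>2 + d x t + e y t + f t\<^sup>2\<close> is regular. In particular \<open>a\<close>, \<open>b\<close>, \<open>c\<close> do not
  all vanish.
\<close>

definition conic_matrix :: "real \<Rightarrow> real \<Rightarrow> real \<Rightarrow> real \<Rightarrow> real \<Rightarrow> real \<Rightarrow> real^3^3" where
  "conic_matrix a b c d e f =
     vector [vector [a, b / 2, d / 2],
             vector [b / 2, c, e / 2],
             vector [d / 2, e / 2, f]]"

definition nondegenerate_conic :: "real \<Rightarrow> real \<Rightarrow> real \<Rightarrow> real \<Rightarrow> real \<Rightarrow> real \<Rightarrow> bool" where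
  "nondegenerate_conic a b c d e f \<longleftrightarrow> det (conic_matrix a b c d e f) \<noteq> 0"

text \<open>
  A polynomial in \<open>x\<close> and \<open>y\<close> is a polynomial in \<open>y\<close> whose coefficients are polynomials in \<open>x\<close>;
  \<open>poly_xy P z\<close> is its value at \<open>(x, y) = (Re z, Im z)\<close>, not at the complex variable \<open>z\<close>.
\<close>

definition poly_xy :: "complex poly poly \<Rightarrow> complex \<Rightarrow> complex" where
  "poly_xy P z = poly (poly P [:of_real (Im z):]) (of_real (Re z))"

subsection \<open>Weak derivatives and Sobolev functions\<close>

text \<open>
  \<open>Ck k \<phi>\<close>: all (real) partial derivatives of \<open>\<phi>\<close> up to order \<open>k\<close> exist and are continuous on the
  plane. The derivative in direction \<open>1\<close> is \<open>\<partial>/\<partial>x\<close>, the one in direction \<open>\<i>\<close> is \<open>\<partial>/\<partial>y\<close>.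
\<close>

primrec Ck :: "nat \<Rightarrow> (complex \<Rightarrow> complex) \<Rightarrow> bool" where
  "Ck 0 \<phi> \<longleftrightarrow> continuous_on UNIV \<phi>"
| "Ck (Suc k) \<phi> \<longleftrightarrow> (\<forall>z. \<phi> differentiable (at z)) \<and>
     (\<forall>v\<in>{1, \<i>}. Ck k (\<lambda>z. frechet_derivative \<phi> (at z) v))"

definition test_fun :: "complex set \<Rightarrow> (complex \<Rightarrow> complex) \<Rightarrow> bool" where
  "test_fun D \<phi> \<longleftrightarrow> (\<forall>k. Ck k \<phi>) \<and>
     compact (closure {z. \<phi> z \<noteq> 0}) \<and> closure {z. \<phi> z \<noteq> 0} \<subseteq> D"

definition locally_integrable_on :: "(complex \<Rightarrow> complex) \<Rightarrow> complex set \<Rightarrow> bool" where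
  "locally_integrable_on f D \<longleftrightarrow> (\<forall>K. compact K \<and> K \<subseteq> D \<longrightarrow> set_integrable lebesgue K f)"

definition has_weak_partial ::
  "complex set \<Rightarrow> complex \<Rightarrow> (complex \<Rightarrow> complex) \<Rightarrow> (complex \<Rightarrow> complex) \<Rightarrow> bool" where
  "has_weak_partial D v f g \<longleftrightarrow>
     locally_integrable_on f D \<and> locally_integrable_on g D \<and>
     (\<forall>\<phi>. test_fun D \<phi> \<longrightarrow>
        (LINT z:D|lebesgue. f z * frechet_derivative \<phi> (at z) v) =
        - (LINT z:D|lebesgue. g z * \<phi> z))"

definition Lq_on :: "real \<Rightarrow> complex set \<Rightarrow> (complex \<Rightarrow> complex) \<Rightarrow> bool" where
  "Lq_on q D f \<longleftrightarrow> set_borel_measurable lebesgue D f \<and>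
     set_integrable lebesgue D (\<lambda>z. norm (f z) powr q)"

definition sobolev_W1 :: "real \<Rightarrow> complex set \<Rightarrow> (complex \<Rightarrow> complex) \<Rightarrow> bool" where
  "sobolev_W1 q D f \<longleftrightarrow> Lq_on q D f \<and>
     (\<exists>fx fy. has_weak_partial D 1 f fx \<and> has_weak_partial D \<i> f fy \<and>
              Lq_on q D fx \<and> Lq_on q D fy)"

subsection \<open>The operators and the Dirichlet problem\<close>

text \<open>
  Weak derivatives are determined only up to null sets, so the operator
  \<open>dbar = (\<partial>/\<partial>x + \<i> \<partial>/\<partial>y) / 2\<close> and \<open>dbar - A\<close> are given as relations between a function
  and (a representative of) its image.
\<close>

definition has_weak_dbar ::
  "complex set \<Rightarrow> (complex \<Rightarrow> complex) \<Rightarrow> (complex \<Rightarrow> complex) \<Rightarrow> bool" where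
  "has_weak_dbar D w g \<longleftrightarrow>
     (\<exists>wx wy. has_weak_partial D 1 w wx \<and> has_weak_partial D \<i> w wy \<and>
        (AE z in lebesgue. z \<in> D \<longrightarrow> g z = 1 / 2 * (wx z + \<i> * wy z)))"

definition dbar_minus ::
  "(complex \<Rightarrow> complex) \<Rightarrow> complex set \<Rightarrow> (complex \<Rightarrow> complex) \<Rightarrow> (complex \<Rightarrow> complex) \<Rightarrow> bool" where
  "dbar_minus A D w v \<longleftrightarrow>
     (\<exists>g. has_weak_dbar D w g \<and> (AE z in lebesgue. z \<in> D \<longrightarrow> v z = g z - A z * w z))"

definition T_op :: "complex set \<Rightarrow> (complex \<Rightarrow> complex) \<Rightarrow> complex \<Rightarrow> complex" where
  "T_op D A z = - (1 / of_real pi) * (LINT \<zeta>:D|lebesgue. A \<zeta> / (\<zeta> - z))"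

text \<open>
  The equation says that \<open>dbar - A\<close> composed with itself sends \<open>w\<close> to \<open>0\<close> in \<open>D\<close>; the
  boundary values are attained continuously.
\<close>

definition dirichlet_solution ::
  "(complex \<Rightarrow> complex) \<Rightarrow> complex set \<Rightarrow> complex set \<Rightarrow> (complex \<Rightarrow> complex) \<Rightarrow>
   (complex \<Rightarrow> complex) \<Rightarrow> bool" where
  "dirichlet_solution A D \<Gamma> h w \<longleftrightarrow>
     continuous_on (closure D) w \<and>
     (\<exists>v. dbar_minus A D w v \<and> dbar_minus A D v (\<lambda>_. 0)) \<and>
     (\<forall>z\<in>\<Gamma>. w z = h z)"

end

theory Submission
  imports Defs "HOL-Real_Asymp.Real_Asymp"
begin

text \<open>
  Let \<open>B\<close> be the function \<open>T_op D A\<close>. It is continuous on the plane, and since \<open>A\<close> is a Sobolev function with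
  \<open>q > 2\<close>, it is continuously differentiable in \<open>D\<close> with \<open>dbar B = A\<close>. Putting \<open>w = e\<^sup>B u\<close>, the problem
  becomes \<open>dbar (dbar u) = 0\<close> in \<open>D\<close> and \<open>u = P\<close> on \<open>\<Gamma>\<close>. The domain is \<open>{Q < 0}\<close> for an elliptic quadratic
  polynomial \<open>Q\<close>, and \<open>\<Gamma>\<close> not being a circle means that the coefficient of \<open>(cnj z)\<^sup>2\<close> in \<open>Q\<close> is not zero.

  Existence: on \<open>\<Gamma>\<close> the equation \<open>Q = 0\<close> expresses \<open>(cnj z)\<^sup>2\<close> through lower powers of \<open>cnj z\<close>, so every
  polynomial in \<open>x\<close> and \<open>y\<close> agrees on \<open>\<Gamma>\<close> with some \<open>p0 z + cnj z * p1 z\<close>, which is bianalytic.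

  Uniqueness: a bianalytic \<open>u\<close> with zero boundary values is orthogonal to \<open>dbar (dbar (Q g))\<close> for every
  polynomial \<open>g\<close>. As the coefficient of \<open>(cnj z)\<^sup>2\<close> in \<open>Q\<close> is not zero, these functions exhaust all
  polynomials, and the Stone--Weierstrass theorem gives \<open>u = 0\<close>.
\<close>

subsection \<open>Wirtinger derivatives\<close>

text \<open>The circle has to be excluded because \<open>1 - z * cnj z\<close> is itself of the form
  \<open>p0 z + cnj z * p1 z\<close> and vanishes on the unit circle, so uniqueness fails there.
  Solutions are only weak and continuous up to the boundary. Uniqueness therefore goes by duality:
  \<open>u\<close> is never differentiated, all derivatives fall on test functions. Two obstacles
  follow. First, the factor \<open>exp (- B)\<close> is only C^1 in \<open>D\<close>, while weak
  derivatives are defined with smooth test functions; mollification extends the weak identities to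
  C^1 test functions. Second, \<open>Quad * g\<close> vanishes on the boundary only to first order
  and is no test function, so it is approximated by functions of compact support whose second
  derivatives blow up near the boundary. In the regularity of \<open>B\<close>, the assumption
  \<open>q > 2\<close> enters through the conjugate exponent \<open>q / (q - 1) < 2\<close>, a power
  in which the kernel \<open>1 / w\<close> is locally integrable. Since the extension of
  \<open>A\<close> by zero need not have weak derivatives across the boundary, the derivatives of
  \<open>B\<close> are found locally, after a cutoff.\<close>

text \<open>
  \<open>p\<close> and \<open>q\<close> are the Wirtinger derivatives \<open>\<partial>f/\<partial>z\<close> and \<open>\<partial>f/\<partial>(cnj z)\<close>; the derivative in direction \<open>v\<close> is \<open>p v + q cnj v\<close>.
\<close>

definition wirt :: "complex set \<Rightarrow> (complex \<Rightarrow> complex) \<Rightarrow> (complex \<Rightarrow> complex) \<Rightarrow> (complex \<Rightarrow> complex) \<Rightarrow> bool" where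
  "wirt U f p q \<longleftrightarrow> (\<forall>z\<in>U. (f has_derivative (\<lambda>h. p z * h + q z * cnj h)) (at z)) \<and>
     continuous_on U p \<and> continuous_on U q"

lemma wirt_D: "wirt U f p q \<Longrightarrow> z \<in> U \<Longrightarrow> (f has_derivative (\<lambda>h. p z * h + q z * cnj h)) (at z)"
  by (simp add: wirt_def)

lemma wirt_cont:
  assumes "wirt U f p q" shows "continuous_on U f" "continuous_on U p" "continuous_on U q"
  using assms unfolding wirt_def
  by (auto intro!: continuous_at_imp_continuous_on has_derivative_continuous)

lemma wirt_subset: "wirt U f p q \<Longrightarrow> V \<subseteq> U \<Longrightarrow> wirt V f p q"
  unfolding wirt_def by (meson continuous_on_subset subsetD)

lemma wirt_const: "wirt U (\<lambda>z. c) (\<lambda>z. 0) (\<lambda>z. 0)"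
  by (simp add: wirt_def)

lemma wirt_id: "wirt U (\<lambda>z. z) (\<lambda>z. 1) (\<lambda>z. 0)"
  by (simp add: wirt_def)

lemma wirt_cnj_id: "wirt U cnj (\<lambda>z. 0) (\<lambda>z. 1)"
  using bounded_linear_cnj by (simp add: wirt_def bounded_linear_imp_has_derivative)

lemma wirt_add:
  assumes "wirt U f p q" "wirt U g r s"
  shows "wirt U (\<lambda>z. f z + g z) (\<lambda>z. p z + r z) (\<lambda>z. q z + s z)"
  unfolding wirt_def
proof (intro conjI ballI)
  fix z assume z: "z \<in> U"
  have "((\<lambda>z. f z + g z) has_derivative (\<lambda>h. (p z * h + q z * cnj h) + (r z * h + s z * cnj h))) (at z)"
    by (intro has_derivative_add wirt_D[OF assms(1) z] wirt_D[OF assms(2) z])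
  then show "((\<lambda>z. f z + g z) has_derivative (\<lambda>h. (p z + r z) * h + (q z + s z) * cnj h)) (at z)"
    by (simp add: algebra_simps)
qed (intro continuous_intros wirt_cont[OF assms(1)] wirt_cont[OF assms(2)])+

lemma wirt_mult:
  assumes "wirt U f p q" "wirt U g r s"
  shows "wirt U (\<lambda>z. f z * g z) (\<lambda>z. p z * g z + f z * r z) (\<lambda>z. q z * g z + f z * s z)"
  unfolding wirt_def
proof (intro conjI ballI)
  fix z assume z: "z \<in> U"
  have "((\<lambda>z. f z * g z) has_derivative (\<lambda>h. f z * (r z * h + s z * cnj h) + (p z * h + q z * cnj h) * g z)) (at z)"
    by (intro has_derivative_mult wirt_D[OF assms(1) z] wirt_D[OF assms(2) z])
  then show "((\<lambda>z. f z * g z) has_derivative (\<lambda>h. (p z * g z + f z * r z) * h + (q z * g z + f z * s z) * cnj h)) (at z)"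
    by (simp add: algebra_simps)
qed (intro continuous_intros wirt_cont[OF assms(1)] wirt_cont[OF assms(2)])+

lemma wirt_cmult:
  assumes "wirt U f p q"
  shows "wirt U (\<lambda>z. c * f z) (\<lambda>z. c * p z) (\<lambda>z. c * q z)"
  using wirt_mult[OF wirt_const assms, of c] by simp

lemma wirt_cnj:
  assumes "wirt U f p q"
  shows "wirt U (\<lambda>z. cnj (f z)) (\<lambda>z. cnj (q z)) (\<lambda>z. cnj (p z))"
  unfolding wirt_def
proof (intro conjI ballI)
  fix z assume z: "z \<in> U"
  have "((\<lambda>z. cnj (f z)) has_derivative (\<lambda>h. cnj (p z * h + q z * cnj h))) (at z)"
    by (intro has_derivative_cnj wirt_D[OF assms(1) z])
  then show "((\<lambda>z. cnj (f z)) has_derivative (\<lambda>h. cnj (q z) * h + cnj (p z) * cnj h)) (at z)"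
    by (simp add: algebra_simps)
qed (intro continuous_intros wirt_cont[OF assms(1)])+

lemma wirt_compose_field:
  assumes "wirt U f p q" and F: "\<And>z. z \<in> U \<Longrightarrow> (F has_field_derivative F' (f z)) (at (f z))"
    and "continuous_on (f ` U) F'"
  shows "wirt U (\<lambda>z. F (f z)) (\<lambda>z. F' (f z) * p z) (\<lambda>z. F' (f z) * q z)"
  unfolding wirt_def
proof (intro conjI ballI)
  fix z assume z: "z \<in> U"
  have "((\<lambda>z. F (f z)) has_derivative (\<lambda>h. F' (f z) * (p z * h + q z * cnj h))) (at z)"
    using has_derivative_compose[OF wirt_D[OF assms(1) z], of F "(*) (F' (f z))"] F[OF z]
    by (simp add: has_field_derivative_def)
  then show "((\<lambda>z. F (f z)) has_derivative (\<lambda>h. F' (f z) * p z * h + F' (f z) * q z * cnj h)) (at z)"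
    by (simp add: algebra_simps)
qed (intro continuous_intros wirt_cont[OF assms(1)] continuous_on_compose2[OF assms(3)] order_refl)+

lemma wirt_exp:
  "wirt U f p q \<Longrightarrow> wirt U (\<lambda>z. exp (f z)) (\<lambda>z. exp (f z) * p z) (\<lambda>z. exp (f z) * q z)"
  by (rule wirt_compose_field) (auto intro!: DERIV_exp continuous_intros)

lemma wirt_holomorphic:
  assumes "\<And>z. z \<in> U \<Longrightarrow> (F has_field_derivative F' z) (at z)" "continuous_on U F'"
  shows "wirt U F F' (\<lambda>z. 0)"
  using wirt_compose_field[OF wirt_id, of U F F'] assms by simp

text \<open>\<open>k\<close> need not be holomorphic, so the chain rule goes through the real-valued
  \<open>r\<close>. The derivative of \<open>of_real (r z)\<close> takes real values only, which
  turns the real chain rule back into one for the coefficients \<open>p\<close> and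
  \<open>q\<close>.\<close>

lemma wirt_real_compose:
  fixes k k' :: "real \<Rightarrow> real" and r :: "complex \<Rightarrow> real"
  assumes "wirt U (\<lambda>z. of_real (r z)) p q" and k: "\<And>x. (k has_real_derivative k' x) (at x)"
    and "continuous_on UNIV k'"
  shows "wirt U (\<lambda>z. of_real (k (r z))) (\<lambda>z. of_real (k' (r z)) * p z) (\<lambda>z. of_real (k' (r z)) * q z)"
  unfolding wirt_def
proof (intro conjI ballI)
  fix z assume z: "z \<in> U"
  let ?d = "\<lambda>h. p z * h + q z * cnj h"
  have d: "((\<lambda>z. complex_of_real (r z)) has_derivative ?d) (at z)"
    by (rule wirt_D[OF assms(1) z])
  have r: "(r has_derivative (\<lambda>h. Re (?d h))) (at z)"
    using has_derivative_Re[OF d] by simp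
  have "((\<lambda>z. Im (complex_of_real (r z))) has_derivative (\<lambda>h. Im (?d h))) (at z)"
    by (rule has_derivative_Im[OF d])
  then have im: "Im (?d h) = 0" for h
    using has_derivative_unique[of "\<lambda>z. 0::real" "\<lambda>h. Im (?d h)" z "\<lambda>h. 0"]
    by (simp add: fun_eq_iff del: times_complex.simps)
  then have eq: "complex_of_real (Re (?d h)) = ?d h" for h
    by (metis complex_eq_iff Re_complex_of_real Im_complex_of_real)
  have "((\<lambda>z. k (r z)) has_derivative (\<lambda>h. k' (r z) * Re (?d h))) (at z)"
    using has_derivative_compose[OF r, of k "(*) (k' (r z))"] k by (simp add: has_field_derivative_def)
  then have "((\<lambda>z. complex_of_real (k (r z))) has_derivative (\<lambda>h. of_real (k' (r z) * Re (?d h)))) (at z)"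
    by (rule has_derivative_of_real)
  moreover have "(\<lambda>h. complex_of_real (k' (r z) * Re (?d h))) =
     (\<lambda>h. of_real (k' (r z)) * p z * h + of_real (k' (r z)) * q z * cnj h)"
    unfolding of_real_mult eq by (simp add: algebra_simps)
  ultimately show "((\<lambda>z. complex_of_real (k (r z))) has_derivative (\<lambda>h. of_real (k' (r z)) * p z * h + of_real (k' (r z)) * q z * cnj h)) (at z)"
    by simp
next
  have "continuous_on U (\<lambda>z. Re (complex_of_real (r z)))"
    by (intro continuous_intros wirt_cont(1)[OF assms(1)])
  then have "continuous_on U r" by simp
  then have *: "continuous_on U (\<lambda>z. complex_of_real (k' (r z)))"
    by (intro continuous_intros continuous_on_compose2[OF assms(3)]) auto
  show "continuous_on U (\<lambda>z. of_real (k' (r z)) * p z)" "continuous_on U (\<lambda>z. of_real (k' (r z)) * q z)"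
    by (intro continuous_intros * wirt_cont[OF assms(1)])+
qed

lemma wirt_cong:
  assumes "wirt U f p q" "open U" "\<And>z. z \<in> U \<Longrightarrow> f z = g z" "\<And>z. z \<in> U \<Longrightarrow> p z = r z" "\<And>z. z \<in> U \<Longrightarrow> q z = s z"
  shows "wirt U g r s"
  unfolding wirt_def
proof (intro conjI ballI)
  fix z assume z: "z \<in> U"
  show "(g has_derivative (\<lambda>h. r z * h + s z * cnj h)) (at z)"
    using has_derivative_transform_within_open[OF wirt_D[OF assms(1) z] assms(2) z assms(3)] assms(4,5) z by simp
next
  show "continuous_on U r" using wirt_cont(2)[OF assms(1)] assms(4) by (metis continuous_on_cong)
  show "continuous_on U s" using wirt_cont(3)[OF assms(1)] assms(5) by (metis continuous_on_cong)
qed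

text \<open>Evaluating the derivative at \<open>1\<close> and at \<open>\<i>\<close> gives the sum
  and the difference of the two coefficients.\<close>

lemma wirt_unique:
  assumes "wirt U f p q" "wirt U f r s" "z \<in> U"
  shows "p z = r z \<and> q z = s z"
proof -
  have eq: "p z * h + q z * cnj h = r z * h + s z * cnj h" for h
    using has_derivative_unique[OF wirt_D[OF assms(1,3)] wirt_D[OF assms(2,3)]] by (auto simp: fun_eq_iff)
  have 1: "p z + q z = r z + s z" using eq[of 1] by simp
  have "\<i> * (p z - q z) = \<i> * (r z - s z)" using eq[of \<i>] by (simp add: algebra_simps)
  then have "p z - q z = r z - s z" by simp
  with 1 have "2 * p z = 2 * r z" by algebra
  then have "p z = r z" by simp
  with 1 show ?thesis by simp
qed

lemma wirt_zero_outside: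
  assumes "wirt UNIV f p q" "closed K" "\<And>z. z \<notin> K \<Longrightarrow> f z = 0" "z \<notin> K"
  shows "p z = 0" "q z = 0"
proof -
  have "wirt (- K) (\<lambda>z. 0) p q"
    by (rule wirt_cong[OF wirt_subset[OF assms(1)]]) (use assms in auto)
  then show "p z = 0" "q z = 0" using wirt_unique[OF _ wirt_const, of "-K" 0 p q z] assms by auto
qed

text \<open>Meant for products of a function that is regular only on the domain with a test function
  supported in \<open>K\<close>. The open sets \<open>U\<close> and \<open>- K\<close> cover the
  plane, and the claim is local.\<close>

lemma wirt_extend_zero:
  assumes "wirt U f p q" "open U" "closed K" "K \<subseteq> U" "\<And>z. z \<notin> K \<Longrightarrow> f z = 0"
    "\<And>z. z \<notin> K \<Longrightarrow> p z = 0" "\<And>z. z \<notin> K \<Longrightarrow> q z = 0"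
  shows "wirt UNIV f p q"
proof -
  have 1: "wirt (-K) f p q"
    by (rule wirt_cong[OF wirt_const[where c=0]]) (use assms in auto)
  have U: "UNIV = U \<union> -K" using assms by auto
  show ?thesis
    unfolding wirt_def
  proof (intro conjI ballI)
    fix z :: complex
    show "(f has_derivative (\<lambda>h. p z * h + q z * cnj h)) (at z)"
      using wirt_D[OF 1, of z] wirt_D[OF assms(1), of z] U by blast
  next
    show "continuous_on UNIV p" unfolding U
      by (rule continuous_on_open_Un) (use assms wirt_cont[OF 1] wirt_cont[OF assms(1)] in auto)
    show "continuous_on UNIV q" unfolding U
      by (rule continuous_on_open_Un) (use assms wirt_cont[OF 1] wirt_cont[OF assms(1)] in auto)
  qed
qed

lemma wirt_deriv_norm:
  fixes h :: complex
  assumes "norm x \<le> C" "norm y \<le> C"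
  shows "norm (x * h + y * cnj h) \<le> 2 * C * norm h"
proof -
  have "norm (x * h + y * cnj h) \<le> norm x * norm h + norm y * norm h"
    by (rule order_trans[OF norm_triangle_ineq]) (simp add: norm_mult)
  also have "\<dots> \<le> C * norm h + C * norm h"
    using assms by (intro add_mono mult_right_mono) auto
  finally show ?thesis by simp
qed

lemma wirt_lipschitz:
  assumes "wirt V k p q" "\<And>w. w \<in> V \<Longrightarrow> norm (p w) \<le> C" "\<And>w. w \<in> V \<Longrightarrow> norm (q w) \<le> C"
    and "convex U" "U \<subseteq> V" "x \<in> U" "y \<in> U"
  shows "norm (k x - k y) \<le> 2 * C * norm (x - y)"
proof (rule differentiable_bound[OF assms(4) _ _ assms(6,7)])
  fix z assume "z \<in> U"
  then have z: "z \<in> V" using assms by auto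
  show "(k has_derivative (\<lambda>h. p z * h + q z * cnj h)) (at z within U)"
    using wirt_D[OF assms(1) z] has_derivative_at_withinI by blast
  show "onorm (\<lambda>h. p z * h + q z * cnj h) \<le> 2 * C"
    by (rule onorm_le) (rule wirt_deriv_norm[OF assms(2)[OF z] assms(3)[OF z]])
qed

text \<open>Differentiation under the integral sign. The set \<open>V\<close> keeps the argument of
  the kernel away from a singularity: it is the whole plane for regularised kernels and the exterior
  of a disc for \<open>1 / w\<close>. The minus signs come from differentiating
  \<open>\<zeta> - z\<close> with respect to \<open>z\<close>.\<close>

lemma wirt_convolution:
  fixes a k kp kq :: "complex \<Rightarrow> complex"
  assumes a: "integrable lborel a" and U: "open U" "convex U"
    and sep: "\<And>\<zeta> z. a \<zeta> \<noteq> 0 \<Longrightarrow> z \<in> U \<Longrightarrow> \<zeta> - z \<in> V"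
    and oV: "open V" and k: "wirt V k kp kq"
    and C: "\<And>w. w \<in> V \<Longrightarrow> norm (k w) \<le> C" "\<And>w. w \<in> V \<Longrightarrow> norm (kp w) \<le> C" "\<And>w. w \<in> V \<Longrightarrow> norm (kq w) \<le> C"
    and [measurable]: "k \<in> borel_measurable borel" "kp \<in> borel_measurable borel" "kq \<in> borel_measurable borel"
  shows "wirt U (\<lambda>z. \<integral>\<zeta>. a \<zeta> * k (\<zeta> - z) \<partial>lborel) (\<lambda>z. - (\<integral>\<zeta>. a \<zeta> * kp (\<zeta> - z) \<partial>lborel))
     (\<lambda>z. - (\<integral>\<zeta>. a \<zeta> * kq (\<zeta> - z) \<partial>lborel))"
proof -
  have [measurable]: "a \<in> borel_measurable borel" using a by auto
  have ibl: "integrable lborel (\<lambda>\<zeta>. a \<zeta> * g (\<zeta> - z))"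
    if "z \<in> U" and gm: "g \<in> borel_measurable borel" and "\<And>w. w \<in> V \<Longrightarrow> norm (g w) \<le> C" for g z
  proof (rule Bochner_Integration.integrable_bound[where f="\<lambda>\<zeta>. of_real C * a \<zeta>"])
    show "integrable lborel (\<lambda>\<zeta>. of_real C * a \<zeta>)" using a by simp
    note gm[measurable]
    show "(\<lambda>\<zeta>. a \<zeta> * g (\<zeta> - z)) \<in> borel_measurable lborel" by measurable
    show "AE \<zeta> in lborel. norm (a \<zeta> * g (\<zeta> - z)) \<le> norm (complex_of_real C * a \<zeta>)"
    proof (rule AE_I2)
      fix \<zeta>
      show "norm (a \<zeta> * g (\<zeta> - z)) \<le> norm (complex_of_real C * a \<zeta>)"
      proof (cases "a \<zeta> = 0")
        case False
        then have "norm (g (\<zeta> - z)) \<le> C" using that sep by auto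
        then have "norm (g (\<zeta> - z)) \<le> \<bar>C\<bar>" by simp
        then show ?thesis using mult_right_mono[OF _ norm_ge_zero, of _ "\<bar>C\<bar>" "a \<zeta>"] by (simp add: norm_mult mult.commute[of "norm (a \<zeta>)"])
      qed auto
    qed
  qed
  have cont: "continuous_on U (\<lambda>z. \<integral>\<zeta>. a \<zeta> * g (\<zeta> - z) \<partial>lborel)"
    if gc: "continuous_on V g" and gm: "g \<in> borel_measurable borel" and gC: "\<And>w. w \<in> V \<Longrightarrow> norm (g w) \<le> C" for g
    unfolding continuous_on_sequentially comp_def
  proof (intro allI ballI impI)
    fix X z assume z: "z \<in> U" and X: "(\<forall>n. X n \<in> U) \<and> X \<longlonglongrightarrow> z"
    note gm[measurable]
    show "(\<lambda>n. \<integral>\<zeta>. a \<zeta> * g (\<zeta> - X n) \<partial>lborel) \<longlonglongrightarrow> (\<integral>\<zeta>. a \<zeta> * g (\<zeta> - z) \<partial>lborel)"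
    proof (rule integral_dominated_convergence[where w="\<lambda>\<zeta>. \<bar>C\<bar> * norm (a \<zeta>)"])
      show "integrable lborel (\<lambda>\<zeta>. \<bar>C\<bar> * norm (a \<zeta>))" using a by simp
      show "AE \<zeta> in lborel. (\<lambda>i. a \<zeta> * g (\<zeta> - X i)) \<longlonglongrightarrow> a \<zeta> * g (\<zeta> - z)"
      proof (rule AE_I2)
        fix \<zeta>
        show "(\<lambda>i. a \<zeta> * g (\<zeta> - X i)) \<longlonglongrightarrow> a \<zeta> * g (\<zeta> - z)"
        proof (cases "a \<zeta> = 0")
          case False
          then have "\<zeta> - z \<in> V" using sep z by auto
          then have "isCont g (\<zeta> - z)" using gc oV continuous_on_eq_continuous_at by blast
          moreover have "(\<lambda>i. \<zeta> - X i) \<longlonglongrightarrow> \<zeta> - z" using X by (intro tendsto_intros) auto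
          ultimately have "(\<lambda>i. g (\<zeta> - X i)) \<longlonglongrightarrow> g (\<zeta> - z)" by (rule isCont_tendsto_compose)
          then show ?thesis by (intro tendsto_intros)
        qed auto
      qed
      show "AE \<zeta> in lborel. norm (a \<zeta> * g (\<zeta> - X i)) \<le> \<bar>C\<bar> * norm (a \<zeta>)" for i
      proof (rule AE_I2)
        fix \<zeta>
        show "norm (a \<zeta> * g (\<zeta> - X i)) \<le> \<bar>C\<bar> * norm (a \<zeta>)"
        proof (cases "a \<zeta> = 0")
          case False
          then have "norm (g (\<zeta> - X i)) \<le> C" using X gC sep by auto
          then have "norm (g (\<zeta> - X i)) \<le> \<bar>C\<bar>" by simp
          then show ?thesis using mult_right_mono[OF _ norm_ge_zero, of _ "\<bar>C\<bar>" "a \<zeta>"] by (simp add: norm_mult mult.commute[of "norm (a \<zeta>)"])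
        qed auto
      qed
    qed measurable
  qed
  show ?thesis
      unfolding wirt_def
    proof (intro conjI ballI)
      show "continuous_on U (\<lambda>z. - (\<integral>\<zeta>. a \<zeta> * kp (\<zeta> - z) \<partial>lborel))"
        "continuous_on U (\<lambda>z. - (\<integral>\<zeta>. a \<zeta> * kq (\<zeta> - z) \<partial>lborel))"
        using oV C by (intro continuous_intros cont wirt_cont[OF k]; simp)+
      fix z assume z: "z \<in> U"
      let ?F = "\<lambda>z. \<integral>\<zeta>. a \<zeta> * k (\<zeta> - z) \<partial>lborel"
      let ?p = "\<integral>\<zeta>. a \<zeta> * kp (\<zeta> - z) \<partial>lborel" and ?q = "\<integral>\<zeta>. a \<zeta> * kq (\<zeta> - z) \<partial>lborel"
      have bl: "bounded_linear (\<lambda>h. (-?p) * h + (-?q) * cnj h)"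
        by (intro bounded_linear_intros bounded_linear_compose[OF bounded_linear_mult_right bounded_linear_cnj] bounded_linear_mult_right)
      have "((\<lambda>y. ((?F y - ?F z) - ((-?p) * (y - z) + (-?q) * cnj (y - z))) /\<^sub>R norm (y - z)) \<longlongrightarrow> 0) (at z within U)"
        unfolding tendsto_at_iff_sequentially comp_def
      proof (intro allI impI)
        fix X assume X: "\<forall>i. X i \<in> U - {z}" "X \<longlonglongrightarrow> z"
        \<comment> \<open>\<open>s i\<close> is \<open>a\<close> times the first-order Taylor
          remainder of the kernel at \<open>\<zeta> - z\<close>, divided by the length of the
          increment. It tends to \<open>0\<close> pointwise by differentiability of
          \<open>k\<close>.\<close>
        define s where "s i \<zeta> = a \<zeta> * ((k (\<zeta> - X i) - k (\<zeta> - z) + kp (\<zeta> - z) * (X i - z) + kq (\<zeta> - z) * cnj (X i - z)) /\<^sub>R norm (X i - z))" for i \<zeta>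
        have XU: "X i \<in> U" "X i \<noteq> z" for i using X by auto
        have eq: "((?F (X i) - ?F z) - ((-?p) * (X i - z) + (-?q) * cnj (X i - z))) /\<^sub>R norm (X i - z) = (\<integral>\<zeta>. s i \<zeta> \<partial>lborel)" for i
        proof -
          have i1: "integrable lborel (\<lambda>\<zeta>. a \<zeta> * k (\<zeta> - X i))" "integrable lborel (\<lambda>\<zeta>. a \<zeta> * k (\<zeta> - z))"
            "integrable lborel (\<lambda>\<zeta>. a \<zeta> * kp (\<zeta> - z))" "integrable lborel (\<lambda>\<zeta>. a \<zeta> * kq (\<zeta> - z))"
            by (intro ibl XU z C; simp)+
          have "(\<integral>\<zeta>. s i \<zeta> \<partial>lborel) = (\<integral>\<zeta>. (a \<zeta> * k (\<zeta> - X i) - a \<zeta> * k (\<zeta> - z) + (a \<zeta> * kp (\<zeta> - z)) * (X i - z) + (a \<zeta> * kq (\<zeta> - z)) * cnj (X i - z)) /\<^sub>R norm (X i - z) \<partial>lborel)"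
            unfolding s_def by (intro Bochner_Integration.integral_cong) (simp_all add: algebra_simps)
          also have "\<dots> = (?F (X i) - ?F z + ?p * (X i - z) + ?q * cnj (X i - z)) /\<^sub>R norm (X i - z)"
            using i1 by simp
          finally show ?thesis by simp
        qed
        have "(\<lambda>i. \<integral>\<zeta>. s i \<zeta> \<partial>lborel) \<longlonglongrightarrow> integral\<^sup>L lborel (\<lambda>\<zeta>::complex. 0::complex)"
        proof (rule integral_dominated_convergence[where w="\<lambda>\<zeta>. (4 * \<bar>C\<bar>) * norm (a \<zeta>)"])
          show "(\<lambda>x. 0) \<in> borel_measurable lborel" by simp
          show "s i \<in> borel_measurable lborel" for i unfolding s_def by measurable
          show "integrable lborel (\<lambda>\<zeta>. (4 * \<bar>C\<bar>) * norm (a \<zeta>))" using a by simp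
          show "AE \<zeta> in lborel. (\<lambda>i. s i \<zeta>) \<longlonglongrightarrow> 0"
          proof (rule AE_I2)
            fix \<zeta>
            show "(\<lambda>i. s i \<zeta>) \<longlonglongrightarrow> 0"
            proof (cases "a \<zeta> = 0")
              case True then show ?thesis by (simp add: s_def)
            next
              case False
              then have V: "\<zeta> - z \<in> V" using sep z by auto
              have "(k has_derivative (\<lambda>h. kp (\<zeta> - z) * h + kq (\<zeta> - z) * cnj h)) (at (\<zeta> - z))"
                by (rule wirt_D[OF k V])
              then have "((\<lambda>y. k (\<zeta> - y)) has_derivative (\<lambda>h. kp (\<zeta> - z) * (-h) + kq (\<zeta> - z) * cnj (-h))) (at z within U)"
                by (intro has_derivative_compose[of "\<lambda>y. \<zeta> - y" "\<lambda>h. -h" z U k]) (auto intro!: derivative_eq_intros)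
              then have "((\<lambda>y. (k (\<zeta> - y) - k (\<zeta> - z) - (kp (\<zeta> - z) * (-(y-z)) + kq (\<zeta> - z) * cnj (-(y-z)))) /\<^sub>R norm (y - z)) \<longlongrightarrow> 0) (at z within U)"
                by (rule conjunct2[OF has_derivative_at_within[THEN iffD1]])
              then have "(\<lambda>i. (k (\<zeta> - X i) - k (\<zeta> - z) - (kp (\<zeta> - z) * (-(X i-z)) + kq (\<zeta> - z) * cnj (-(X i-z)))) /\<^sub>R norm (X i - z)) \<longlonglongrightarrow> 0"
                unfolding tendsto_at_iff_sequentially comp_def using X by blast
              then have "(\<lambda>i. a \<zeta> * ((k (\<zeta> - X i) - k (\<zeta> - z) - (kp (\<zeta> - z) * (-(X i-z)) + kq (\<zeta> - z) * cnj (-(X i-z)))) /\<^sub>R norm (X i - z))) \<longlonglongrightarrow> a \<zeta> * 0"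
                by (intro tendsto_mult tendsto_const)
              then show ?thesis unfolding s_def by (simp add: algebra_simps)
            qed
          qed
          \<comment> \<open>A bound uniform in \<open>i\<close>: the increment of \<open>k\<close>
            contributes \<open>2 * C\<close> by the mean value inequality on the convex set of all
            \<open>\<zeta> - y\<close> with \<open>y\<close> in \<open>U\<close>, the linear part
            another \<open>2 * C\<close>.\<close>
          show "AE \<zeta> in lborel. norm (s i \<zeta>) \<le> (4 * \<bar>C\<bar>) * norm (a \<zeta>)" for i
          proof (rule AE_I2)
            fix \<zeta>
            show "norm (s i \<zeta>) \<le> (4 * \<bar>C\<bar>) * norm (a \<zeta>)"
            proof (cases "a \<zeta> = 0")
              case True then show ?thesis by (simp add: s_def)
            next
              case False
              let ?S = "(\<lambda>y. \<zeta> - y) ` U"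
              have S: "?S \<subseteq> V" using sep False by auto
              have cS: "convex ?S"
              proof -
                have "?S = (\<lambda>y. \<zeta> + y) ` ((\<lambda>y. - y) ` U)" by (auto simp: image_image)
                then show ?thesis using U(2) by (metis convex_negations convex_translation)
              qed
              have V: "\<zeta> - z \<in> V" using S z by auto
              have "norm (k (\<zeta> - X i) - k (\<zeta> - z)) \<le> 2 * C * norm ((\<zeta> - X i) - (\<zeta> - z))"
                by (rule wirt_lipschitz[OF k C(2,3) cS S]) (use XU z in auto)
              also have "norm ((\<zeta> - X i) - (\<zeta> - z)) = norm (X i - z)" by (simp add: norm_minus_commute)
              finally have 1: "norm (k (\<zeta> - X i) - k (\<zeta> - z)) \<le> 2 * C * norm (X i - z)" .
              have 2: "norm (kp (\<zeta> - z) * (X i - z) + kq (\<zeta> - z) * cnj (X i - z)) \<le> 2 * C * norm (X i - z)"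
                by (rule wirt_deriv_norm[OF C(2)[OF V] C(3)[OF V]])
              have "norm (k (\<zeta> - X i) - k (\<zeta> - z) + kp (\<zeta> - z) * (X i - z) + kq (\<zeta> - z) * cnj (X i - z)) \<le> 4 * C * norm (X i - z)"
                using norm_triangle_le[OF add_mono[OF 1 2]] by (simp add: algebra_simps)
              then have "norm ((k (\<zeta> - X i) - k (\<zeta> - z) + kp (\<zeta> - z) * (X i - z) + kq (\<zeta> - z) * cnj (X i - z)) /\<^sub>R norm (X i - z)) \<le> 4 * C"
                using XU(2)[of i] by (simp add: divide_simps)
              then have "norm ((k (\<zeta> - X i) - k (\<zeta> - z) + kp (\<zeta> - z) * (X i - z) + kq (\<zeta> - z) * cnj (X i - z)) /\<^sub>R norm (X i - z)) \<le> 4 * \<bar>C\<bar>"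
                by linarith
              then show ?thesis unfolding s_def norm_mult
                by (subst mult.commute) (rule mult_right_mono, auto)
            qed
          qed
        qed
        then show "(\<lambda>i. ((?F (X i) - ?F z) - ((-?p) * (X i - z) + (-?q) * cnj (X i - z))) /\<^sub>R norm (X i - z)) \<longlonglongrightarrow> 0"
          unfolding eq by simp
      qed
      then have "(?F has_derivative (\<lambda>h. (-?p) * h + (-?q) * cnj h)) (at z within U)"
        using bl by (simp add: has_derivative_at_within)
      then show "(?F has_derivative (\<lambda>h. (-?p) * h + (-?q) * cnj h)) (at z)"
        using at_within_open[OF z U(1)] by simp
    qed
qed

section \<open>Integrals of compactly supported functions and their derivatives\<close>

lemma lborel_integral_translate:
  fixes F :: "complex \<Rightarrow> complex"
  assumes [measurable]: "F \<in> borel_measurable borel"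
  shows "(\<integral>z. F (z + c) \<partial>lborel) = (\<integral>z. F z \<partial>lborel)"
proof -
  have "(\<integral>z. F z \<partial>lborel) = (\<integral>z. F z \<partial>distr lborel borel (\<lambda>x. c + x))"
    by (simp add: lborel_distr_plus)
  also have "\<dots> = (\<integral>z. F (c + z) \<partial>lborel)" by (rule integral_distr) auto
  finally show ?thesis by (simp add: add.commute)
qed

lemma compact_support_bounded:
  fixes f :: "complex \<Rightarrow> complex"
  assumes "continuous_on UNIV f" "\<And>z. z \<notin> cball 0 R \<Longrightarrow> f z = 0"
  obtains C where "C \<ge> 0" "\<And>z. norm (f z) \<le> C"
proof -
  have "compact (f ` cball 0 R)"
    by (intro compact_continuous_image compact_cball) (use assms continuous_on_subset[OF assms(1)] in auto)
  then obtain C where "\<And>z. z \<in> cball 0 R \<Longrightarrow> norm (f z) \<le> C"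
    by (metis compact_imp_bounded bounded_iff image_eqI)
  then have "norm (f z) \<le> max 0 C" for z
    using assms(2)[of z] by (cases "z \<in> cball 0 R") (auto simp: le_max_iff_disj)
  then show ?thesis by (intro that[of "max 0 C"]) auto
qed

lemma compact_support_integrable:
  fixes f :: "complex \<Rightarrow> complex"
  assumes "continuous_on UNIV f" "\<And>z. z \<notin> cball 0 R \<Longrightarrow> f z = 0"
  shows "integrable lborel f"
proof -
  have "integrable lborel (\<lambda>z. indicator (cball 0 R) z *\<^sub>R f z)"
    by (rule borel_integrable_compact) (use assms continuous_on_subset[OF assms(1)] in auto)
  also have "(\<lambda>z. indicator (cball 0 R) z *\<^sub>R f z) = f"
    using assms(2) by (auto simp: fun_eq_iff indicator_def)
  finally show ?thesis .
qed

text \<open>The directional derivative is the limit of difference quotients, and each of them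
  integrates to \<open>0\<close> by translation invariance of Lebesgue measure. The integrations by
  parts in the plane are reduced to this fact.\<close>

lemma integral_derivative_compact_support:
  fixes v :: complex
  assumes F: "wirt UNIV F p q" and z: "\<And>z. z \<notin> cball 0 R \<Longrightarrow> F z = 0"
  shows "(\<integral>z. p z * v + q z * cnj v \<partial>lborel) = 0"
proof -
  note c = wirt_cont[OF F]
  have z': "p z = 0" "q z = 0" if "z \<notin> cball 0 R" for z
    using wirt_zero_outside[OF F closed_cball z that] by auto
  obtain C1 where C1: "\<And>z. norm (p z) \<le> C1" using compact_support_bounded[OF c(2) z'(1)] by blast
  obtain C2 where C2: "\<And>z. norm (q z) \<le> C2" using compact_support_bounded[OF c(3) z'(2)] by blast
  define C where "C = max C1 C2"
  have C: "norm (p z) \<le> C" "norm (q z) \<le> C" for z using C1[of z] C2[of z] by (auto simp: C_def)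
  have C0: "C \<ge> 0" using C(1)[of 0] norm_ge_zero order_trans by blast
  have [measurable]: "F \<in> borel_measurable borel" "p \<in> borel_measurable borel" "q \<in> borel_measurable borel"
    using c by (auto intro: borel_measurable_continuous_onI)
  have iF: "integrable lborel F" by (rule compact_support_integrable[OF c(1) z])
  have iF': "integrable lborel (\<lambda>z. F (z + w))" for w
  proof -
    have "continuous_on UNIV (\<lambda>z. F (z + w))" by (intro continuous_on_compose2[OF c(1)] continuous_intros) auto
    moreover have "F (z + w) = 0" if "z \<notin> cball 0 (R + norm w)" for z
    proof -
      have "norm z \<le> norm (z + w) + norm w" by (metis add_diff_cancel norm_triangle_ineq4)
      then show ?thesis using that by (intro z) auto
    qed
    ultimately show ?thesis by (rule compact_support_integrable)
  qed
  define s where "s n z = (F (z + v / of_nat (Suc n)) - F z) * of_nat (Suc n)" for n z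
  have "(\<lambda>n. \<integral>z. s n z \<partial>lborel) \<longlonglongrightarrow> (\<integral>z. p z * v + q z * cnj v \<partial>lborel)"
  \<comment> \<open>Each shift is at most \<open>norm v\<close>, so the quotients vanish outside the
    ball of radius \<open>R + norm v\<close>; inside, the Lipschitz bound of \<open>F\<close>
    cancels the factor \<open>Suc n\<close>.\<close>
  proof (rule integral_dominated_convergence[where w="\<lambda>z. indicator (cball 0 (R + norm v)) z * (2 * C * norm v)"])
    show "integrable lborel (\<lambda>z. indicator (cball 0 (R + norm v)) z * (2 * C * norm v))"
      by (intro integrable_mult_left integrable_real_indicator) (use emeasure_lborel_cball_finite[of 0 "R + norm v"] in \<open>auto simp: less_top\<close>)
    show "AE z in lborel. (\<lambda>i. s i z) \<longlonglongrightarrow> p z * v + q z * cnj v"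
    proof (rule AE_I2)
      fix z
      show "(\<lambda>i. s i z) \<longlonglongrightarrow> p z * v + q z * cnj v"
      proof (cases "v = 0")
        case True then show ?thesis by (simp add: s_def)
      next
        case False
        define X where "X i = z + v / of_nat (Suc i)" for i
        have "((\<lambda>y. ((F y - F z) - (p z * (y - z) + q z * cnj (y - z))) /\<^sub>R norm (y - z)) \<longlongrightarrow> 0) (at z)"
          using wirt_D[OF F, of z] by (simp add: has_derivative_at_within)
        moreover have "X \<longlonglongrightarrow> z"
        proof -
          have "(\<lambda>i. z + v * (1 / of_nat (Suc i))) \<longlonglongrightarrow> z + v * 0"
            using LIMSEQ_Suc[OF lim_1_over_n[where 'a=complex]] by (intro tendsto_intros) (simp)
          then show ?thesis by (simp add: X_def[abs_def])
        qed
        moreover have "X i \<noteq> z" for i using False by (simp add: X_def del: of_nat_Suc)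
        ultimately have "(\<lambda>i. ((F (X i) - F z) - (p z * (X i - z) + q z * cnj (X i - z))) /\<^sub>R norm (X i - z)) \<longlonglongrightarrow> 0"
          unfolding tendsto_at_iff_sequentially comp_def by blast
        then have "(\<lambda>i. norm v *\<^sub>R (((F (X i) - F z) - (p z * (X i - z) + q z * cnj (X i - z))) /\<^sub>R norm (X i - z))) \<longlonglongrightarrow> norm v *\<^sub>R 0"
          by (intro tendsto_intros)
        moreover have "norm v *\<^sub>R (((F (X i) - F z) - (p z * (X i - z) + q z * cnj (X i - z))) /\<^sub>R norm (X i - z)) = s i z - (p z * v + q z * cnj v)" for i
        proof -
          have n: "norm v / norm (X i - z) = real (Suc i)" using False by (simp add: X_def norm_divide del: of_nat_Suc)
          have "X i - z = v / of_nat (Suc i)" by (simp add: X_def)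
          then have X2: "(X i - z) * of_nat (Suc i) = v" "cnj (X i - z) * of_nat (Suc i) = cnj v" by (simp_all del: of_nat_Suc)
          have "norm v *\<^sub>R (((F (X i) - F z) - (p z * (X i - z) + q z * cnj (X i - z))) /\<^sub>R norm (X i - z))
             = (norm v / norm (X i - z)) *\<^sub>R ((F (X i) - F z) - (p z * (X i - z) + q z * cnj (X i - z)))"
            by (simp add: divide_inverse)
          also have "\<dots> = of_nat (Suc i) * (F (X i) - F z) - (p z * ((X i - z) * of_nat (Suc i)) + q z * (cnj (X i - z) * of_nat (Suc i)))"
            unfolding n by (simp add: scaleR_conv_of_real algebra_simps)
          also have "\<dots> = s i z - (p z * v + q z * cnj v)"
            unfolding X2 by (simp add: s_def X_def mult.commute)
          finally show ?thesis .
        qed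
        ultimately have "(\<lambda>i. s i z - (p z * v + q z * cnj v)) \<longlonglongrightarrow> 0" by simp
        then show ?thesis by (rule LIM_zero_cancel)
      qed
    qed
    show "AE z in lborel. norm (s i z) \<le> indicator (cball 0 (R + norm v)) z * (2 * C * norm v)" for i
    proof (rule AE_I2)
      fix z
      have "norm v / real (Suc i) \<le> norm v / 1" by (rule divide_left_mono) auto
      then have vn: "norm (v / of_nat (Suc i)) \<le> norm v" by (simp add: norm_divide del: of_nat_Suc)
      show "norm (s i z) \<le> indicator (cball 0 (R + norm v)) z * (2 * C * norm v)"
      proof (cases "z \<in> cball 0 (R + norm v)")
        case True
        have "norm (F (z + v / of_nat (Suc i)) - F z) \<le> 2 * C * norm ((z + v / of_nat (Suc i)) - z)"
          by (rule wirt_lipschitz[OF F C convex_UNIV]) auto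
        also have "\<dots> = 2 * C * norm v / real (Suc i)" by (simp add: norm_divide del: of_nat_Suc)
        finally have "norm (s i z) \<le> 2 * C * norm v / real (Suc i) * real (Suc i)"
          unfolding s_def norm_mult norm_of_nat by (rule mult_right_mono) auto
        also have "\<dots> = 2 * C * norm v" by (simp del: of_nat_Suc)
        finally show ?thesis using True by simp
      next
        case False
        have "norm z \<le> norm (z + v / of_nat (Suc i)) + norm (v / of_nat (Suc i))" by (metis add_diff_cancel norm_triangle_ineq4)
        then have "norm (z + v / of_nat (Suc i)) > R" using False vn by (auto simp del: of_nat_Suc)
        moreover have "norm z > R" using False norm_ge_zero[of v] by (simp add: not_le del: norm_ge_zero)
        ultimately have "s i z = 0" using z by (simp add: s_def)
        then show ?thesis using C0 by simp
      qed
    qed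
    show "s i \<in> borel_measurable lborel" for i unfolding s_def by measurable
  qed measurable
  moreover have "(\<integral>z. s n z \<partial>lborel) = 0" for n
    using iF iF' lborel_integral_translate[of F] unfolding s_def by simp
  ultimately show ?thesis by (simp add: LIMSEQ_const_iff)
qed

subsection \<open>Mollification of test functions\<close>

text \<open>
  \<open>bump n\<close> is the \<open>n\<close>-th derivative of \<open>exp (- 1 / (1 - x\<^sup>2))\<close>, extended by \<open>0\<close> outside \<open>(-1, 1)\<close>;
  \<open>bump_poly n\<close> is its numerator over the denominator \<open>(1 - x\<^sup>2)\<close> to the power \<open>2 n\<close>.
\<close>

fun bump_poly :: "nat \<Rightarrow> real poly" where
  "bump_poly 0 = 1"
| "bump_poly (Suc n) = pderiv (bump_poly n) * [:1, 0, -1:]\<^sup>2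
     + [:0, 4 * real n:] * bump_poly n * [:1, 0, -1:] - [:0, 2:] * bump_poly n"

definition bump :: "nat \<Rightarrow> real \<Rightarrow> real" where
  "bump n x = (if \<bar>x\<bar> < 1 then poly (bump_poly n) x / (1 - x\<^sup>2) ^ (2 * n) * exp (- (1 / (1 - x\<^sup>2))) else 0)"

lemma power_le_fact_exp:
  fixes t :: real
  assumes "t \<ge> 0" shows "t ^ n \<le> fact n * exp t"
proof -
  have "(\<Sum>k\<in>{n}. t ^ k /\<^sub>R fact k) \<le> (\<Sum>k. t ^ k /\<^sub>R fact k)"
    using assms by (intro sum_le_suminf summable_exp_generic) auto
  then show ?thesis by (simp add: exp_def field_simps)
qed

lemma DERIV_zero_quadratic:
  fixes f :: "real \<Rightarrow> real"
  assumes "\<And>y. \<bar>f y - f x\<bar> \<le> K * (y - x)\<^sup>2"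
  shows "(f has_real_derivative 0) (at x)"
  unfolding DERIV_def
proof (rule tendsto_0_le[where K=1 and f="\<lambda>h. K * h"])
  show "((\<lambda>h. K * h) \<longlongrightarrow> 0) (at 0)" by (auto intro!: tendsto_eq_intros)
  have "norm ((f (x + h) - f x) / h) \<le> norm (K * h) * 1" if "h \<noteq> 0" for h
  proof -
    have "\<bar>f (x + h) - f x\<bar> \<le> \<bar>K\<bar> * h\<^sup>2"
      using assms[of "x + h"] by (simp add: order_trans[OF _ mult_right_mono[OF abs_ge_self]])
    then have "\<bar>f (x + h) - f x\<bar> / \<bar>h\<bar> \<le> \<bar>K\<bar> * h\<^sup>2 / \<bar>h\<bar>" by (rule divide_right_mono) simp
    also have "\<bar>K\<bar> * h\<^sup>2 / \<bar>h\<bar> = \<bar>K\<bar> * \<bar>h\<bar>" using that by (simp add: power2_eq_square abs_if)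
    finally show ?thesis by (simp add: abs_mult)
  qed
  then show "\<forall>\<^sub>F h in at 0. norm ((f (x + h) - f x) / h) \<le> norm (K * h) * 1"
    by (auto simp: eventually_at_filter)
qed

text \<open>Inside the interval the recursion of \<open>bump_poly\<close> is the quotient rule. At
  the endpoints exponential decay beats the power in the denominator, which yields a quadratic bound
  and hence derivative \<open>0\<close>.\<close>

lemma bump_DERIV: "(bump n has_real_derivative bump (Suc n) x) (at x)"
proof -
  consider "\<bar>x\<bar> < 1" | "\<bar>x\<bar> > 1" | "\<bar>x\<bar> = 1" by linarith
  then show ?thesis
  proof cases
    case 1
    define u where "u = 1 - x\<^sup>2"
    have u: "u > 0" using 1 by (simp add: u_def abs_square_less_1)
    define G where "G = (\<lambda>x::real. poly (bump_poly n) x / (1 - x\<^sup>2) ^ (2 * n) * exp (- (1 / (1 - x\<^sup>2))))"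
    let ?p = "poly (bump_poly n) x" and ?p' = "poly (pderiv (bump_poly n)) x" and ?E = "exp (- (1 / u))"
    have dE: "((\<lambda>x. exp (- (1 / (1 - x\<^sup>2)))) has_real_derivative ?E * (- (2 * x) / u\<^sup>2)) (at x)"
      using u unfolding u_def by (auto intro!: derivative_eq_intros simp: power2_eq_square)
    have dw: "((\<lambda>x. 1 / (1 - x\<^sup>2)) has_real_derivative 2 * x / u\<^sup>2) (at x)"
      using u unfolding u_def by (auto intro!: derivative_eq_intros simp: power2_eq_square)
    have dq: "((\<lambda>x. (1 / (1 - x\<^sup>2)) ^ (2 * n)) has_real_derivative real (2 * n) * (2 * x / u\<^sup>2) * (1 / u) ^ (2 * n - 1)) (at x)"
      using DERIV_power[OF dw, of "2 * n"] by (simp add: u_def algebra_simps)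
    have eq0: "real (2 * n) * (2 * x / u\<^sup>2) * (1 / u) ^ (2 * n - 1) = 4 * real n * x * u / u ^ (2 * n + 2)"
    proof (cases n)
      case (Suc m)
      then show ?thesis using u by (simp add: field_simps power2_eq_square)
    qed auto
    have "(G has_real_derivative (?p' * (1/u)^(2*n) + (4 * real n * x * u / u ^ (2 * n + 2)) * ?p) * ?E
        + (?E * (- (2 * x) / u\<^sup>2)) * (?p * (1/u)^(2*n))) (at x)"
      using DERIV_mult[OF DERIV_mult[OF poly_DERIV[of "bump_poly n" x] dq] dE] unfolding eq0
      by (simp add: G_def u_def power_divide)
    also have "(?p' * (1/u)^(2*n) + (4 * real n * x * u / u ^ (2 * n + 2)) * ?p) * ?E
        + (?E * (- (2 * x) / u\<^sup>2)) * (?p * (1/u)^(2*n)) = bump (Suc n) x"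
    proof -
      have pu: "poly [:1, 0, -1:] x = u" by (simp add: u_def power2_eq_square)
      have "poly (bump_poly (Suc n)) x = ?p' * u\<^sup>2 + 4 * real n * x * ?p * u - 2 * x * ?p"
        by (simp only: bump_poly.simps poly_add poly_diff poly_mult poly_power pu) simp
      then have "bump (Suc n) x = (?p' * u\<^sup>2 + 4 * real n * x * ?p * u - 2 * x * ?p) / u ^ (2 * n + 2) * ?E"
        using 1 by (simp only: bump_def u_def[symmetric] if_True) simp
      moreover have "(1/u)^(2*n) = u\<^sup>2 / u ^ (2*n+2)" using u by (simp add: power_divide power_add power2_eq_square)
      moreover have "?E * (- (2 * x) / u\<^sup>2) * (?p * (u\<^sup>2 / u ^ (2*n+2))) = ?E * (- (2 * x) * ?p) / u ^ (2*n+2)"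
        using u by simp
      ultimately show ?thesis by (simp only: add_divide_distrib diff_divide_distrib) (simp add: algebra_simps)
    qed
    finally have "(G has_real_derivative bump (Suc n) x) (at x)" .
    moreover have "open {x::real. \<bar>x\<bar> < 1}" by (intro open_Collect_less continuous_intros)
    ultimately show ?thesis
      by (rule has_field_derivative_transform_within_open) (use 1 in \<open>auto simp: G_def bump_def\<close>)
  next
    case 2
    have "((\<lambda>x. 0) has_real_derivative 0) (at x)" by simp
    moreover have "open {x::real. \<bar>x\<bar> > 1}" by (intro open_Collect_less continuous_intros)
    ultimately have "(bump n has_real_derivative 0) (at x)"
      by (rule has_field_derivative_transform_within_open) (use 2 in \<open>auto simp: bump_def\<close>)
    then show ?thesis using 2 by (simp add: bump_def)
  next
    case 3
    obtain M where M: "\<And>y. y \<in> {-1..1} \<Longrightarrow> norm (poly (bump_poly n) y) \<le> M"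
    proof -
      have "compact (poly (bump_poly n) ` {-1..1})" by (intro compact_continuous_image continuous_intros) auto
      then show ?thesis using that by (metis compact_imp_bounded bounded_iff image_eqI)
    qed
    have M0: "M \<ge> 0" using M[of 0] by (meson norm_ge_zero order_trans atLeastAtMost_iff neg_le_0_iff_le zero_le_one)
    let ?K = "M * fact (2 * n + 2) * 4"
    have x0: "bump n x = 0" using 3 by (simp add: bump_def)
    have "\<bar>bump n y - bump n x\<bar> \<le> ?K * (y - x)\<^sup>2" for y
    proof (cases "\<bar>y\<bar> < 1")
      case False
      then have "bump n y = 0" by (simp add: bump_def)
      then show ?thesis using M0 x0 by simp
    next
      case True
      define u where "u = 1 - y\<^sup>2"
      have u: "u > 0" using True by (simp add: u_def abs_square_less_1)
      have ux: "\<bar>u\<bar> \<le> 2 * \<bar>y - x\<bar>"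
      proof -
        have "u = (x - y) * (x + y)" using 3 by (auto simp: u_def power2_eq_square abs_if algebra_simps split: if_splits)
        then have "\<bar>u\<bar> = \<bar>y - x\<bar> * \<bar>x + y\<bar>" by (simp add: abs_mult abs_minus_commute)
        also have "\<dots> \<le> \<bar>y - x\<bar> * 2" using True 3 by (intro mult_left_mono) auto
        finally show ?thesis by simp
      qed
      \<comment> \<open>Two powers more than the denominator \<open>u ^ (2*n)\<close> requires: they
        leave a factor \<open>u\<^sup>2\<close>, and \<open>u\<close> is at most
        \<open>2 * \<bar>y - x\<bar>\<close>, whence the factor \<open>4\<close> in
        \<open>?K\<close>.\<close>
      have "(1/u) ^ (2*n+2) \<le> fact (2*n+2) * exp (1/u)" using u by (intro power_le_fact_exp) simp
      then have "(1/u) ^ (2*n+2) * (u\<^sup>2 * exp (- (1/u))) \<le> fact (2*n+2) * exp (1/u) * (u\<^sup>2 * exp (- (1/u)))"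
        by (rule mult_right_mono) simp
      also have "fact (2*n+2) * exp (1/u) * (u\<^sup>2 * exp (- (1/u))) = fact (2*n+2) * u\<^sup>2"
        by (simp add: exp_minus)
      also have "(1/u) ^ (2*n+2) * (u\<^sup>2 * exp (- (1/u))) = exp (- (1/u)) / u ^ (2*n)"
        using u by (simp add: power_divide power_add power2_eq_square field_simps)
      finally have A: "exp (- (1/u)) / u ^ (2*n) \<le> fact (2*n+2) * u\<^sup>2" .
      have "\<bar>bump n y\<bar> = \<bar>poly (bump_poly n) y\<bar> * (exp (- (1/u)) / u ^ (2*n))"
        using True u by (simp add: bump_def abs_mult u_def)
      also have "\<dots> \<le> M * (fact (2*n+2) * u\<^sup>2)"
        using M[of y] True M0 A u by (intro mult_mono) (simp_all add: abs_less_iff)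
      also have "M * (fact (2*n+2) * u\<^sup>2) \<le> M * (fact (2*n+2) * (4 * (y - x)\<^sup>2))"
        using power_mono[OF ux, of 2] M0 by (intro mult_left_mono) (simp_all only: power_mult_distrib power2_abs abs_ge_zero fact_ge_zero, simp)
      also have "\<dots> = ?K * (y - x)\<^sup>2" by (simp only: mult_ac)
      finally show ?thesis using x0 by simp
    qed
    then have "(bump n has_real_derivative 0) (at x)" by (rule DERIV_zero_quadratic)
    then show ?thesis using 3 by (simp add: bump_def)
  qed
qed

lemma bump_cont: "continuous_on UNIV (bump n)"
  using bump_DERIV by (intro DERIV_continuous_on) (auto intro: has_field_derivative_at_within)

text \<open>The partial derivative of order \<open>i\<close> in \<open>x\<close> and
  \<open>j\<close> in \<open>y\<close> of a tensor product of bumps. A product reduces smoothness to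
  one variable; its support is a square rather than a disc, contained in the disc of radius
  \<open>2\<close>.\<close>

definition bump2 :: "nat \<Rightarrow> nat \<Rightarrow> complex \<Rightarrow> complex" where
  "bump2 i j z = of_real (bump i (Re z)) * of_real (bump j (Im z))"

lemma wirt_Re: "wirt U (\<lambda>z. of_real (Re z)) (\<lambda>z. 1/2) (\<lambda>z. 1/2)"
proof -
  have eq: "(\<lambda>z. complex_of_real (Re z)) = (\<lambda>z. (1/2) * (z + cnj z))"
    by (auto simp: fun_eq_iff complex_eq_iff)
  show ?thesis unfolding eq using wirt_cmult[OF wirt_add[OF wirt_id wirt_cnj_id], of U "1/2"] by simp
qed

lemma wirt_Im: "wirt U (\<lambda>z. of_real (Im z)) (\<lambda>z. -\<i>/2) (\<lambda>z. \<i>/2)"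
proof -
  have eq: "(\<lambda>z. complex_of_real (Im z)) = (\<lambda>z. (-\<i>/2) * (z + (-1) * cnj z))"
    by (auto simp: fun_eq_iff complex_eq_iff)
  show ?thesis unfolding eq using wirt_cmult[OF wirt_add[OF wirt_id wirt_cmult[OF wirt_cnj_id]], of U "-\<i>/2" "-1"] by simp
qed

lemma bump2_wirt:
  "wirt UNIV (bump2 i j) (\<lambda>z. (bump2 (Suc i) j z - \<i> * bump2 i (Suc j) z) / 2)
     (\<lambda>z. (bump2 (Suc i) j z + \<i> * bump2 i (Suc j) z) / 2)"
proof -
  have "wirt UNIV (\<lambda>z. of_real (bump i (Re z)) * of_real (bump j (Im z)))
    (\<lambda>z. (of_real (bump (Suc i) (Re z)) * (1/2)) * of_real (bump j (Im z)) + of_real (bump i (Re z)) * (of_real (bump (Suc j) (Im z)) * (-\<i>/2)))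
    (\<lambda>z. (of_real (bump (Suc i) (Re z)) * (1/2)) * of_real (bump j (Im z)) + of_real (bump i (Re z)) * (of_real (bump (Suc j) (Im z)) * (\<i>/2)))"
    by (intro wirt_mult wirt_real_compose wirt_Re wirt_Im bump_DERIV bump_cont)
  then show ?thesis
    by (rule wirt_cong) (auto simp: bump2_def field_simps)
qed

lemma bump2_support: "z \<notin> cball 0 2 \<Longrightarrow> bump2 i j z = 0"
proof -
  assume "z \<notin> cball 0 2"
  then have "norm z > 2" by simp
  then have "\<bar>Re z\<bar> \<ge> 1 \<or> \<bar>Im z\<bar> \<ge> 1" using cmod_le[of z] by linarith
  then show ?thesis by (auto simp: bump2_def bump_def)
qed

text \<open>\<open>p + q\<close> and \<open>\<i> * (p - q)\<close> are the derivatives in the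
  directions \<open>1\<close> and \<open>\<i>\<close>, in which \<open>Ck\<close> is
  phrased.\<close>

lemma Ck_Suc_wirt:
  assumes "wirt UNIV f p q" "Ck k (\<lambda>z. p z + q z)" "Ck k (\<lambda>z. \<i> * (p z - q z))"
  shows "Ck (Suc k) f"
proof -
  have d: "(f has_derivative (\<lambda>h. p z * h + q z * cnj h)) (at z)" for z by (rule wirt_D[OF assms(1)]) simp
  have fd: "frechet_derivative f (at z) = (\<lambda>h. p z * h + q z * cnj h)" for z
    using frechet_derivative_at[OF d] by simp
  have "(\<lambda>z. frechet_derivative f (at z) 1) = (\<lambda>z. p z + q z)"
    "(\<lambda>z. frechet_derivative f (at z) \<i>) = (\<lambda>z. \<i> * (p z - q z))"
    by (auto simp: fd algebra_simps)
  then show ?thesis using assms d by (auto simp: differentiable_def)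
qed

lemma wirt_scale:
  assumes "wirt UNIV f p q"
  shows "wirt UNIV (\<lambda>z. f (of_real c * z)) (\<lambda>z. of_real c * p (of_real c * z)) (\<lambda>z. of_real c * q (of_real c * z))"
  unfolding wirt_def
proof (intro conjI ballI)
  fix z
  have "((\<lambda>z. f (of_real c * z)) has_derivative (\<lambda>h. p (of_real c * z) * (of_real c * h) + q (of_real c * z) * cnj (of_real c * h))) (at z)"
    using wirt_D[OF assms, of "of_real c * z"]
    by (intro has_derivative_compose[of "\<lambda>z. of_real c * z" "\<lambda>h. of_real c * h" z UNIV f]) (auto intro!: derivative_eq_intros)
  then show "((\<lambda>z. f (of_real c * z)) has_derivative (\<lambda>h. of_real c * p (of_real c * z) * h + of_real c * q (of_real c * z) * cnj h)) (at z)"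
    by (simp add: algebra_simps)
qed (intro continuous_intros continuous_on_compose2[OF wirt_cont(2)[OF assms]] continuous_on_compose2[OF wirt_cont(3)[OF assms]]; auto)+

lemma bump2_bounded: obtains C where "C \<ge> 0" "\<And>z. norm (bump2 i j z) \<le> C"
  using compact_support_bounded[OF wirt_cont(1)[OF bump2_wirt] bump2_support] by blast

lemma bump2_measurable [measurable]: "bump2 i j \<in> borel_measurable borel"
  by (intro borel_measurable_continuous_onI wirt_cont(1)[OF bump2_wirt])

text \<open>All derivatives fall on the bump and only raise its indices, so that, up to constant
  factors, the family \<open>E\<close> is closed under differentiation and \<open>Ck\<close> follows
  for every order by induction.\<close>

lemma bump2_conv_wirt:
  fixes g :: "complex \<Rightarrow> complex" and N :: real
  assumes g: "integrable lborel g"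
  defines "E \<equiv> \<lambda>i j z. \<integral>\<zeta>. g \<zeta> * bump2 i j (of_real N * (\<zeta> - z)) \<partial>lborel"
  shows "wirt UNIV (E i j) (\<lambda>z. - (of_real N * (E (Suc i) j z - \<i> * E i (Suc j) z) / 2))
     (\<lambda>z. - (of_real N * (E (Suc i) j z + \<i> * E i (Suc j) z) / 2))"
proof -
  obtain C0 where C0: "\<And>z. norm (bump2 i j z) \<le> C0" using bump2_bounded by blast
  obtain C1 where C1: "\<And>z. norm (bump2 (Suc i) j z) \<le> C1" using bump2_bounded by blast
  obtain C2 where C2: "\<And>z. norm (bump2 i (Suc j) z) \<le> C2" using bump2_bounded by blast
  define C where "C = max C0 (\<bar>N\<bar> * (C1 + C2))"
  have int: "integrable lborel (\<lambda>\<zeta>. g \<zeta> * bump2 i j (of_real N * (\<zeta> - z)))" for i j z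
  proof -
    obtain C where C: "C \<ge> 0" "\<And>z. norm (bump2 i j z) \<le> C" using bump2_bounded by blast
    show ?thesis
    proof (rule Bochner_Integration.integrable_bound[where f="\<lambda>\<zeta>. of_real C * g \<zeta>"])
      show "integrable lborel (\<lambda>\<zeta>. of_real C * g \<zeta>)" using g by simp
      have [measurable]: "g \<in> borel_measurable borel" using g by auto
      show "(\<lambda>\<zeta>. g \<zeta> * bump2 i j (of_real N * (\<zeta> - z))) \<in> borel_measurable lborel" by measurable
      show "AE \<zeta> in lborel. norm (g \<zeta> * bump2 i j (of_real N * (\<zeta> - z))) \<le> norm (of_real C * g \<zeta>)"
        using mult_right_mono[OF C(2) norm_ge_zero] C(1) by (intro AE_I2) (simp add: norm_mult mult.commute[of "norm (g _)"])
    qed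
  qed
  let ?p = "\<lambda>z. of_real N * ((bump2 (Suc i) j (of_real N * z) - \<i> * bump2 i (Suc j) (of_real N * z)) / 2)"
  let ?q = "\<lambda>z. of_real N * ((bump2 (Suc i) j (of_real N * z) + \<i> * bump2 i (Suc j) (of_real N * z)) / 2)"
  have w: "wirt UNIV (\<lambda>z. bump2 i j (of_real N * z)) ?p ?q"
    by (rule wirt_scale[OF bump2_wirt])
  have bnd: "norm (x + y) / 2 \<le> C1 + C2" "norm (x - y) / 2 \<le> C1 + C2" if "norm x \<le> C1" "norm y \<le> C2" for x y :: complex
    using norm_triangle_ineq[of x y] norm_triangle_ineq4[of x y] norm_ge_zero[of x] norm_ge_zero[of y] that by linarith+
  have C2i: "norm (\<i> * bump2 i (Suc j) z) \<le> C2" for z using C2 by (simp add: norm_mult)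
  have "wirt UNIV (\<lambda>z. \<integral>\<zeta>. g \<zeta> * bump2 i j (of_real N * (\<zeta> - z)) \<partial>lborel) (\<lambda>z. - (\<integral>\<zeta>. g \<zeta> * ?p (\<zeta> - z) \<partial>lborel))
     (\<lambda>z. - (\<integral>\<zeta>. g \<zeta> * ?q (\<zeta> - z) \<partial>lborel))"
  proof (rule wirt_convolution[where V=UNIV and C=C, OF g _ _ _ _ w])
    fix z
    show "norm (bump2 i j (of_real N * z)) \<le> C" using C0[of "of_real N * z"] by (simp add: C_def)
    have "norm (?p z) \<le> \<bar>N\<bar> * (C1 + C2)"
      unfolding norm_mult norm_divide using bnd(2)[OF C1 C2i, of "of_real N * z" "of_real N * z"] by (intro mult_mono) auto
    then show "norm (?p z) \<le> C" by (simp add: C_def)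
    have "norm (?q z) \<le> \<bar>N\<bar> * (C1 + C2)"
      unfolding norm_mult norm_divide using bnd(1)[OF C1 C2i, of "of_real N * z" "of_real N * z"] by (intro mult_mono) auto
    then show "norm (?q z) \<le> C" by (simp add: C_def)
  qed auto
  moreover have "(\<integral>\<zeta>. g \<zeta> * ?p (\<zeta> - z) \<partial>lborel) = of_real N * (E (Suc i) j z - \<i> * E i (Suc j) z) / 2" for z
  proof -
    have "(\<integral>\<zeta>. g \<zeta> * ?p (\<zeta> - z) \<partial>lborel) = (\<integral>\<zeta>. (of_real N / 2) * (g \<zeta> * bump2 (Suc i) j (of_real N * (\<zeta> - z)) - \<i> * (g \<zeta> * bump2 i (Suc j) (of_real N * (\<zeta> - z)))) \<partial>lborel)"
      by (intro Bochner_Integration.integral_cong) (simp_all add: field_simps)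
    also have "\<dots> = (of_real N / 2) * (E (Suc i) j z - \<i> * E i (Suc j) z)"
      using int unfolding E_def by simp
    finally show ?thesis by simp
  qed
  moreover have "(\<integral>\<zeta>. g \<zeta> * ?q (\<zeta> - z) \<partial>lborel) = of_real N * (E (Suc i) j z + \<i> * E i (Suc j) z) / 2" for z
  proof -
    have "(\<integral>\<zeta>. g \<zeta> * ?q (\<zeta> - z) \<partial>lborel) = (\<integral>\<zeta>. (of_real N / 2) * (g \<zeta> * bump2 (Suc i) j (of_real N * (\<zeta> - z)) + \<i> * (g \<zeta> * bump2 i (Suc j) (of_real N * (\<zeta> - z)))) \<partial>lborel)"
      by (intro Bochner_Integration.integral_cong) (simp_all add: field_simps)
    also have "\<dots> = (of_real N / 2) * (E (Suc i) j z + \<i> * E i (Suc j) z)"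
      using int unfolding E_def by simp
    finally show ?thesis by simp
  qed
  ultimately show ?thesis by (simp add: E_def)
qed

lemma Ck_cmult:
  assumes "Ck k f" shows "Ck k (\<lambda>z. c * f z)"
  using assms
proof (induction k arbitrary: f)
  case (Suc k)
  then have d: "f differentiable (at z)" for z by auto
  have d': "((\<lambda>z. c * f z) has_derivative (\<lambda>h. c * frechet_derivative f (at z) h)) (at z)" for z
    by (intro has_derivative_mult_right frechet_derivative_works[THEN iffD1] d)
  then have "frechet_derivative (\<lambda>z. c * f z) (at z) = (\<lambda>h. c * frechet_derivative f (at z) h)" for z
    using frechet_derivative_at by metis
  then show ?case using Suc d' by (auto simp: differentiable_def)
qed (auto intro!: continuous_intros)

lemma bump2_conv_Ck:
  fixes g :: "complex \<Rightarrow> complex"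
  assumes g: "integrable lborel g"
  shows "Ck k (\<lambda>z. \<integral>\<zeta>. g \<zeta> * bump2 i j (of_real N * (\<zeta> - z)) \<partial>lborel)"
proof (induction k arbitrary: i j)
  case 0
  show ?case using wirt_cont(1)[OF bump2_conv_wirt[OF g]] by simp
next
  case (Suc k)
  show ?case
  proof (rule Ck_Suc_wirt[OF bump2_conv_wirt[OF g]])
    let ?E = "\<lambda>i j z. \<integral>\<zeta>. g \<zeta> * bump2 i j (of_real N * (\<zeta> - z)) \<partial>lborel"
    have eq: "(\<lambda>z. - (of_real N * (?E (Suc i) j z - \<i> * ?E i (Suc j) z) / 2) + - (of_real N * (?E (Suc i) j z + \<i> * ?E i (Suc j) z) / 2))
      = (\<lambda>z. (- of_real N) * ?E (Suc i) j z)" by (auto simp: field_simps)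
    show "Ck k (\<lambda>z. - (of_real N * (?E (Suc i) j z - \<i> * ?E i (Suc j) z) / 2) + - (of_real N * (?E (Suc i) j z + \<i> * ?E i (Suc j) z) / 2))"
      unfolding eq by (rule Ck_cmult[OF Suc])
    have eq: "(\<lambda>z. \<i> * (- (of_real N * (?E (Suc i) j z - \<i> * ?E i (Suc j) z) / 2) - - (of_real N * (?E (Suc i) j z + \<i> * ?E i (Suc j) z) / 2)))
      = (\<lambda>z. (- of_real N) * ?E i (Suc j) z)" by (auto simp: field_simps)
    show "Ck k (\<lambda>z. \<i> * (- (of_real N * (?E (Suc i) j z - \<i> * ?E i (Suc j) z) / 2) - - (of_real N * (?E (Suc i) j z + \<i> * ?E i (Suc j) z) / 2)))"
      unfolding eq by (rule Ck_cmult[OF Suc])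
  qed
qed

section \<open>The normalised mollifier, its limit and its derivatives\<close>

lemma lborel_integral_affine:
  fixes F :: "complex \<Rightarrow> complex"
  assumes c: "c \<noteq> 0" and [measurable]: "F \<in> borel_measurable borel"
  shows "(\<integral>z. F z \<partial>lborel) = of_real (c\<^sup>2) * (\<integral>z. F (t + of_real c * z) \<partial>lborel)"
proof -
  have "(\<integral>z. F z \<partial>lborel) = (\<integral>z. F z \<partial>density (distr lborel borel (\<lambda>x. t + c *\<^sub>R x)) (\<lambda>_. ennreal (\<bar>c\<bar> ^ DIM(complex))))"
    by (subst lborel_affine[OF c, of t, symmetric]) simp
  also have "\<dots> = (\<integral>z. (\<bar>c\<bar> ^ DIM(complex)) *\<^sub>R F (t + c *\<^sub>R z) \<partial>lborel)"
    by (subst integral_density) (auto simp: integral_distr)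
  finally show ?thesis by (simp add: scaleR_conv_of_real)
qed

definition bump_mass :: real where "bump_mass = (\<integral>z. Re (bump2 0 0 z) \<partial>lborel)"

lemma bump_nonneg: "bump 0 x \<ge> 0"
  by (simp add: bump_def)

lemma bump2_integrable: "integrable lborel (bump2 i j)"
  by (rule compact_support_integrable[OF wirt_cont(1)[OF bump2_wirt] bump2_support])

text \<open>The exact value never matters, only that division by it is possible: a vanishing
  integral would make the bump zero almost everywhere on the unit disc, where it is
  positive.\<close>

lemma bump_mass_pos: "bump_mass > 0"
proof -
  have i: "integrable lborel (\<lambda>z. Re (bump2 0 0 z))" using bump2_integrable by (rule integrable_Re)
  have nn: "Re (bump2 0 0 z) \<ge> 0" for z by (simp add: bump2_def bump_nonneg)
  have "bump_mass \<ge> 0" unfolding bump_mass_def using nn by simp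
  moreover have "bump_mass \<noteq> 0"
  proof
    assume "bump_mass = 0"
    then have "AE z in lborel. Re (bump2 0 0 z) = 0"
      unfolding bump_mass_def using integral_nonneg_eq_0_iff_AE[OF i] nn by auto
    then have "AE z in lborel. z \<notin> ball (0::complex) 1"
    proof (rule eventually_mono, intro notI)
      fix z :: complex assume "Re (bump2 0 0 z) = 0" "z \<in> ball 0 1"
      moreover have "\<bar>Re z\<bar> < 1" "\<bar>Im z\<bar> < 1"
        using abs_Re_le_cmod[of z] abs_Im_le_cmod[of z] \<open>z \<in> ball 0 1\<close> by auto
      ultimately show False by (auto simp: bump2_def bump_def)
    qed
    then have "ball 0 1 \<in> null_sets (lborel :: complex measure)"
      by (subst AE_iff_null_sets) auto
    then have "negligible (ball (0::complex) 1)"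
      using null_sets_completionI negligible_iff_null_sets by blast
    then show False using open_not_negligible[of "ball (0::complex) 1"] by simp
  qed
  ultimately show ?thesis by simp
qed

lemma bump_mass_complex: "(\<integral>z. bump2 0 0 z \<partial>lborel) = of_real bump_mass"
proof -
  have "bump2 0 0 z = of_real (Re (bump2 0 0 z))" for z by (simp add: bump2_def)
  then have "(\<integral>z. bump2 0 0 z \<partial>lborel) = (\<integral>z. of_real (Re (bump2 0 0 z)) \<partial>lborel)" by simp
  then show ?thesis unfolding bump_mass_def by (simp only: integral_complex_of_real)
qed

text \<open>Convolution with the bump rescaled by \<open>Suc n\<close>; the prefactor is the area
  factor of the rescaling over the mass of the bump, so that the kernel has integral
  \<open>1\<close>.\<close>

definition mollify :: "(complex \<Rightarrow> complex) \<Rightarrow> nat \<Rightarrow> complex \<Rightarrow> complex" where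
  "mollify g n z = of_real ((real (Suc n))\<^sup>2 / bump_mass) * (\<integral>\<zeta>. g \<zeta> * bump2 0 0 (of_real (real (Suc n)) * (\<zeta> - z)) \<partial>lborel)"

lemma mollify_eq:
  assumes [measurable]: "g \<in> borel_measurable borel"
  shows "mollify g n z = (1 / of_real bump_mass) * (\<integral>x. g (z + of_real (1 / real (Suc n)) * x) * bump2 0 0 x \<partial>lborel)"
proof -
  have "(\<integral>\<zeta>. g \<zeta> * bump2 0 0 (of_real (real (Suc n)) * (\<zeta> - z)) \<partial>lborel) =
     of_real ((1 / real (Suc n))\<^sup>2) * (\<integral>x. g (z + of_real (1 / real (Suc n)) * x) * bump2 0 0 (of_real (real (Suc n)) * ((z + of_real (1 / real (Suc n)) * x) - z)) \<partial>lborel)"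
    by (rule lborel_integral_affine) auto
  also have "(\<lambda>x. g (z + of_real (1 / real (Suc n)) * x) * bump2 0 0 (of_real (real (Suc n)) * ((z + of_real (1 / real (Suc n)) * x) - z)))
     = (\<lambda>x. g (z + of_real (1 / real (Suc n)) * x) * bump2 0 0 x)"
    by (simp del: of_nat_Suc)
  finally show ?thesis unfolding mollify_def by (simp del: of_nat_Suc add: power_divide)
qed

lemma mollify_bound:
  assumes g: "continuous_on UNIV g" and C: "\<And>z. norm (g z) \<le> C"
  shows "norm (mollify g n z) \<le> C"
proof -
  have [measurable]: "g \<in> borel_measurable borel" using g by (rule borel_measurable_continuous_onI)
  have "norm (\<integral>x. g (z + of_real (1 / real (Suc n)) * x) * bump2 0 0 x \<partial>lborel) \<le> (\<integral>x. C * Re (bump2 0 0 x) \<partial>lborel)"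
  proof (rule Bochner_Integration.integral_norm_bound_integral)
    show "integrable lborel (\<lambda>x. C * Re (bump2 0 0 x))" using integrable_Re[OF bump2_integrable] by simp
    have le: "norm (g (z + of_real (1 / real (Suc n)) * x) * bump2 0 0 x) \<le> C * Re (bump2 0 0 x)" for x
    proof -
      have "norm (bump2 0 0 x) = Re (bump2 0 0 x)" by (simp add: bump2_def norm_mult bump_nonneg)
      then show ?thesis by (simp only: norm_mult) (intro mult_right_mono C, simp add: bump2_def bump_nonneg)
    qed
    then show "norm (g (z + of_real (1 / real (Suc n)) * x) * bump2 0 0 x) \<le> C * Re (bump2 0 0 x)" for x .
    show "integrable lborel (\<lambda>x. g (z + of_real (1 / real (Suc n)) * x) * bump2 0 0 x)"
      by (rule Bochner_Integration.integrable_bound[OF \<open>integrable lborel (\<lambda>x. C * Re (bump2 0 0 x))\<close>])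
        (use le order_trans[OF le abs_ge_self] in auto)
  qed
  also have "\<dots> = C * bump_mass" by (simp add: bump_mass_def)
  finally show ?thesis unfolding mollify_eq[OF \<open>g \<in> borel_measurable borel\<close>]
    using bump_mass_pos by (simp add: norm_mult norm_divide field_simps del: of_nat_Suc)
qed

lemma mollify_tendsto:
  assumes g: "continuous_on UNIV g" and C: "\<And>z. norm (g z) \<le> C"
  shows "(\<lambda>n. mollify g n z) \<longlonglongrightarrow> g z"
proof -
  have [measurable]: "g \<in> borel_measurable borel" using g by (rule borel_measurable_continuous_onI)
  have "(\<lambda>n. \<integral>x. g (z + of_real (1 / real (Suc n)) * x) * bump2 0 0 x \<partial>lborel) \<longlonglongrightarrow> (\<integral>x. g z * bump2 0 0 x \<partial>lborel)"
  proof (rule integral_dominated_convergence[where w="\<lambda>x. C * norm (bump2 0 0 x)"])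
    show "integrable lborel (\<lambda>x. C * norm (bump2 0 0 x))" using bump2_integrable by simp
    show "AE x in lborel. (\<lambda>n. g (z + of_real (1 / real (Suc n)) * x) * bump2 0 0 x) \<longlonglongrightarrow> g z * bump2 0 0 x"
    proof (rule AE_I2, intro tendsto_mult tendsto_const isCont_tendsto_compose[of z g])
      fix x
      show "isCont g z" using g by (simp add: continuous_on_eq_continuous_at)
      have "(\<lambda>n. 1 / real (Suc n)) \<longlonglongrightarrow> 0" using LIMSEQ_Suc[OF lim_1_over_n[where 'a=real]] by simp
      then have "(\<lambda>n. z + of_real (1 / real (Suc n)) * x) \<longlonglongrightarrow> z + of_real 0 * x"
        by (intro tendsto_intros)
      then show "(\<lambda>n. z + of_real (1 / real (Suc n)) * x) \<longlonglongrightarrow> z" by simp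
    qed
    show "AE x in lborel. norm (g (z + of_real (1 / real (Suc n)) * x) * bump2 0 0 x) \<le> C * norm (bump2 0 0 x)" for n
      by (intro AE_I2) (simp add: norm_mult mult_right_mono C del: of_real_divide of_nat_Suc)
  qed auto
  then have "(\<lambda>n. mollify g n z) \<longlonglongrightarrow> (1 / of_real bump_mass) * (\<integral>x. g z * bump2 0 0 x \<partial>lborel)"
    unfolding mollify_eq[OF \<open>g \<in> borel_measurable borel\<close>] by (intro tendsto_intros)
  then show ?thesis using bump_mass_pos bump2_integrable by (simp add: bump_mass_complex)
qed

text \<open>Differentiating under the integral hits the bump. The derivative of the product of
  \<open>f\<close> with the bump has integral \<open>0\<close>, which moves the derivative over to
  \<open>f\<close>.\<close>

lemma mollify_derivative:
  assumes f: "wirt UNIV f p q" and z: "\<And>z. z \<notin> cball 0 R \<Longrightarrow> f z = 0"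
  shows "frechet_derivative (mollify f n) (at z) v = mollify (\<lambda>z. p z * v + q z * cnj v) n z"
proof -
  let ?N = "real (Suc n)" let ?c = "of_real (?N\<^sup>2 / bump_mass) :: complex"
  define E where "E i j z = (\<integral>\<zeta>. f \<zeta> * bump2 i j (of_real ?N * (\<zeta> - z)) \<partial>lborel)" for i j z
  have fi: "integrable lborel f" by (rule compact_support_integrable[OF wirt_cont(1)[OF f] z])
  have "wirt UNIV (\<lambda>z. ?c * E 0 0 z) (\<lambda>z. ?c * (- (of_real ?N * (E (Suc 0) 0 z - \<i> * E 0 (Suc 0) z) / 2)))
     (\<lambda>z. ?c * (- (of_real ?N * (E (Suc 0) 0 z + \<i> * E 0 (Suc 0) z) / 2)))"
    unfolding E_def by (rule wirt_cmult[OF bump2_conv_wirt[OF fi]])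
  from wirt_D[OF this, of z] have
    "(mollify f n has_derivative (\<lambda>h. ?c * (- (of_real ?N * (E (Suc 0) 0 z - \<i> * E 0 (Suc 0) z) / 2)) * h
       + ?c * (- (of_real ?N * (E (Suc 0) 0 z + \<i> * E 0 (Suc 0) z) / 2)) * cnj h)) (at z)"
    unfolding E_def mollify_def[abs_def] by simp
  have alg1: "c * (- (N * (e1 - \<i> * e2) / 2)) * x + c * (- (N * (e1 + \<i> * e2) / 2)) * y
      = c * (- (N * (e1 - \<i> * e2) / 2) * x - (N * (e1 + \<i> * e2) / 2) * y)" for c N e1 e2 x y :: complex
    by (simp add: algebra_simps)
  \<comment> \<open>Splits the derivative of the product into the part with \<open>f\<close>
    differentiated and the parts with the bump differentiated in \<open>x\<close> and in
    \<open>y\<close>; \<open>w\<close> stands for \<open>cnj v\<close>.\<close>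
  have alg2: "(s * b + f * (N * ((x - \<i> * y) / 2))) * v + (t * b + f * (N * ((x + \<i> * y) / 2))) * w
      = (s * v + t * w) * b + (N * ((v + w) / 2) * (f * x) + N * (\<i> * (w - v) / 2) * (f * y))"
    for s t b f N x y v w :: complex
    by (simp add: field_simps)
  have alg3: "X = - (N * (e1 - \<i> * e2) / 2) * v - (N * (e1 + \<i> * e2) / 2) * w"
    if "X + (N * ((v + w) / 2) * e1 + N * (\<i> * (w - v) / 2) * e2) = 0" for X N e1 e2 v w :: complex
  proof -
    have "X = - (N * ((v + w) / 2) * e1 + N * (\<i> * (w - v) / 2) * e2)" using that by (simp only: add_eq_0_iff2)
    also have "\<dots> = - (N * (e1 - \<i> * e2) / 2) * v - (N * (e1 + \<i> * e2) / 2) * w" by (simp add: field_simps)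
    finally show ?thesis .
  qed
  from frechet_derivative_at[OF \<open>(mollify f n has_derivative _) _\<close>, symmetric]
  have fd: "frechet_derivative (mollify f n) (at z) v = ?c * (- (of_real ?N * (E (Suc 0) 0 z - \<i> * E 0 (Suc 0) z) / 2) * v
       - (of_real ?N * (E (Suc 0) 0 z + \<i> * E 0 (Suc 0) z) / 2) * cnj v)"
    by (simp only: alg1)
  define b where "b i j \<zeta> = bump2 i j (of_real ?N * (\<zeta> - z))" for i j \<zeta>
  have bw: "wirt UNIV (b 0 0) (\<lambda>\<zeta>. of_real ?N * ((b (Suc 0) 0 \<zeta> - \<i> * b 0 (Suc 0) \<zeta>) / 2)) (\<lambda>\<zeta>. of_real ?N * ((b (Suc 0) 0 \<zeta> + \<i> * b 0 (Suc 0) \<zeta>) / 2))"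
    unfolding wirt_def
  proof (intro conjI ballI)
    fix \<zeta>
    from wirt_D[OF wirt_scale[OF bump2_wirt[of 0 0], of ?N], of "\<zeta> - z"]
    show "(b 0 0 has_derivative (\<lambda>h. of_real ?N * ((b (Suc 0) 0 \<zeta> - \<i> * b 0 (Suc 0) \<zeta>) / 2) * h + of_real ?N * ((b (Suc 0) 0 \<zeta> + \<i> * b 0 (Suc 0) \<zeta>) / 2) * cnj h)) (at \<zeta>)"
      unfolding b_def[abs_def]
      by (intro has_derivative_compose[of "\<lambda>\<zeta>. \<zeta> - z" "\<lambda>h. h" \<zeta> UNIV "\<lambda>x. bump2 0 0 (of_real ?N * x)"]) (auto intro!: derivative_eq_intros)
    have cb: "continuous_on UNIV (b i j)" for i j
      unfolding b_def by (intro continuous_on_compose2[OF wirt_cont(1)[OF bump2_wirt]] continuous_intros) auto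
    show "continuous_on UNIV (\<lambda>\<zeta>. of_real ?N * ((b (Suc 0) 0 \<zeta> - \<i> * b 0 (Suc 0) \<zeta>) / 2))"
      "continuous_on UNIV (\<lambda>\<zeta>. of_real ?N * ((b (Suc 0) 0 \<zeta> + \<i> * b 0 (Suc 0) \<zeta>) / 2))"
      by (intro continuous_intros cb; simp)+
  qed
  let ?P = "\<lambda>\<zeta>. of_real ?N * ((b (Suc 0) 0 \<zeta> - \<i> * b 0 (Suc 0) \<zeta>) / 2)" and ?Q = "\<lambda>\<zeta>. of_real ?N * ((b (Suc 0) 0 \<zeta> + \<i> * b 0 (Suc 0) \<zeta>) / 2)"
  have zero: "(\<integral>\<zeta>. (p \<zeta> * b 0 0 \<zeta> + f \<zeta> * ?P \<zeta>) * v + (q \<zeta> * b 0 0 \<zeta> + f \<zeta> * ?Q \<zeta>) * cnj v \<partial>lborel) = 0"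
    by (rule integral_derivative_compact_support[OF wirt_mult[OF f bw], of R]) (use z in auto)
  have pq0: "p z = 0" "q z = 0" if "z \<notin> cball 0 R" for z
    using wirt_zero_outside[OF f closed_cball z that] by auto
  have cb: "continuous_on UNIV (b i j)" for i j
    unfolding b_def by (intro continuous_on_compose2[OF wirt_cont(1)[OF bump2_wirt]] continuous_intros) auto
  have ib: "integrable lborel (\<lambda>\<zeta>. f \<zeta> * b i j \<zeta>)" for i j
    by (rule compact_support_integrable[where R=R]) (use z wirt_cont(1)[OF f] cb in \<open>auto intro!: continuous_intros\<close>)
  have ipq: "integrable lborel (\<lambda>\<zeta>. (p \<zeta> * v + q \<zeta> * cnj v) * b 0 0 \<zeta>)"
    by (rule compact_support_integrable[where R=R]) (use pq0 wirt_cont[OF f] cb in \<open>auto intro!: continuous_intros\<close>)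
  have "(\<integral>\<zeta>. (p \<zeta> * v + q \<zeta> * cnj v) * b 0 0 \<zeta> + (of_real ?N * ((v + cnj v) / 2) * (f \<zeta> * b (Suc 0) 0 \<zeta>)
      + of_real ?N * (\<i> * (cnj v - v) / 2) * (f \<zeta> * b 0 (Suc 0) \<zeta>)) \<partial>lborel) = 0"
    unfolding zero[symmetric] by (intro Bochner_Integration.integral_cong refl) (simp only: alg2)
  then have "(\<integral>\<zeta>. (p \<zeta> * v + q \<zeta> * cnj v) * b 0 0 \<zeta> \<partial>lborel) + (of_real ?N * ((v + cnj v) / 2) * E (Suc 0) 0 z
      + of_real ?N * (\<i> * (cnj v - v) / 2) * E 0 (Suc 0) z) = 0"
    using ib ipq unfolding E_def b_def[symmetric] by (simp del: of_nat_Suc)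
  then have "(\<integral>\<zeta>. (p \<zeta> * v + q \<zeta> * cnj v) * b 0 0 \<zeta> \<partial>lborel) = - (of_real ?N * (E (Suc 0) 0 z - \<i> * E 0 (Suc 0) z) / 2) * v
       - (of_real ?N * (E (Suc 0) 0 z + \<i> * E 0 (Suc 0) z) / 2) * cnj v"
    by (rule alg3)
  note eq = this
  have "frechet_derivative (mollify f n) (at z) v = ?c * (\<integral>\<zeta>. (p \<zeta> * v + q \<zeta> * cnj v) * b 0 0 \<zeta> \<partial>lborel)"
    by (subst fd) (rule arg_cong[OF eq[symmetric]])
  also have "\<dots> = mollify (\<lambda>z. p z * v + q z * cnj v) n z"
    unfolding mollify_def b_def by (rule refl)
  finally show ?thesis .
qed

text \<open>The bump rescaled by \<open>Suc n\<close> lives in the disc of radius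
  \<open>2 / Suc n\<close>.\<close>

lemma mollify_support:
  assumes "\<And>z. z \<notin> K \<Longrightarrow> g z = 0" "2 / real (Suc n) < r" "z \<notin> {x + y | x y. x \<in> K \<and> y \<in> cball 0 r}"
  shows "mollify g n z = 0"
proof -
  have "g \<zeta> * bump2 0 0 (of_real (real (Suc n)) * (\<zeta> - z)) = 0" for \<zeta>
  proof (cases "\<zeta> \<in> K")
    case True
    have "z - \<zeta> \<notin> cball 0 r"
    proof
      assume "z - \<zeta> \<in> cball 0 r"
      with True have "\<exists>x y. z = x + y \<and> x \<in> K \<and> y \<in> cball 0 r" by (intro exI[of _ \<zeta>] exI[of _ "z - \<zeta>"]) auto
      with assms(3) show False by blast
    qed
    then have "norm (\<zeta> - z) > r" by (simp add: norm_minus_commute)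
    then have "norm (\<zeta> - z) > 2 / real (Suc n)" using assms(2) by linarith
    then have "real (Suc n) * norm (\<zeta> - z) > 2" by (simp add: field_simps del: of_nat_Suc)
    then have "norm (of_real (real (Suc n)) * (\<zeta> - z)) > 2" by (simp only: norm_mult norm_of_real abs_of_nat)
    then have "of_real (real (Suc n)) * (\<zeta> - z) \<notin> cball 0 2" by (simp only: mem_cball_0 not_le)
    then show ?thesis using bump2_support by simp
  qed (use assms in auto)
  then show ?thesis unfolding mollify_def by (simp only: Bochner_Integration.integral_zero mult_zero_right)
qed

text \<open>The definition of a weak derivative admits only smooth test functions, but those used
  below contain \<open>exp (- B)\<close>, a cutoff or a spline and are merely C^1. Their
  mollifications are smooth, are eventually supported in one compact subset of \<open>D\<close> and
  converge boundedly, together with their derivatives.\<close>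

lemma weak_partial_C1_test:
  assumes wp: "has_weak_partial D v f g" and D: "open D"
    and \<phi>: "wirt UNIV \<phi> p q" and K: "compact K" "K \<subseteq> D" and z: "\<And>z. z \<notin> K \<Longrightarrow> \<phi> z = 0"
  shows "(LINT z:D|lebesgue. f z * (p z * v + q z * cnj v)) = - (LINT z:D|lebesgue. g z * \<phi> z)"
proof -
  obtain R where R: "K \<subseteq> cball 0 R" using compact_imp_bounded[OF K(1)] by (auto simp: bounded_iff subset_iff)
  have zR: "\<phi> z = 0" if "z \<notin> cball 0 R" for z using z R that by blast
  obtain r where r: "r > 0" "{x + y |x y. x \<in> K \<and> y \<in> cball 0 r} \<subseteq> D"
  proof (cases "D = UNIV")
    case True then show ?thesis using that[of 1] by auto
  next
    case False
    have cD: "closed (- D)" using D by auto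
    obtain d where d: "d > 0" "\<forall>x\<in>K. \<forall>y\<in>-D. d \<le> dist x y"
      using separate_compact_closed[OF K(1) cD] K(2) by blast
    show ?thesis
    proof (rule that[of "d/2"])
      show "{x + y |x y. x \<in> K \<and> y \<in> cball 0 (d/2)} \<subseteq> D"
      proof safe
        fix x y :: complex assume xy: "x \<in> K" "y \<in> cball 0 (d/2)"
        show "x + y \<in> D"
        proof (rule ccontr)
          assume "x + y \<notin> D"
          then have "d \<le> dist x (x + y)" using d xy by auto
          then show False using xy d by (simp add: dist_norm)
        qed
      qed
    qed (use d in auto)
  qed
  \<comment> \<open>A compact neighbourhood of \<open>K\<close> in \<open>D\<close>, on which
    \<open>f\<close> and \<open>g\<close> are integrable; the shift by \<open>n0\<close> in
    \<open>m\<close> makes all the mollifications in use live in it.\<close>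
  define K' where "K' = {x + y |x y. x \<in> K \<and> y \<in> cball 0 r}"
  have cK': "compact K'" unfolding K'_def by (intro compact_sums K compact_cball)
  have K'D: "K' \<subseteq> D" using r K'_def by auto
  obtain n0 where n0: "2 / real (Suc n0) < r"
    using reals_Archimedean[of "r/2"] r(1) by (auto simp: field_simps)
  define m where "m k = k + n0" for k :: nat
  have mr: "2 / real (Suc (m k)) < r" for k
  proof -
    have "2 / real (Suc (m k)) \<le> 2 / real (Suc n0)" by (intro divide_left_mono) (auto simp: m_def)
    then show ?thesis using n0 by linarith
  qed
  let ?d = "\<lambda>z. p z * v + q z * cnj v"
  note c = wirt_cont[OF \<phi>]
  have pq0: "p z = 0" "q z = 0" if "z \<notin> K" for z
    using wirt_zero_outside[OF \<phi> compact_imp_closed[OF K(1)] z that] by auto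
  have dR: "?d z = 0" if "z \<notin> cball 0 R" for z using pq0[of z] R that by (cases "z \<in> K") auto
  have dc: "continuous_on UNIV ?d" by (intro continuous_intros c)
  have \<phi>i: "integrable lborel \<phi>" by (rule compact_support_integrable[OF c(1) zR])
  have di: "integrable lborel ?d" by (rule compact_support_integrable[OF dc dR])
  obtain C1 where C1: "\<And>z. norm (\<phi> z) \<le> C1" using compact_support_bounded[OF c(1) zR] by blast
  obtain C2 where C2: "\<And>z. norm (?d z) \<le> C2" using compact_support_bounded[OF dc dR] by blast
  have mz: "mollify \<phi> (m k) z = 0" if "z \<notin> K'" for k z
    by (rule mollify_support[OF z mr]) (use that K'_def in auto)
  have mdz: "mollify ?d (m k) z = 0" if "z \<notin> K'" for k z
    by (rule mollify_support[of K ?d, OF _ mr]) (use that K'_def pq0 in auto)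
  have Ckm: "Ck j (mollify h k)" if "integrable lborel h" for h k j
    unfolding mollify_def[abs_def] by (intro Ck_cmult bump2_conv_Ck that)
  have mc: "continuous_on UNIV (mollify h k)" if "integrable lborel h" for h k
    using Ckm[OF that, of 0] by simp
  have tf: "test_fun D (mollify \<phi> (m k))" for k
  proof -
    have "closure {z. mollify \<phi> (m k) z \<noteq> 0} \<subseteq> K'"
      by (rule closure_minimal) (use mz compact_imp_closed[OF cK'] in auto)
    then show ?thesis unfolding test_fun_def using Ckm[OF \<phi>i] K'D
      by (auto intro: compact_closure[THEN iffD2] bounded_subset[OF compact_imp_bounded[OF cK']] closure_subset[THEN subsetD])
  qed
  have lf: "set_integrable lebesgue K' f" and lg: "set_integrable lebesgue K' g"
    using wp cK' K'D unfolding has_weak_partial_def locally_integrable_on_def by auto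
  have eqn: "(LINT z:D|lebesgue. f z * mollify ?d (m k) z) = - (LINT z:D|lebesgue. g z * mollify \<phi> (m k) z)" for k
  proof -
    have "(LINT z:D|lebesgue. f z * frechet_derivative (mollify \<phi> (m k)) (at z) v) = - (LINT z:D|lebesgue. g z * mollify \<phi> (m k) z)"
      using wp tf[of k] unfolding has_weak_partial_def by blast
    then show ?thesis using mollify_derivative[OF \<phi> zR] by simp
  qed
  \<comment> \<open>Used on both sides of the weak identity: the mollifications are bounded by the
    bound \<open>C\<close> of \<open>h\<close>, so \<open>C\<close> times the modulus of
    \<open>F\<close> on \<open>K'\<close> dominates.\<close>
  have lim: "(\<lambda>k. LINT z:D|lebesgue. F z * mollify h (m k) z) \<longlonglongrightarrow> (LINT z:D|lebesgue. F z * h z)"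
    if F: "set_integrable lebesgue K' F" and hi: "integrable lborel h" and hc: "continuous_on UNIV h" and hC: "\<And>z. norm (h z) \<le> C"
      and h0: "\<And>z. z \<notin> K \<Longrightarrow> h z = 0" for F h C
  proof -
    have hz: "mollify h (m k) z = 0" if "z \<notin> K'" for k z
      by (rule mollify_support[OF h0 mr]) (use that K'_def in auto)
    have KK: "K \<subseteq> K'"
    proof
      fix x assume "x \<in> K"
      then have "x = x + 0 \<and> x \<in> K \<and> (0::complex) \<in> cball 0 r" using r by auto
      then show "x \<in> K'" unfolding K'_def by blast
    qed
    have [measurable]: "h \<in> borel_measurable lebesgue" "mollify h k \<in> borel_measurable lebesgue" for k
      using borel_measurable_continuous_onI[OF hc] borel_measurable_continuous_onI[OF mc[OF hi]]
      by (auto intro: measurable_completion)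
    have [measurable]: "(\<lambda>z. indicator K' z *\<^sub>R F z) \<in> borel_measurable lebesgue"
      using F unfolding set_integrable_def by auto
    have "(\<lambda>k. integral\<^sup>L lebesgue (\<lambda>z. (indicator K' z *\<^sub>R F z) * mollify h (m k) z)) \<longlonglongrightarrow> integral\<^sup>L lebesgue (\<lambda>z. (indicator K' z *\<^sub>R F z) * h z)"
    proof (rule integral_dominated_convergence[where w="\<lambda>z. C * norm (indicator K' z *\<^sub>R F z)"])
      show "integrable lebesgue (\<lambda>z. C * norm (indicator K' z *\<^sub>R F z))"
        using F unfolding set_integrable_def by (intro integrable_mult_right integrable_norm)
      show "AE z in lebesgue. (\<lambda>k. (indicator K' z *\<^sub>R F z) * mollify h (m k) z) \<longlonglongrightarrow> (indicator K' z *\<^sub>R F z) * h z"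
      proof (intro AE_I2 tendsto_mult tendsto_const)
        fix z show "(\<lambda>k. mollify h (m k) z) \<longlonglongrightarrow> h z"
          unfolding m_def by (rule LIMSEQ_ignore_initial_segment[OF mollify_tendsto[OF hc hC]])
      qed
      show "AE z in lebesgue. norm ((indicator K' z *\<^sub>R F z) * mollify h (m k) z) \<le> C * norm (indicator K' z *\<^sub>R F z)" for k
      proof (rule AE_I2)
        fix z
        show "norm ((indicator K' z *\<^sub>R F z) * mollify h (m k) z) \<le> C * norm (indicator K' z *\<^sub>R F z)"
          unfolding norm_mult by (subst mult.commute) (intro mult_right_mono mollify_bound hc hC norm_ge_zero)
      qed
    qed measurable
    moreover have "(\<lambda>z. (indicator K' z *\<^sub>R F z) * mollify h (m k) z) = (\<lambda>z. indicator D z *\<^sub>R (F z * mollify h (m k) z))" for k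
      using K'D hz[of _ k] by (auto simp: fun_eq_iff indicator_def)
    moreover have "(\<lambda>z. (indicator K' z *\<^sub>R F z) * h z) = (\<lambda>z. indicator D z *\<^sub>R (F z * h z))"
      using K'D KK h0 by (auto simp: fun_eq_iff indicator_def)
    ultimately show ?thesis by (simp add: set_lebesgue_integral_def)
  qed
  have 1: "(\<lambda>k. LINT z:D|lebesgue. f z * mollify ?d (m k) z) \<longlonglongrightarrow> (LINT z:D|lebesgue. f z * ?d z)"
    by (rule lim[OF lf di dc C2]) (use pq0 in auto)
  have 2: "(\<lambda>k. LINT z:D|lebesgue. g z * mollify \<phi> (m k) z) \<longlonglongrightarrow> (LINT z:D|lebesgue. g z * \<phi> z)"
    by (rule lim[OF lg \<phi>i c(1) C1 z])
  from tendsto_minus[OF 2] have "(\<lambda>k. LINT z:D|lebesgue. f z * mollify ?d (m k) z) \<longlonglongrightarrow> - (LINT z:D|lebesgue. g z * \<phi> z)"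
    unfolding eqn .
  then show ?thesis using LIMSEQ_unique 1 by blast
qed

subsection \<open>Lebesgue integrals over the complex plane\<close>

text \<open>Makes Tonelli's theorem in real coordinates available for the type
  \<open>complex\<close>; the two measures agree on boxes, which determines them.\<close>

lemma lborel_complex_eq: "(lborel :: complex measure) = distr (lborel \<Otimes>\<^sub>M lborel) borel (\<lambda>(x, y). Complex x y)"
proof (rule lborel_eqI)
  have m: "(\<lambda>(x, y). Complex x y) \<in> borel_measurable ((lborel :: real measure) \<Otimes>\<^sub>M (lborel :: real measure))"
  proof -
    have "(\<lambda>p::real \<times> real. complex_of_real (fst p) + \<i> * complex_of_real (snd p)) \<in> borel_measurable borel"
      by (intro borel_measurable_continuous_onI continuous_intros)
    then show ?thesis by (simp add: lborel_prod case_prod_unfold Complex_eq)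
  qed
  fix l u :: complex assume lu: "\<And>b. b \<in> Basis \<Longrightarrow> l \<bullet> b \<le> u \<bullet> b"
  have le: "Re l \<le> Re u" "Im l \<le> Im u" using lu[of 1] lu[of \<i>] by (auto simp: Basis_complex_def)
  have "emeasure (distr (lborel \<Otimes>\<^sub>M lborel) borel (\<lambda>(x, y). Complex x y)) (box l u)
     = emeasure (lborel \<Otimes>\<^sub>M lborel) ({Re l<..<Re u} \<times> {Im l<..<Im u})"
    by (subst emeasure_distr[OF m]) (auto intro!: arg_cong[where f="emeasure _"] simp: box_def Basis_complex_def space_pair_measure)
  also have "\<dots> = emeasure lborel {Re l<..<Re u} * emeasure lborel {Im l<..<Im u}"
    by (rule lborel.emeasure_pair_measure_Times) auto
  also have "\<dots> = (\<Prod>b\<in>Basis. (u - l) \<bullet> b)"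
    using le by (simp add: Basis_complex_def ennreal_mult'' complex_eq_iff)
  finally show "emeasure (distr (lborel \<Otimes>\<^sub>M lborel) borel (\<lambda>(x, y). Complex x y)) (box l u) = (\<Prod>b\<in>Basis. (u - l) \<bullet> b)" .
qed simp

lemma nn_integral_complex:
  fixes f :: "complex \<Rightarrow> ennreal"
  assumes [measurable]: "f \<in> borel_measurable borel"
  shows "(\<integral>\<^sup>+z. f z \<partial>lborel) = (\<integral>\<^sup>+x. \<integral>\<^sup>+y. f (Complex x y) \<partial>lborel \<partial>lborel)"
proof -
  have m: "(\<lambda>(x, y). Complex x y) \<in> borel_measurable ((lborel :: real measure) \<Otimes>\<^sub>M (lborel :: real measure))"
  proof -
    have "(\<lambda>p::real \<times> real. complex_of_real (fst p) + \<i> * complex_of_real (snd p)) \<in> borel_measurable borel"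
      by (intro borel_measurable_continuous_onI continuous_intros)
    then show ?thesis by (simp add: lborel_prod case_prod_unfold Complex_eq)
  qed
  note m[measurable]
  have "(\<integral>\<^sup>+z. f z \<partial>lborel) = (\<integral>\<^sup>+p. f ((\<lambda>(x, y). Complex x y) p) \<partial>(lborel \<Otimes>\<^sub>M lborel))"
    unfolding lborel_complex_eq by (rule nn_integral_distr[OF m]) simp
  also have "\<dots> = (\<integral>\<^sup>+x. \<integral>\<^sup>+y. f ((\<lambda>(x, y). Complex x y) (x, y)) \<partial>lborel \<partial>lborel)"
    by (rule lborel.nn_integral_fst[symmetric]) (rule measurable_compose[OF m], simp)
  finally show ?thesis by simp
qed

lemma nn_integral_powr_abs_finite:
  assumes s: "0 \<le> s" "s < 1" and R: "R \<ge> 0"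
  shows "(\<integral>\<^sup>+x. ennreal (indicator {-R..R} x * \<bar>x\<bar> powr (-s)) \<partial>lborel) < \<infinity>"
proof -
  have "((\<lambda>x. x powr (-s)) has_integral (R powr (-s+1) / (-s+1))) {0..R}"
    using has_integral_powr_from_0[of "-s" R] s R by simp
  then have 1: "(\<integral>\<^sup>+x. ennreal (indicator {0..R} x * x powr (-s)) \<partial>lborel) = ennreal (R powr (-s+1) / (-s+1))"
    by (intro nn_integral_has_integral_lebesgue) auto
  have 2: "(\<integral>\<^sup>+x. ennreal (indicator {0..R} (-x) * (-x) powr (-s)) \<partial>lborel) = (\<integral>\<^sup>+x. ennreal (indicator {0..R} x * x powr (-s)) \<partial>lborel)"
    using nn_integral_real_affine[of "\<lambda>x. ennreal (indicator {0..R} x * x powr (-s))" "-1" 0] by simp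
  have "(\<integral>\<^sup>+x. ennreal (indicator {-R..R} x * \<bar>x\<bar> powr (-s)) \<partial>lborel)
     \<le> (\<integral>\<^sup>+x. ennreal (indicator {0..R} x * x powr (-s)) + ennreal (indicator {0..R} (-x) * (-x) powr (-s)) \<partial>lborel)"
    by (intro nn_integral_mono) (auto simp: indicator_def abs_if ennreal_plus[symmetric] simp del: ennreal_plus)
  also have "\<dots> = (\<integral>\<^sup>+x. ennreal (indicator {0..R} x * x powr (-s)) \<partial>lborel) + (\<integral>\<^sup>+x. ennreal (indicator {0..R} (-x) * (-x) powr (-s)) \<partial>lborel)"
    by (rule nn_integral_add) auto
  also have "\<dots> < \<infinity>" unfolding 2 unfolding 1 by simp
  finally show ?thesis .
qed

text \<open>Polar coordinates are avoided: because of
  \<open>\<bar>Re w\<bar> * \<bar>Im w\<bar> \<le> (norm w)\<^sup>2\<close> the function is bounded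
  by the product of \<open>\<bar>Re w\<bar> powr (-(p/2))\<close> and
  \<open>\<bar>Im w\<bar> powr (-(p/2))\<close>, and these one-dimensional powers are locally
  integrable since \<open>p / 2 < 1\<close>.\<close>

lemma inverse_norm_powr_integrable:
  assumes p: "0 \<le> p" "p < 2"
  shows "integrable lborel (\<lambda>w::complex. indicator (cball 0 R) w * norm (1 / w) powr p)"
proof -
  define S where "S = \<bar>R\<bar>"
  define g where "g = (\<lambda>x::real. indicator {-S..S} x * \<bar>x\<bar> powr (-(p/2)))"
  have [measurable]: "g \<in> borel_measurable borel" unfolding g_def by measurable
  have gf: "(\<integral>\<^sup>+x. ennreal (g x) \<partial>lborel) < \<infinity>"
    unfolding g_def by (rule nn_integral_powr_abs_finite) (use p S_def in auto)
  have g0: "g x \<ge> 0" for x by (simp add: g_def)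
  define f where "f = (\<lambda>w::complex. indicator (cball 0 R) w * norm (1 / w) powr p)"
  have f0: "f w \<ge> 0" for w by (simp add: f_def)
  have le: "f w \<le> g (Re w) * g (Im w)" if "Re w \<noteq> 0" "Im w \<noteq> 0" for w
  proof (cases "w \<in> cball 0 R")
    case True
    then have "\<bar>Re w\<bar> \<le> S" "\<bar>Im w\<bar> \<le> S" using abs_Re_le_cmod[of w] abs_Im_le_cmod[of w] by (auto simp: S_def)
    then have g: "g (Re w) * g (Im w) = \<bar>Re w\<bar> powr (-(p/2)) * \<bar>Im w\<bar> powr (-(p/2))"
      by (simp add: g_def abs_le_iff minus_le_iff)
    have pos: "\<bar>Re w\<bar> * \<bar>Im w\<bar> > 0" using that by simp
    have "\<bar>Re w\<bar> * \<bar>Im w\<bar> \<le> norm w * norm w"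
      using abs_Re_le_cmod[of w] abs_Im_le_cmod[of w] by (intro mult_mono) auto
    then have le: "\<bar>Re w\<bar> * \<bar>Im w\<bar> \<le> (norm w)\<^sup>2" by (simp add: power2_eq_square)
    have nw: "norm w > 0" using that by auto
    have "f w = norm w powr (-p)" using True nw 
    proof -
      have "norm (1 / w) = norm w powr (-1)" using nw by (simp add: norm_divide powr_minus inverse_eq_divide)
      then have "norm (1 / w) powr p = norm w powr (-p)" by (simp only: powr_powr) simp
      then show ?thesis using True by (simp only: f_def) simp
    qed
    also have "\<dots> = ((norm w)\<^sup>2) powr (-(p/2))"
    proof -
      have "(norm w)\<^sup>2 = norm w powr 2" using nw by (simp add: powr_numeral)
      then have "((norm w)\<^sup>2) powr (-(p/2)) = norm w powr (2 * (-(p/2)))" by (simp only: powr_powr)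
      then show ?thesis by simp
    qed
    also have "\<dots> \<le> (\<bar>Re w\<bar> * \<bar>Im w\<bar>) powr (-(p/2))"
      using p pos le by (intro powr_mono2') auto
    also have "\<dots> = g (Re w) * g (Im w)" unfolding g by (simp add: powr_mult)
    finally show ?thesis .
  qed (simp add: f_def g0)
  have [measurable]: "cball (0::complex) R \<in> sets borel" by simp
  have fm: "f \<in> borel_measurable borel" unfolding f_def by measurable
  note fm[measurable]
  have "(\<integral>\<^sup>+w. ennreal (f w) \<partial>lborel) = (\<integral>\<^sup>+x. \<integral>\<^sup>+y. ennreal (f (Complex x y)) \<partial>lborel \<partial>lborel)"
    by (rule nn_integral_complex) simp
  also have "\<dots> \<le> (\<integral>\<^sup>+x. \<integral>\<^sup>+y. ennreal (g x) * ennreal (g y) \<partial>lborel \<partial>lborel)"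
  \<comment> \<open>The bound can fail on the axes, where the convention makes \<open>0 powr\<close>
    any exponent equal to \<open>0\<close>; these are null sets.\<close>
  proof (rule nn_integral_mono_AE)
    have ne: "AE x in lborel. x \<noteq> (0::real)" by (rule AE_lborel_singleton)
    show "AE x in lborel. (\<integral>\<^sup>+y. ennreal (f (Complex x y)) \<partial>lborel) \<le> (\<integral>\<^sup>+y. ennreal (g x) * ennreal (g y) \<partial>lborel)"
      using ne
    proof (rule eventually_mono)
      fix x :: real assume x: "x \<noteq> 0"
      show "(\<integral>\<^sup>+y. ennreal (f (Complex x y)) \<partial>lborel) \<le> (\<integral>\<^sup>+y. ennreal (g x) * ennreal (g y) \<partial>lborel)"
      proof (rule nn_integral_mono_AE)
        show "AE y in lborel. ennreal (f (Complex x y)) \<le> ennreal (g x) * ennreal (g y)"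
          using ne by (rule eventually_mono) (use le[of "Complex x _"] x g0 in \<open>auto simp: ennreal_mult[symmetric]\<close>)
      qed
    qed
  qed
  also have "\<dots> = (\<integral>\<^sup>+x. ennreal (g x) * (\<integral>\<^sup>+y. ennreal (g y) \<partial>lborel) \<partial>lborel)"
    by (intro nn_integral_cong nn_integral_cmult) auto
  also have "\<dots> = (\<integral>\<^sup>+x. ennreal (g x) \<partial>lborel) * (\<integral>\<^sup>+y. ennreal (g y) \<partial>lborel)"
    by (intro nn_integral_multc) auto
  also have "\<dots> < \<infinity>" using gf by (simp add: ennreal_mult_less_top less_top)
  finally have "(\<integral>\<^sup>+w. ennreal (f w) \<partial>lborel) < \<infinity>" .
  then have "integrable lborel f"
    by (intro integrableI_nonneg) (use f0 in auto)
  then show ?thesis unfolding f_def .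
qed

lemma nn_integral_FTC_real_line:
  fixes f F :: "real \<Rightarrow> real"
  assumes d: "\<And>x. (F has_real_derivative f x) (at x)" and c: "continuous_on UNIV f" and f0: "\<And>x. f x \<ge> 0"
    and A: "(F \<longlongrightarrow> A) at_bot" and B: "(F \<longlongrightarrow> B) at_top"
  shows "(\<integral>\<^sup>+x. ennreal (f x) \<partial>lborel) = ennreal (B - A)"
proof -
  have [measurable]: "f \<in> borel_measurable borel" using c by (rule borel_measurable_continuous_onI)
  have A': "((F \<circ> real_of_ereal) \<longlongrightarrow> A) (at_right (-\<infinity>))" and B': "((F \<circ> real_of_ereal) \<longlongrightarrow> B) (at_left \<infinity>)"
    unfolding ereal_tendsto_simps1 by (rule A, rule B)
  have cf: "isCont f x" for x using c by (simp add: continuous_on_eq_continuous_at)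
  have nn: "AE x in lborel. - \<infinity> < ereal x \<longrightarrow> ereal x < \<infinity> \<longrightarrow> 0 \<le> f x" using f0 by simp
  have lt: "- \<infinity> < (\<infinity>::ereal)" by simp
  have "set_integrable lborel (einterval (-\<infinity>) \<infinity>) f" "(LBINT x=-\<infinity>..\<infinity>. f x) = B - A"
    by (rule interval_integral_FTC_nonneg[OF lt d cf nn A' B'])+
  then have "integrable lborel f" "integral\<^sup>L lborel f = B - A"
    by (simp_all add: set_integrable_def interval_lebesgue_integral_def set_lebesgue_integral_def)
  then show ?thesis using nn_integral_eq_integral[of lborel f] f0 by simp
qed

lemma nn_integral_kernel_inner:
  fixes c :: real assumes c: "c > 0"
  shows "(\<integral>\<^sup>+y. ennreal (1 / (c\<^sup>2 + y\<^sup>2)\<^sup>2) \<partial>lborel) = ennreal (pi / (2 * c ^ 3))"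
proof -
  have pos: "c\<^sup>2 + y\<^sup>2 > 0" for y using c by (simp add: add_pos_nonneg)
  \<comment> \<open>The standard antiderivative of
    \<open>1 / (c\<^sup>2 + y\<^sup>2)\<^sup>2\<close>. The rational part vanishes at infinity, and
    the \<open>arctan\<close> part supplies the limit \<open>pi / (4 * c^3)\<close> at the top and
    its negative at the bottom.\<close>
  define F where "F = (\<lambda>y. y / (2 * c\<^sup>2 * (c\<^sup>2 + y\<^sup>2)) + arctan (y / c) / (2 * c ^ 3))"
  have "(\<integral>\<^sup>+y. ennreal (1 / (c\<^sup>2 + y\<^sup>2)\<^sup>2) \<partial>lborel) = ennreal (pi / (4 * c^3) - (- (pi / (4 * c^3))))"
  proof (rule nn_integral_FTC_real_line[where F=F])
    fix y
    have "(F has_real_derivative ((2 * c\<^sup>2 * (c\<^sup>2 + y\<^sup>2) - y * (2 * c\<^sup>2 * (2 * y))) / (2 * c\<^sup>2 * (c\<^sup>2 + y\<^sup>2))\<^sup>2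
       + (1 / c) * inverse (1 + (y / c)\<^sup>2) / (2 * c ^ 3))) (at y)"
    proof -
      have "((\<lambda>y. 2 * c\<^sup>2 * (c\<^sup>2 + y\<^sup>2)) has_real_derivative 2 * c\<^sup>2 * (2 * y)) (at y)"
        by (auto intro!: derivative_eq_intros)
      then have 1: "((\<lambda>y. y / (2 * c\<^sup>2 * (c\<^sup>2 + y\<^sup>2))) has_real_derivative
          (1 * (2 * c\<^sup>2 * (c\<^sup>2 + y\<^sup>2)) - y * (2 * c\<^sup>2 * (2 * y))) / ((2 * c\<^sup>2 * (c\<^sup>2 + y\<^sup>2)) * (2 * c\<^sup>2 * (c\<^sup>2 + y\<^sup>2)))) (at y)"
        by (rule DERIV_divide[OF DERIV_ident]) (use c pos[of y] in auto)
      have 2: "((\<lambda>y. arctan (y / c) / (2 * c ^ 3)) has_real_derivative inverse (1 + (y / c)\<^sup>2) * (1 / c) / (2 * c ^ 3)) (at y)"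
        by (rule DERIV_cdivide[OF DERIV_chain2[OF DERIV_arctan DERIV_cdivide[OF DERIV_ident]]])
      show ?thesis unfolding F_def using DERIV_add[OF 1 2]
        by (simp only: mult_1 power2_eq_square[of "2 * c\<^sup>2 * (c\<^sup>2 + y\<^sup>2)"] mult.commute[of "1 / c"])
    qed
    also have "(2 * c\<^sup>2 * (c\<^sup>2 + y\<^sup>2) - y * (2 * c\<^sup>2 * (2 * y))) / (2 * c\<^sup>2 * (c\<^sup>2 + y\<^sup>2))\<^sup>2
       = (c\<^sup>2 - y\<^sup>2) / (2 * c\<^sup>2 * (c\<^sup>2 + y\<^sup>2)\<^sup>2)"
    proof -
      have "2 * c\<^sup>2 * (c\<^sup>2 + y\<^sup>2) - y * (2 * c\<^sup>2 * (2 * y)) = (2 * c\<^sup>2) * (c\<^sup>2 - y\<^sup>2)" by (simp add: power2_eq_square algebra_simps)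
      moreover have "(2 * c\<^sup>2 * (c\<^sup>2 + y\<^sup>2))\<^sup>2 = (2 * c\<^sup>2) * (2 * c\<^sup>2 * (c\<^sup>2 + y\<^sup>2)\<^sup>2)" by (simp add: power2_eq_square)
      ultimately show ?thesis
        by (simp only:) (rule mult_divide_mult_cancel_left, use c in simp)
    qed
    also have "(1 / c) * inverse (1 + (y / c)\<^sup>2) / (2 * c ^ 3) = (c\<^sup>2 + y\<^sup>2) / (2 * c\<^sup>2 * (c\<^sup>2 + y\<^sup>2)\<^sup>2)"
    proof -
      have "inverse (1 + (y / c)\<^sup>2) = c\<^sup>2 / (c\<^sup>2 + y\<^sup>2)" using c pos[of y] by (simp add: field_simps)
      moreover have "(1 / c) * (c\<^sup>2 / D) / (2 * c ^ 3) = D / (2 * c\<^sup>2 * D\<^sup>2)" if "D > 0" for D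
        using c that by (simp add: field_simps power2_eq_square power3_eq_cube)
      ultimately show ?thesis using pos[of y] by simp
    qed
    also have "(c\<^sup>2 - y\<^sup>2) / (2 * c\<^sup>2 * (c\<^sup>2 + y\<^sup>2)\<^sup>2) + (c\<^sup>2 + y\<^sup>2) / (2 * c\<^sup>2 * (c\<^sup>2 + y\<^sup>2)\<^sup>2) = 1 / (c\<^sup>2 + y\<^sup>2)\<^sup>2"
      unfolding add_divide_distrib[symmetric] using c by simp
    finally show "(F has_real_derivative 1 / (c\<^sup>2 + y\<^sup>2)\<^sup>2) (at y)" .
  next
    show "continuous_on UNIV (\<lambda>y. 1 / (c\<^sup>2 + y\<^sup>2)\<^sup>2)"
      using pos by (intro continuous_intros) (auto simp: less_le)
    show "(F \<longlongrightarrow> - (pi / (4 * c^3))) at_bot" unfolding F_def using c by (real_asymp simp: field_simps)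
    show "(F \<longlongrightarrow> pi / (4 * c^3)) at_top" unfolding F_def using c by (real_asymp simp: field_simps)
  qed simp
  then show ?thesis by (simp add: field_simps)
qed

text \<open>Iterated integration in real coordinates: the inner integral is known with
  \<open>c = sqrt (1 + x\<^sup>2)\<close>, and the outer integrand has the antiderivative
  \<open>pi / 2 * (x / sqrt (1 + x\<^sup>2))\<close>. The value \<open>pi\<close> is what the factor
  \<open>1 / pi\<close> in \<open>T_op\<close> cancels.\<close>

lemma nn_integral_kernel_mass:
  "(\<integral>\<^sup>+w. ennreal (1 / ((norm (w::complex))\<^sup>2 + 1)\<^sup>2) \<partial>lborel) = ennreal pi"
proof -
  have "(\<integral>\<^sup>+w. ennreal (1 / ((norm (w::complex))\<^sup>2 + 1)\<^sup>2) \<partial>lborel) = (\<integral>\<^sup>+x. \<integral>\<^sup>+y. ennreal (1 / ((norm (Complex x y))\<^sup>2 + 1)\<^sup>2) \<partial>lborel \<partial>lborel)"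
    by (rule nn_integral_complex) simp
  also have "\<dots> = (\<integral>\<^sup>+x. ennreal (pi / (2 * sqrt (1 + x\<^sup>2) ^ 3)) \<partial>lborel)"
  proof (rule nn_integral_cong)
    fix x :: real
    have p: "1 + x\<^sup>2 > 0" by (simp add: add_pos_nonneg)
    have "ennreal (1 / ((norm (Complex x y))\<^sup>2 + 1)\<^sup>2) = ennreal (1 / ((sqrt (1 + x\<^sup>2))\<^sup>2 + y\<^sup>2)\<^sup>2)" for y
      using p by (simp add: cmod_power2 add_ac)
    then show "(\<integral>\<^sup>+y. ennreal (1 / ((norm (Complex x y))\<^sup>2 + 1)\<^sup>2) \<partial>lborel) = ennreal (pi / (2 * sqrt (1 + x\<^sup>2) ^ 3))"
      using nn_integral_kernel_inner[of "sqrt (1 + x\<^sup>2)"] p by (simp del: real_sqrt_pow2_iff real_sqrt_pow2)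
  qed
  also have "\<dots> = ennreal (pi / 2 - (- (pi / 2)))"
  proof (rule nn_integral_FTC_real_line[where F="\<lambda>x. pi / 2 * (x / sqrt (1 + x\<^sup>2))"])
    fix x :: real
    have p: "1 + x\<^sup>2 > 0" by (simp add: add_pos_nonneg)
    define s where "s = sqrt (1 + x\<^sup>2)"
    have s: "s > 0" "s\<^sup>2 = 1 + x\<^sup>2" using p by (simp_all add: s_def)
    have "((\<lambda>x. pi / 2 * (x / sqrt (1 + x\<^sup>2))) has_real_derivative pi / 2 * ((s - x * (x / s)) / s\<^sup>2)) (at x)"
    proof -
      have "((\<lambda>x. sqrt (1 + x\<^sup>2)) has_real_derivative x / s) (at x)"
        using p unfolding s_def by (auto intro!: derivative_eq_intros simp: field_simps)
      then have "((\<lambda>x. x / sqrt (1 + x\<^sup>2)) has_real_derivative (1 * s - x * (x / s)) / (s * s)) (at x)"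
        unfolding s_def by (rule DERIV_divide[OF DERIV_ident]) (use p in auto)
      from DERIV_cmult[OF this, of "pi / 2"] show ?thesis by (simp add: power2_eq_square)
    qed
    also have "(s - x * (x / s)) / s\<^sup>2 = 1 / s ^ 3"
    proof -
      have "s - x * (x / s) = (s\<^sup>2 - x\<^sup>2) / s" using s(1) by (simp add: field_simps power2_eq_square)
      also have "\<dots> = 1 / s" using s(2) by simp
      finally show ?thesis by (simp add: power3_eq_cube power2_eq_square)
    qed
    finally show "((\<lambda>x. pi / 2 * (x / sqrt (1 + x\<^sup>2))) has_real_derivative pi / (2 * sqrt (1 + x\<^sup>2) ^ 3)) (at x)"
      by (simp add: s_def)
  next
    show "continuous_on UNIV (\<lambda>x. pi / (2 * sqrt (1 + x\<^sup>2) ^ 3))"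
      by (intro continuous_intros) (auto simp: add_nonneg_eq_0_iff)
    show "((\<lambda>x. pi / 2 * (x / sqrt (1 + x\<^sup>2))) \<longlongrightarrow> - (pi / 2)) at_bot" by real_asymp
    show "((\<lambda>x. pi / 2 * (x / sqrt (1 + x\<^sup>2))) \<longlongrightarrow> pi / 2) at_top" by real_asymp
  qed auto
  finally show ?thesis by simp
qed

subsection \<open>The Cauchy transform\<close>

text \<open>
  A smooth approximation of the Cauchy kernel \<open>1 / w\<close>. Its derivative with respect to \<open>cnj w\<close> is \<open>\<pi>\<close>
  times an approximate identity.
\<close>

definition kern :: "real \<Rightarrow> complex \<Rightarrow> complex" where
  "kern \<epsilon> w = cnj w / (w * cnj w + of_real (\<epsilon>\<^sup>2))"

definition kern_z :: "real \<Rightarrow> complex \<Rightarrow> complex" where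
  "kern_z \<epsilon> w = - (cnj w)\<^sup>2 / (w * cnj w + of_real (\<epsilon>\<^sup>2))\<^sup>2"

definition kern_zbar :: "real \<Rightarrow> complex \<Rightarrow> complex" where
  "kern_zbar \<epsilon> w = of_real (\<epsilon>\<^sup>2) / (w * cnj w + of_real (\<epsilon>\<^sup>2))\<^sup>2"

lemma kern_denom: "w * cnj w + of_real (\<epsilon>\<^sup>2) = of_real ((norm w)\<^sup>2 + \<epsilon>\<^sup>2)"
  by (simp add: complex_norm_square[symmetric])

lemma kern_denom_pos: "\<epsilon> > 0 \<Longrightarrow> (norm w)\<^sup>2 + \<epsilon>\<^sup>2 > 0"
  by (simp add: add_nonneg_pos)

lemma kern_wirt:
  assumes e: "\<epsilon> > 0"
  shows "wirt UNIV (kern \<epsilon>) (kern_z \<epsilon>) (kern_zbar \<epsilon>)"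
proof -
  let ?d = "\<lambda>w. w * cnj w + of_real (\<epsilon>\<^sup>2)"
  have nz: "?d w \<noteq> 0" for w
    using kern_denom_pos[OF e, of w] unfolding kern_denom by (simp only: of_real_eq_0_iff)
  have wd: "wirt UNIV ?d cnj (\<lambda>w. w)"
    using wirt_add[OF wirt_mult[OF wirt_id wirt_cnj_id] wirt_const] by simp
  have wi: "wirt UNIV (\<lambda>w. inverse (?d w)) (\<lambda>w. - (inverse (?d w) * inverse (?d w)) * cnj w) (\<lambda>w. - (inverse (?d w) * inverse (?d w)) * w)"
  proof (rule wirt_compose_field[OF wd])
    show "(inverse has_field_derivative - (inverse (?d z) * inverse (?d z))) (at (?d z))" for z
      using DERIV_inverse[OF nz[of z]] by (simp add: numeral_2_eq_2)
    show "continuous_on (range ?d) (\<lambda>x. - (inverse x * inverse x))"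
      using nz by (intro continuous_intros) auto
  qed
  show ?thesis
  proof (rule wirt_cong[OF wirt_mult[OF wirt_cnj_id wi]])
    fix w
    define D where "D = ?d w"
    have D: "D \<noteq> 0" using nz D_def by simp
    have e2: "of_real (\<epsilon>\<^sup>2) = D - w * cnj w" by (simp add: D_def)
    show "cnj w * inverse (?d w) = kern \<epsilon> w" by (simp add: kern_def divide_inverse)
    show "0 * inverse (?d w) + cnj w * (- (inverse (?d w) * inverse (?d w)) * cnj w) = kern_z \<epsilon> w"
      unfolding kern_z_def D_def[symmetric] using D by (simp add: field_simps power2_eq_square)
    show "1 * inverse (?d w) + cnj w * (- (inverse (?d w) * inverse (?d w)) * w) = kern_zbar \<epsilon> w"
      unfolding kern_zbar_def D_def[symmetric] unfolding e2 using D by (simp add: field_simps power2_eq_square)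
  qed auto
qed

lemma kern_measurable [measurable]:
  "kern \<epsilon> \<in> borel_measurable borel" "kern_z \<epsilon> \<in> borel_measurable borel" "kern_zbar \<epsilon> \<in> borel_measurable borel"
proof -
  have [measurable]: "cnj \<in> borel_measurable borel" by (intro borel_measurable_continuous_onI continuous_intros)
  show "kern \<epsilon> \<in> borel_measurable borel" "kern_z \<epsilon> \<in> borel_measurable borel" "kern_zbar \<epsilon> \<in> borel_measurable borel"
    unfolding kern_def[abs_def] kern_z_def[abs_def] kern_zbar_def[abs_def] by measurable
qed

text \<open>The first three bounds degenerate with \<open>\<epsilon>\<close> and serve for a fixed
  kernel only, in differentiation under the integral and in Fubini's theorem. The last one does not
  depend on \<open>\<epsilon>\<close> and supplies the domination in the limit.\<close>

lemma kern_bounds: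
  assumes e: "\<epsilon> > 0"
  shows "norm (kern \<epsilon> w) \<le> 1 / \<epsilon>" "norm (kern_z \<epsilon> w) \<le> 1 / \<epsilon>\<^sup>2" "norm (kern_zbar \<epsilon> w) \<le> 1 / \<epsilon>\<^sup>2"
    "norm (kern \<epsilon> w) \<le> norm (1 / w)"
proof -
  define t where "t = norm w" define D where "D = t\<^sup>2 + \<epsilon>\<^sup>2"
  have t: "t \<ge> 0" by (simp add: t_def)
  have D: "D > 0" using kern_denom_pos[OF e, of w] by (simp add: D_def t_def)
  have nD: "norm (complex_of_real D) = D" using D by simp
  have k1: "norm (kern \<epsilon> w) = t / D"
    unfolding kern_def kern_denom norm_divide by (simp only: nD t_def[symmetric] D_def[symmetric] complex_mod_cnj)
  have k2: "norm (kern_z \<epsilon> w) = t\<^sup>2 / D\<^sup>2"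
    unfolding kern_z_def kern_denom norm_divide by (simp only: nD t_def[symmetric] D_def[symmetric] complex_mod_cnj norm_power norm_minus_cancel)
  have k3: "norm (kern_zbar \<epsilon> w) = \<epsilon>\<^sup>2 / D\<^sup>2"
    unfolding kern_zbar_def kern_denom norm_divide by (simp only: nD t_def[symmetric] D_def[symmetric] norm_power norm_of_real) simp
  have "t * \<epsilon> \<le> D" using sum_squares_bound[of t \<epsilon>] mult_nonneg_nonneg[OF t, of \<epsilon>] e unfolding D_def by linarith
  then show "norm (kern \<epsilon> w) \<le> 1 / \<epsilon>" unfolding k1 using D e by (simp add: field_simps)
  have le: "t\<^sup>2 * \<epsilon>\<^sup>2 \<le> D\<^sup>2" "\<epsilon>\<^sup>2 * \<epsilon>\<^sup>2 \<le> D\<^sup>2" unfolding power2_eq_square[of D]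
    by (rule mult_mono; simp add: D_def)+
  show "norm (kern_z \<epsilon> w) \<le> 1 / \<epsilon>\<^sup>2" unfolding k2 using le(1) D e by (simp add: field_simps)
  show "norm (kern_zbar \<epsilon> w) \<le> 1 / \<epsilon>\<^sup>2" unfolding k3 using le(2) D e by (simp add: field_simps)
  show "norm (kern \<epsilon> w) \<le> norm (1 / w)"
  proof (cases "w = 0")
    case False
    then have "t > 0" by (simp add: t_def)
    then have "t / D \<le> 1 / t" using D unfolding D_def by (simp add: field_simps power2_eq_square)
    then show ?thesis unfolding k1 by (simp add: norm_divide t_def)
  qed (simp add: kern_def)
qed

section \<open>Convergence of the regularised kernels and convolution with L^q functions\<close>

definition eps :: "nat \<Rightarrow> real" where "eps n = 1 / real (Suc n)"

lemma eps_pos: "eps n > 0" by (simp add: eps_def)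

lemma eps_tendsto: "eps \<longlonglongrightarrow> 0"
  using LIMSEQ_Suc[OF lim_1_over_n[where 'a=real]] by (simp add: eps_def[abs_def])

text \<open>At \<open>w = 0\<close> both sides are \<open>0\<close> because of the convention
  \<open>1 / 0 = 0\<close>, so the limit holds everywhere.\<close>

lemma kern_tendsto: "(\<lambda>n. kern (eps n) w) \<longlonglongrightarrow> 1 / w"
proof (cases "w = 0")
  case False
  have "(\<lambda>n. kern (eps n) w) \<longlonglongrightarrow> cnj w / (w * cnj w + of_real (0\<^sup>2))"
    unfolding kern_def by (intro tendsto_intros eps_tendsto) (use False in simp)
  then show ?thesis using False by simp
qed (simp add: kern_def)

text \<open>Takes the place of Hoelder's inequality: with a small weight \<open>s\<close> on the
  \<open>q\<close>-th power, an integral of a product becomes small as soon as the second factor is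
  small in the conjugate exponent \<open>q / (q - 1)\<close>.\<close>

lemma young_eps:
  fixes q s :: real
  assumes q: "q > 2" and s: "s > 0"
  obtains c where "c \<ge> 0" "\<And>a b. a \<ge> 0 \<Longrightarrow> b \<ge> 0 \<Longrightarrow> a * b \<le> s * a powr q + c * b powr (q / (q - 1))"
proof -
  define p where "p = q / (q - 1)"
  \<comment> \<open>Chosen so that the scaled factor \<open>t * a\<close> has \<open>q\<close>-th
    power \<open>s * a powr q\<close>; the inverse scaling of \<open>b\<close> goes into the
    constant \<open>c\<close>.\<close>
  define t where "t = s powr (1 / q)"
  have t: "t > 0" using s by (simp add: t_def)
  have tq: "t powr q = s" using s q by (simp add: t_def powr_powr)
  have p: "p > 1" "1 / q + 1 / p = 1" using q by (auto simp: p_def field_simps)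
  show ?thesis
  proof (rule that[of "(1/t) powr p"])
    fix a b :: real assume ab: "a \<ge> 0" "b \<ge> 0"
    have "a * b = (t * a) * (b / t)" using t by simp
    also have "\<dots> \<le> (t * a) powr q / q + (b / t) powr p / p"
      by (rule Youngs_inequality) (use p q t ab in auto)
    also have "\<dots> \<le> (t * a) powr q / 1 + (b / t) powr p / 1"
      using p q by (intro add_mono divide_left_mono) auto
    also have "\<dots> = s * a powr q + (1/t) powr p * b powr p"
      using ab t by (simp add: powr_mult tq powr_divide)
    finally show "a * b \<le> s * a powr q + (1/t) powr p * b powr (q / (q - 1))" by (simp add: p_def)
  qed simp
qed

text \<open>Borel functions, defined on the whole plane and carried by a fixed disc: measurability
  of products and translates as well as Fubini's theorem then work over \<open>lborel\<close>.
  Functions that are L^q on \<open>D\<close> are replaced by such representatives.\<close>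

definition Lqc :: "real \<Rightarrow> real \<Rightarrow> (complex \<Rightarrow> complex) \<Rightarrow> bool" where
  "Lqc q R a \<longleftrightarrow> a \<in> borel_measurable borel \<and> integrable lborel (\<lambda>z. norm (a z) powr q) \<and> (\<forall>z. z \<notin> cball 0 R \<longrightarrow> a z = 0)"

text \<open>The inequality \<open>Y\<close> is applied pointwise and integrated. For
  \<open>\<zeta>\<close> in the disc of radius \<open>R\<close> and \<open>norm z \<le> R0\<close>
  only the values of \<open>d\<close> on the disc of radius \<open>R + R0\<close> occur, and
  translation invariance makes the bound independent of \<open>z\<close>.\<close>

lemma Lqc_conv_bound:
  assumes a: "Lqc q R a" and [measurable]: "d \<in> borel_measurable borel"
    and J: "integrable lborel (\<lambda>w. indicator (cball 0 (R + R0)) w * norm (d w) powr p)"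
    and z: "norm z \<le> R0" and Y: "\<And>a b. a \<ge> 0 \<Longrightarrow> b \<ge> 0 \<Longrightarrow> a * b \<le> s * a powr q + c * b powr p" and c: "c \<ge> 0" "s \<ge> 0"
  shows "integrable lborel (\<lambda>\<zeta>. a \<zeta> * d (\<zeta> - z))"
    "norm (\<integral>\<zeta>. a \<zeta> * d (\<zeta> - z) \<partial>lborel) \<le> s * (\<integral>z. norm (a z) powr q \<partial>lborel) + c * (\<integral>w. indicator (cball 0 (R + R0)) w * norm (d w) powr p \<partial>lborel)"
proof -
  have am[measurable]: "a \<in> borel_measurable borel" and aq: "integrable lborel (\<lambda>z. norm (a z) powr q)"
    and a0: "\<And>z. z \<notin> cball 0 R \<Longrightarrow> a z = 0" using a by (auto simp: Lqc_def)
  let ?g = "\<lambda>w. indicator (cball 0 (R + R0)) w * norm (d w) powr p :: real"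
  have [measurable]: "cball (0::complex) (R + R0) \<in> sets borel" by simp
  have gm: "?g \<in> borel_measurable borel" by measurable
  have g0: "?g w \<ge> 0" for w by simp
  have dg: "distr lborel borel (\<lambda>\<zeta>. - z + \<zeta>) = (lborel :: complex measure)" by (rule lborel_distr_plus)
  have Ji: "integrable lborel (\<lambda>\<zeta>. ?g (\<zeta> - z))"
  proof -
    have "integrable (distr lborel borel (\<lambda>\<zeta>. - z + \<zeta>)) ?g" unfolding dg by (rule J)
    then have "integrable lborel (\<lambda>\<zeta>. ?g (- z + \<zeta>))" by (subst (asm) integrable_distr_eq) (use gm in auto)
    then show ?thesis by (simp add: add.commute)
  qed
  have Je: "(\<integral>\<zeta>. ?g (\<zeta> - z) \<partial>lborel) = (\<integral>w. ?g w \<partial>lborel)"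
  proof -
    have "(\<integral>w. ?g w \<partial>lborel) = (\<integral>w. ?g w \<partial>distr lborel borel (\<lambda>\<zeta>. - z + \<zeta>))" unfolding dg ..
    also have "\<dots> = (\<integral>\<zeta>. ?g (- z + \<zeta>) \<partial>lborel)" by (rule integral_distr) (use gm in auto)
    finally show ?thesis by (simp add: add.commute)
  qed
  have bi: "integrable lborel (\<lambda>\<zeta>. s * norm (a \<zeta>) powr q + c * ?g (\<zeta> - z))" using aq Ji by simp
  have le: "norm (a \<zeta> * d (\<zeta> - z)) \<le> s * norm (a \<zeta>) powr q + c * ?g (\<zeta> - z)" for \<zeta>
  proof (cases "\<zeta> \<in> cball 0 R")
    case True
    have "norm (\<zeta> - z) \<le> norm \<zeta> + norm z" by (rule norm_triangle_ineq4)
    then have "\<zeta> - z \<in> cball 0 (R + R0)" using True z by simp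
    then show ?thesis using Y[of "norm (a \<zeta>)" "norm (d (\<zeta> - z))"] by (simp add: norm_mult)
  next
    case False
    have "0 \<le> s * norm (a \<zeta>) powr q + c * ?g (\<zeta> - z)" using c g0 by (intro add_nonneg_nonneg mult_nonneg_nonneg) auto
    then show ?thesis using a0[OF False] by simp
  qed
  have [measurable]: "(\<lambda>\<zeta>. d (\<zeta> - z)) \<in> borel_measurable borel" by measurable
  show i: "integrable lborel (\<lambda>\<zeta>. a \<zeta> * d (\<zeta> - z))"
    by (rule Bochner_Integration.integrable_bound[OF bi]) (use order_trans[OF le abs_ge_self] in auto)
  have "norm (\<integral>\<zeta>. a \<zeta> * d (\<zeta> - z) \<partial>lborel) \<le> (\<integral>\<zeta>. s * norm (a \<zeta>) powr q + c * ?g (\<zeta> - z) \<partial>lborel)"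
    by (rule Bochner_Integration.integral_norm_bound_integral[OF i bi le])
  also have "\<dots> = s * (\<integral>z. norm (a z) powr q \<partial>lborel) + c * (\<integral>\<zeta>. ?g (\<zeta> - z) \<partial>lborel)"
    using aq Ji by simp
  finally show "norm (\<integral>\<zeta>. a \<zeta> * d (\<zeta> - z) \<partial>lborel) \<le> s * (\<integral>z. norm (a z) powr q \<partial>lborel) + c * (\<integral>w. ?g w \<partial>lborel)"
    unfolding Je .
qed

lemma Lqc_integrable:
  assumes "Lqc q R a" "q > 2" shows "integrable lborel a"
proof -
  obtain c where c: "c \<ge> 0" "\<And>a b. a \<ge> 0 \<Longrightarrow> b \<ge> 0 \<Longrightarrow> a * b \<le> 1 * a powr q + c * b powr (q / (q - 1))"
    using young_eps[OF assms(2), of 1] by auto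
  \<comment> \<open>The convolution bound is applied to the constant kernel \<open>1\<close>,
    evaluated at the origin.\<close>
  have "integrable lborel (\<lambda>\<zeta>. a \<zeta> * (\<lambda>w. 1) (\<zeta> - 0))"
  proof (rule Lqc_conv_bound(1)[OF assms(1) _ _ _ c(2,1)])
    have "integrable lborel (indicat_real (cball (0::complex) (R + 0)))"
      using emeasure_lborel_cball_finite[of "0::complex" "R + 0"] by (intro integrable_real_indicator) auto
    then show "integrable lborel (\<lambda>w::complex. indicat_real (cball 0 (R + 0)) w * norm (1::complex) powr (q / (q - 1)))" by simp
  qed auto
  then show ?thesis by simp
qed

text \<open>Here \<open>q > 2\<close> enters: it makes the conjugate exponent \<open>p\<close>
  smaller than \<open>2\<close>, so that \<open>(2 * norm (1 / w)) powr p\<close> is locally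
  integrable and dominates.\<close>

lemma kern_diff_tendsto:
  assumes q: "q > 2"
  defines "p \<equiv> q / (q - 1)"
  shows "integrable lborel (\<lambda>w. indicator (cball 0 R) w * norm (1 / w :: complex) powr p)"
    "integrable lborel (\<lambda>w. indicator (cball 0 R) w * norm (kern (eps n) w - 1 / w) powr p)"
    "(\<lambda>n. \<integral>w. indicator (cball 0 R) w * norm (kern (eps n) w - 1 / w) powr p \<partial>lborel) \<longlonglongrightarrow> 0"
proof -
  have p: "0 \<le> p" "p < 2" "p > 0" using q by (auto simp: p_def field_simps)
  show i: "integrable lborel (\<lambda>w. indicator (cball 0 R) w * norm (1 / w :: complex) powr p)"
    by (rule inverse_norm_powr_integrable[OF p(1,2)])
  let ?w = "\<lambda>w::complex. 2 powr p * (indicator (cball 0 R) w * norm (1 / w) powr p)"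
  let ?f = "\<lambda>n w. indicator (cball 0 R) w * norm (kern (eps n) w - 1 / w) powr p :: real"
  have wi: "integrable lborel ?w" using i by simp
  have le: "norm (?f n w) \<le> ?w w" for n w
  proof (cases "w \<in> cball 0 R")
    case True
    have "norm (kern (eps n) w - 1 / w) \<le> 2 * norm (1 / w)"
      using norm_triangle_ineq4[of "kern (eps n) w" "1 / w"] kern_bounds(4)[OF eps_pos[of n], of w] by linarith
    then have "norm (kern (eps n) w - 1 / w) powr p \<le> (2 * norm (1 / w)) powr p" using p by (intro powr_mono2) auto
    also have "\<dots> = 2 powr p * norm (1 / w) powr p" by (rule powr_mult)
    finally show ?thesis using True by simp
  qed simp
  have [measurable]: "cball (0::complex) R \<in> sets borel" by simp
  have m: "?f n \<in> borel_measurable lborel" for n by measurable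
  show "integrable lborel (?f n)" for n
    by (rule Bochner_Integration.integrable_bound[OF wi m]) (use order_trans[OF le abs_ge_self] in auto)
  have "(\<lambda>n. \<integral>w. ?f n w \<partial>lborel) \<longlonglongrightarrow> integral\<^sup>L lborel (\<lambda>w::complex. 0::real)"
  proof (rule integral_dominated_convergence[OF _ m wi])
    show "AE w in lborel. (\<lambda>n. ?f n w) \<longlonglongrightarrow> 0"
    proof (rule AE_I2)
      fix w
      have "(\<lambda>n. norm (kern (eps n) w - 1 / w)) \<longlonglongrightarrow> 0"
        using tendsto_norm[OF LIM_zero[OF kern_tendsto[of w]]] by simp
      then have "(\<lambda>n. norm (kern (eps n) w - 1 / w) powr p) \<longlonglongrightarrow> 0"
        by (rule tendsto_zero_powrI[OF _ tendsto_const]) (use p in auto)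
      then show "(\<lambda>n. ?f n w) \<longlonglongrightarrow> 0" by (rule tendsto_mult_right_zero)
    qed
  qed (use le in auto)
  then show "(\<lambda>n. \<integral>w. ?f n w \<partial>lborel) \<longlonglongrightarrow> 0" by simp
qed

text \<open>This is \<open>- pi\<close> times \<open>T_op\<close> for a function extended by
  \<open>0\<close>; the factor is put back in \<open>T_op_C1\<close>.\<close>

definition Cau :: "(complex \<Rightarrow> complex) \<Rightarrow> complex \<Rightarrow> complex" where
  "Cau a z = (\<integral>\<zeta>. a \<zeta> * (1 / (\<zeta> - z)) \<partial>lborel)"

definition CauN :: "nat \<Rightarrow> (complex \<Rightarrow> complex) \<Rightarrow> complex \<Rightarrow> complex" where
  "CauN n a z = (\<integral>\<zeta>. a \<zeta> * kern (eps n) (\<zeta> - z) \<partial>lborel)"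

lemma CauN_wirt:
  assumes "integrable lborel a"
  shows "wirt UNIV (CauN n a) (\<lambda>z. - (\<integral>\<zeta>. a \<zeta> * kern_z (eps n) (\<zeta> - z) \<partial>lborel)) (\<lambda>z. - (\<integral>\<zeta>. a \<zeta> * kern_zbar (eps n) (\<zeta> - z) \<partial>lborel))"
proof -
  define C where "C = max (1 / eps n) (1 / (eps n)\<^sup>2)"
  show ?thesis unfolding CauN_def[abs_def]
    by (rule wirt_convolution[where V=UNIV and C=C, OF assms _ _ _ _ kern_wirt[OF eps_pos]])
      (use kern_bounds[OF eps_pos] in \<open>auto simp: C_def le_max_iff_disj\<close>)
qed

lemma Cau_uniform:
  assumes a: "Lqc q R a" and q: "q > 2" and e: "e > 0"
  shows "\<forall>\<^sub>F n in sequentially. \<forall>z\<in>cball 0 R0. norm (CauN n a z - Cau a z) < e"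
proof -
  define p where "p = q / (q - 1)"
  let ?A = "\<integral>z. norm (a z) powr q \<partial>lborel"
  have A0: "?A \<ge> 0" by simp
  \<comment> \<open>Makes the first term of the convolution bound at most \<open>e / 2\<close>,
    uniformly in \<open>n\<close>; the \<open>+ 1\<close> covers the case
    \<open>?A = 0\<close>.\<close>
  define s where "s = e / (2 * (?A + 1))"
  have s: "s > 0" unfolding s_def using e A0 by (intro divide_pos_pos mult_pos_pos add_nonneg_pos) auto
  obtain c where c: "c \<ge> 0" "\<And>a b. a \<ge> 0 \<Longrightarrow> b \<ge> 0 \<Longrightarrow> a * b \<le> s * a powr q + c * b powr p"
    using young_eps[OF q s] unfolding p_def by auto
  note K = kern_diff_tendsto[OF q, of "R + R0", folded p_def]
  let ?J = "\<lambda>n. \<integral>w. indicator (cball 0 (R + R0)) w * norm (kern (eps n) w - 1 / w) powr p \<partial>lborel"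
  have "(\<lambda>n. c * ?J n) \<longlonglongrightarrow> 0" using K(3) by (rule tendsto_mult_right_zero)
  then have ev: "\<forall>\<^sub>F n in sequentially. c * ?J n < e / 2" using e by (intro order_tendstoD(2)) auto
  have [measurable]: "(\<lambda>w::complex. 1 / w) \<in> borel_measurable borel" by measurable
  have am[measurable]: "a \<in> borel_measurable borel" using a by (simp add: Lqc_def)
  show ?thesis using ev
  proof (rule eventually_mono, intro ballI)
    fix n and z :: complex assume n: "c * ?J n < e / 2" and "z \<in> cball 0 R0"
    then have z: "norm z \<le> R0" by simp
    have i1: "integrable lborel (\<lambda>\<zeta>. a \<zeta> * (1 / (\<zeta> - z)))"
      by (rule Lqc_conv_bound(1)[OF a _ K(1) z c(2,1)]) (use s in auto)
    have i2: "integrable lborel (\<lambda>\<zeta>. a \<zeta> * (kern (eps n) (\<zeta> - z) - 1 / (\<zeta> - z)))"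
      and b2: "norm (\<integral>\<zeta>. a \<zeta> * (kern (eps n) (\<zeta> - z) - 1 / (\<zeta> - z)) \<partial>lborel) \<le> s * ?A + c * ?J n"
      using Lqc_conv_bound[OF a _ K(2) z c(2,1)] s by auto
    have "CauN n a z = (\<integral>\<zeta>. a \<zeta> * (kern (eps n) (\<zeta> - z) - 1 / (\<zeta> - z)) + a \<zeta> * (1 / (\<zeta> - z)) \<partial>lborel)"
      unfolding CauN_def by (simp add: algebra_simps)
    also have "\<dots> = (\<integral>\<zeta>. a \<zeta> * (kern (eps n) (\<zeta> - z) - 1 / (\<zeta> - z)) \<partial>lborel) + Cau a z"
      unfolding Cau_def by (rule Bochner_Integration.integral_add[OF i2 i1])
    finally have "norm (CauN n a z - Cau a z) \<le> s * ?A + c * ?J n" using b2 by simp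
    moreover have "s * ?A \<le> e / 2"
    proof -
      have X: "e / (2 * X) * X = e / 2" if "X > 0" for X :: real using that by simp
      have "s * ?A \<le> s * (?A + 1)" using s by simp
      also have "\<dots> = e / 2" unfolding s_def using A0 by (intro X) linarith
      finally show ?thesis .
    qed
    ultimately show "norm (CauN n a z - Cau a z) < e" using n by linarith
  qed
qed

lemma Cau_integrable:
  assumes a: "Lqc q R a" and q: "q > 2"
  shows "integrable lborel (\<lambda>\<zeta>. a \<zeta> * (1 / (\<zeta> - z)))"
proof -
  obtain c where c: "c \<ge> 0" "\<And>a b. a \<ge> 0 \<Longrightarrow> b \<ge> 0 \<Longrightarrow> a * b \<le> 1 * a powr q + c * b powr (q / (q - 1))"
    using young_eps[OF q, of 1] by auto
  show ?thesis
    by (rule Lqc_conv_bound(1)[OF a _ kern_diff_tendsto(1)[OF q] order_refl c(2,1)]) auto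
qed

lemma Cau_tendsto:
  assumes a: "Lqc q R a" and q: "q > 2"
  shows "(\<lambda>n. CauN n a z) \<longlonglongrightarrow> Cau a z"
  unfolding tendsto_iff dist_norm
proof (intro allI impI)
  fix e :: real assume "e > 0"
  from Cau_uniform[OF a q this, of "norm z"]
  show "\<forall>\<^sub>F n in sequentially. norm (CauN n a z - Cau a z) < e" by (rule eventually_mono) auto
qed

lemma Cau_continuous:
  assumes a: "Lqc q R a" and q: "q > 2"
  shows "continuous_on UNIV (Cau a)"
proof -
  have "continuous_on (cball 0 R0) (Cau a)" for R0
  proof (rule uniform_limit_theorem[where f="\<lambda>n. CauN n a" and F=sequentially])
    show "\<forall>\<^sub>F n in sequentially. continuous_on (cball 0 R0) (CauN n a)"
      using continuous_on_subset[OF wirt_cont(1)[OF CauN_wirt[OF Lqc_integrable[OF a q]]]] by auto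
    show "uniform_limit (cball 0 R0) (\<lambda>n. CauN n a) (Cau a) sequentially"
      unfolding uniform_limit_iff dist_norm using Cau_uniform[OF a q] by blast
  qed simp
  then have "continuous_on (ball 0 R0) (Cau a)" for R0
    by (meson ball_subset_cball continuous_on_subset)
  then have "isCont (Cau a) z" for z
    using continuous_on_eq_continuous_at[OF open_ball, of 0 "norm z + 1" "Cau a"] by auto
  then show ?thesis by (simp add: continuous_on_eq_continuous_at)
qed

text \<open>The hypotheses \<open>weak1\<close> and \<open>weak2\<close> make \<open>a1\<close> and
  \<open>a2\<close> weak derivatives of \<open>a\<close> in \<open>x\<close> and \<open>y\<close> on
  the whole plane, tested with arbitrary C^1 functions. With the kernel as test function, the
  derivatives of \<open>CauN n a\<close> become \<open>CauN n a1\<close> and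
  \<open>CauN n a2\<close>, which converge locally uniformly; so the limit is C^1. The second
  conclusion keeps the identity for fixed \<open>n\<close>, to be used in the computation of
  dbar.\<close>

lemma Cau_wirt:
  assumes a: "Lqc q R a" and a1: "Lqc q R a1" and a2: "Lqc q R a2" and q: "q > 2"
    and weak1: "\<And>k kp kq. wirt UNIV k kp kq \<Longrightarrow> (\<integral>\<zeta>. a \<zeta> * (kp \<zeta> * 1 + kq \<zeta> * cnj 1) \<partial>lborel) = - (\<integral>\<zeta>. a1 \<zeta> * k \<zeta> \<partial>lborel)"
    and weak2: "\<And>k kp kq. wirt UNIV k kp kq \<Longrightarrow> (\<integral>\<zeta>. a \<zeta> * (kp \<zeta> * \<i> + kq \<zeta> * cnj \<i>) \<partial>lborel) = - (\<integral>\<zeta>. a2 \<zeta> * k \<zeta> \<partial>lborel)"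
  shows "wirt UNIV (Cau a) (\<lambda>z. (Cau a1 z - \<i> * Cau a2 z) / 2) (\<lambda>z. (Cau a1 z + \<i> * Cau a2 z) / 2)" (is ?A)
    and "- (\<integral>\<zeta>. a \<zeta> * kern_zbar (eps n) (\<zeta> - z) \<partial>lborel) = (CauN n a1 z + \<i> * CauN n a2 z) / 2" (is ?B)
proof -
  have am[measurable]: "a \<in> borel_measurable borel" using a by (simp add: Lqc_def)
  have ai: "integrable lborel a" by (rule Lqc_integrable[OF a q])
  define P Q where "P n z = - (\<integral>\<zeta>. a \<zeta> * kern_z (eps n) (\<zeta> - z) \<partial>lborel)"
    and "Q n z = - (\<integral>\<zeta>. a \<zeta> * kern_zbar (eps n) (\<zeta> - z) \<partial>lborel)" for n z
  have W: "wirt UNIV (CauN n a) (P n) (Q n)" for n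
    unfolding P_def[abs_def] Q_def[abs_def] by (rule CauN_wirt[OF ai])
  have kw: "wirt UNIV (\<lambda>\<zeta>. kern (eps n) (\<zeta> - z)) (\<lambda>\<zeta>. kern_z (eps n) (\<zeta> - z)) (\<lambda>\<zeta>. kern_zbar (eps n) (\<zeta> - z))" for n z
    unfolding wirt_def
  proof (intro conjI ballI)
    fix \<zeta>
    from wirt_D[OF kern_wirt[OF eps_pos[of n]], of "\<zeta> - z"]
    show "((\<lambda>\<zeta>. kern (eps n) (\<zeta> - z)) has_derivative (\<lambda>h. kern_z (eps n) (\<zeta> - z) * h + kern_zbar (eps n) (\<zeta> - z) * cnj h)) (at \<zeta>)"
      by (intro has_derivative_compose[of "\<lambda>\<zeta>. \<zeta> - z" "\<lambda>h. h" \<zeta> UNIV "kern (eps n)"]) (auto intro!: derivative_eq_intros)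
    show "continuous_on UNIV (\<lambda>\<zeta>. kern_z (eps n) (\<zeta> - z))" "continuous_on UNIV (\<lambda>\<zeta>. kern_zbar (eps n) (\<zeta> - z))"
      by (intro continuous_on_compose2[OF wirt_cont(2)[OF kern_wirt[OF eps_pos]]] continuous_on_compose2[OF wirt_cont(3)[OF kern_wirt[OF eps_pos]]] continuous_intros; simp)+
  qed
  have ik: "integrable lborel (\<lambda>\<zeta>. a \<zeta> * k (\<zeta> - z))"
    if "\<And>w. norm (k w) \<le> C" and [measurable]: "k \<in> borel_measurable borel" for k C z
  proof (rule Bochner_Integration.integrable_bound[where f="\<lambda>\<zeta>. of_real C * a \<zeta>"])
    show "integrable lborel (\<lambda>\<zeta>. of_real C * a \<zeta>)" using ai by simp
    have C: "norm (k w) \<le> \<bar>C\<bar>" for w using that(1)[of w] by linarith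
    show "AE \<zeta> in lborel. norm (a \<zeta> * k (\<zeta> - z)) \<le> norm (of_real C * a \<zeta>)"
      using mult_right_mono[OF C norm_ge_zero] by (intro AE_I2) (simp add: norm_mult mult.commute[of "norm (a _)"])
  qed measurable
  have ip: "integrable lborel (\<lambda>\<zeta>. a \<zeta> * kern_z (eps n) (\<zeta> - z))" "integrable lborel (\<lambda>\<zeta>. a \<zeta> * kern_zbar (eps n) (\<zeta> - z))" for n z
    by (rule ik[OF kern_bounds(2)[OF eps_pos]] ik[OF kern_bounds(3)[OF eps_pos]], simp)+
  have s1: "P n z + Q n z = CauN n a1 z" for n z
  proof -
    have "P n z + Q n z = - (\<integral>\<zeta>. a \<zeta> * kern_z (eps n) (\<zeta> - z) + a \<zeta> * kern_zbar (eps n) (\<zeta> - z) \<partial>lborel)"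
      unfolding P_def Q_def using ip by simp
    also have "\<dots> = - (\<integral>\<zeta>. a \<zeta> * (kern_z (eps n) (\<zeta> - z) * 1 + kern_zbar (eps n) (\<zeta> - z) * cnj 1) \<partial>lborel)"
      by (simp add: algebra_simps)
    also have "\<dots> = CauN n a1 z" unfolding weak1[OF kw] by (simp add: CauN_def)
    finally show ?thesis .
  qed
  have s2: "\<i> * (P n z - Q n z) = CauN n a2 z" for n z
  proof -
    have "\<i> * (P n z - Q n z) = - (\<integral>\<zeta>. \<i> * (a \<zeta> * kern_z (eps n) (\<zeta> - z) - a \<zeta> * kern_zbar (eps n) (\<zeta> - z)) \<partial>lborel)"
      unfolding P_def Q_def using ip by (simp add: algebra_simps)
    also have "\<dots> = - (\<integral>\<zeta>. a \<zeta> * (kern_z (eps n) (\<zeta> - z) * \<i> + kern_zbar (eps n) (\<zeta> - z) * cnj \<i>) \<partial>lborel)"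
      by (simp add: algebra_simps)
    also have "\<dots> = CauN n a2 z" unfolding weak2[OF kw] by (simp add: CauN_def)
    finally show ?thesis .
  qed
  have PQ: "P n z = (CauN n a1 z - \<i> * CauN n a2 z) / 2" "Q n z = (CauN n a1 z + \<i> * CauN n a2 z) / 2" for n z
    unfolding s1[symmetric] s2[symmetric] by (simp_all add: algebra_simps)
  show ?B using PQ(2)[of n z] by (simp add: Q_def)
  let ?p = "\<lambda>z. (Cau a1 z - \<i> * Cau a2 z) / 2" and ?q = "\<lambda>z. (Cau a1 z + \<i> * Cau a2 z) / 2"
  show ?A unfolding wirt_def
  proof (intro conjI ballI)
    show "continuous_on UNIV ?p" "continuous_on UNIV ?q"
      by (intro continuous_intros Cau_continuous[OF a1 q] Cau_continuous[OF a2 q]; simp)+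
    fix z :: complex
    let ?S = "ball (0::complex) (norm z + 1)"
    have "\<exists>g. \<forall>x\<in>?S. (\<lambda>n. CauN n a x) \<longlonglongrightarrow> g x \<and> (g has_derivative (\<lambda>h. ?p x * h + ?q x * cnj h)) (at x within ?S)"
    proof (rule has_derivative_sequence[where f'="\<lambda>n x h. P n x * h + Q n x * cnj h" and ?x0.0=0 and l="Cau a 0"])
      show "(CauN n a has_derivative (\<lambda>h. P n x * h + Q n x * cnj h)) (at x within ?S)" for n x
        using wirt_D[OF W, of x n] has_derivative_at_withinI by blast
      show "(\<lambda>n. CauN n a 0) \<longlonglongrightarrow> Cau a 0" by (rule Cau_tendsto[OF a q])
      fix e :: real assume e: "e > 0"
      have "\<forall>\<^sub>F n in sequentially. (\<forall>z\<in>cball 0 (norm z + 1). norm (CauN n a1 z - Cau a1 z) < e / 2) \<and>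
          (\<forall>z\<in>cball 0 (norm z + 1). norm (CauN n a2 z - Cau a2 z) < e / 2)"
        using e by (intro eventually_conj Cau_uniform[OF a1 q] Cau_uniform[OF a2 q]) auto
      then show "\<forall>\<^sub>F n in sequentially. \<forall>x\<in>?S. \<forall>h. norm ((P n x * h + Q n x * cnj h) - (?p x * h + ?q x * cnj h)) \<le> e * norm h"
      proof (rule eventually_mono, intro ballI allI)
        fix n x h
        assume n: "(\<forall>z\<in>cball 0 (norm z + 1). norm (CauN n a1 z - Cau a1 z) < e / 2) \<and>
          (\<forall>z\<in>cball 0 (norm z + 1). norm (CauN n a2 z - Cau a2 z) < e / 2)" and "x \<in> ?S"
        then have 1: "norm (CauN n a1 x - Cau a1 x) \<le> e / 2" and 2: "norm (\<i> * (CauN n a2 x - Cau a2 x)) \<le> e / 2"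
          by (auto simp: norm_mult less_imp_le)
        have eq: "(P n x * h + Q n x * cnj h) - (?p x * h + ?q x * cnj h) =
            (P n x - ?p x) * h + (Q n x - ?q x) * cnj h" by (simp add: algebra_simps)
        have "P n x - ?p x = ((CauN n a1 x - Cau a1 x) - \<i> * (CauN n a2 x - Cau a2 x)) / 2" unfolding PQ by (simp add: field_simps)
        then have b1: "norm (P n x - ?p x) \<le> e / 2"
          using norm_triangle_ineq4[of "CauN n a1 x - Cau a1 x" "\<i> * (CauN n a2 x - Cau a2 x)"] 1 2 by (simp only: norm_divide norm_numeral)
        have "Q n x - ?q x = ((CauN n a1 x - Cau a1 x) + \<i> * (CauN n a2 x - Cau a2 x)) / 2" unfolding PQ by (simp add: field_simps)
        then have b2: "norm (Q n x - ?q x) \<le> e / 2"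
          using norm_triangle_ineq[of "CauN n a1 x - Cau a1 x" "\<i> * (CauN n a2 x - Cau a2 x)"] 1 2 by (simp only: norm_divide norm_numeral)
        show "norm ((P n x * h + Q n x * cnj h) - (?p x * h + ?q x * cnj h)) \<le> e * norm h"
          unfolding eq using wirt_deriv_norm[OF b1 b2, of h] by simp
      qed
    qed (use norm_ge_zero[of z] in \<open>simp_all add: add_nonneg_pos\<close>)
    then obtain g where g: "\<And>x. x \<in> ?S \<Longrightarrow> (\<lambda>n. CauN n a x) \<longlonglongrightarrow> g x"
      "\<And>x. x \<in> ?S \<Longrightarrow> (g has_derivative (\<lambda>h. ?p x * h + ?q x * cnj h)) (at x within ?S)" by blast
    have ge: "g x = Cau a x" if "x \<in> ?S" for x using LIMSEQ_unique[OF g(1)[OF that] Cau_tendsto[OF a q]] .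
    have zS: "z \<in> ?S" by simp
    have "(g has_derivative (\<lambda>h. ?p z * h + ?q z * cnj h)) (at z)"
      using g(2)[OF zS] at_within_open[OF zS open_ball] by simp
    then show "(Cau a has_derivative (\<lambda>h. ?p z * h + ?q z * cnj h)) (at z)"
      by (rule has_derivative_transform_within_open[OF _ open_ball zS ge])
  qed
qed

text \<open>The ideal test function is \<open>cnj (sgn (f z))\<close>, which turns the integral into
  that of \<open>norm (f z)\<close>. It is only measurable, hence an almost everywhere limit of
  continuous functions.\<close>

lemma integrable_zero_AE:
  fixes f :: "complex \<Rightarrow> complex"
  assumes f: "integrable lborel f"
    and z: "\<And>\<phi>. continuous_on UNIV \<phi> \<Longrightarrow> (\<And>z. norm (\<phi> z) \<le> 1) \<Longrightarrow> (\<integral>z. f z * \<phi> z \<partial>lborel) = 0"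
  shows "AE z in lborel. f z = 0"
proof -
  have [measurable]: "f \<in> borel_measurable borel" using f by auto
  have [measurable]: "cnj \<in> borel_measurable borel" by (intro borel_measurable_continuous_onI continuous_intros)
  define g where "g z = cnj (sgn (f z))" for z
  have gm: "g \<in> borel_measurable borel" unfolding g_def[abs_def] sgn_div_norm by measurable
  then have "g \<in> borel_measurable lebesgue" by (auto intro: measurable_completion)
  then have "g measurable_on UNIV" by (rule lebesgue_measurable_imp_measurable_on) simp
  then obtain N h where N: "negligible N" and h: "\<And>n. continuous_on UNIV (h n)"
    and lim: "\<And>x. x \<notin> N \<Longrightarrow> (\<lambda>n::nat. h n x) \<longlonglongrightarrow> g x"
    unfolding measurable_on_def by auto
  \<comment> \<open>Rescaling to norm at most \<open>1\<close> makes the approximants admissible and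
    dominated; the limit \<open>g\<close> is unaffected, since its norm is at most \<open>1\<close>
    as well.\<close>
  define hc where "hc n z = h n z / of_real (max 1 (norm (h n z)))" for n z
  have hcc: "continuous_on UNIV (hc n)" for n
    unfolding hc_def[abs_def] by (intro continuous_intros h) (auto simp: max_def)
  have hc1: "norm (hc n z) \<le> 1" for n z
    by (simp add: hc_def norm_divide max_def)
  have gle: "norm (g z) \<le> 1" for z by (simp add: g_def norm_sgn)
  have hlim: "(\<lambda>n. hc n x) \<longlonglongrightarrow> g x" if "x \<notin> N" for x
  proof -
    have "(\<lambda>n. hc n x) \<longlonglongrightarrow> g x / of_real (max 1 (norm (g x)))"
      unfolding hc_def by (intro tendsto_intros lim[OF that]) (auto simp: max_def)
    then show ?thesis using gle[of x] by (simp add: max_absorb1)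
  qed
  have fg: "f z * g z = of_real (norm (f z))" for z
    by (cases "f z = 0") (simp_all add: g_def sgn_div_norm scaleR_conv_of_real complex_norm_square[symmetric] power2_eq_square field_simps)
  have aeN: "AE x in lborel. x \<notin> N"
    using AE_not_in[of N lebesgue] N unfolding negligible_iff_null_sets AE_completion_iff by simp
  have "(\<lambda>n. \<integral>z. f z * hc n z \<partial>lborel) \<longlonglongrightarrow> (\<integral>z. f z * g z \<partial>lborel)"
  proof (rule integral_dominated_convergence[where w="\<lambda>z. norm (f z)"])
    show "(\<lambda>z. f z * g z) \<in> borel_measurable lborel" using gm by simp
    show "(\<lambda>z. f z * hc n z) \<in> borel_measurable lborel" for n
      using borel_measurable_continuous_onI[OF hcc] by simp
    show "AE x in lborel. (\<lambda>n. f x * hc n x) \<longlonglongrightarrow> f x * g x"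
      using aeN by (rule eventually_mono) (intro tendsto_intros hlim)
    show "AE x in lborel. norm (f x * hc n x) \<le> norm (f x)" for n
      using hc1 by (intro AE_I2) (simp add: norm_mult mult_left_le)
  qed (use f in simp)
  then have "(\<integral>z. f z * g z \<partial>lborel) = 0"
    using z[OF hcc hc1] by (simp add: LIMSEQ_const_iff)
  then have "(\<integral>z. norm (f z) \<partial>lborel) = 0"
    unfolding fg by (simp only: integral_complex_of_real of_real_eq_0_iff)
  then show ?thesis
    using integral_nonneg_eq_0_iff_AE[of lborel "\<lambda>z. norm (f z)"] f by simp
qed

section \<open>The approximate identity behind the dbar derivative of the Cauchy transform\<close>

lemma kern_zbar_1: "kern_zbar 1 w = of_real (1 / ((norm w)\<^sup>2 + 1)\<^sup>2)"
  unfolding kern_zbar_def kern_denom by simp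

lemma kern_zbar_mass:
  "integrable lborel (kern_zbar 1)" "(\<integral>w. kern_zbar 1 w \<partial>lborel) = of_real pi"
proof -
  have hb: "has_bochner_integral lborel (\<lambda>w::complex. 1 / ((norm w)\<^sup>2 + 1)\<^sup>2) pi"
    by (rule has_bochner_integral_nn_integral) (use nn_integral_kernel_mass in auto)
  have eq: "kern_zbar 1 = (\<lambda>w. complex_of_real (1 / ((norm w)\<^sup>2 + 1)\<^sup>2))"
    by (rule ext) (rule kern_zbar_1)
  have 1: "integrable lborel (\<lambda>w::complex. 1 / ((norm w)\<^sup>2 + 1)\<^sup>2)" and 2: "(\<integral>w. 1 / ((norm (w::complex))\<^sup>2 + 1)\<^sup>2 \<partial>lborel) = pi"
    using hb by (auto simp: has_bochner_integral_iff)
  show "integrable lborel (kern_zbar 1)" unfolding eq by (rule integrable_of_real[OF 1])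
  show "(\<integral>w. kern_zbar 1 w \<partial>lborel) = of_real pi" unfolding eq integral_complex_of_real 2 ..
qed

text \<open>The substitution \<open>z = \<zeta> + eps n * x\<close> turns
  \<open>kern_zbar (eps n)\<close> into \<open>kern_zbar 1\<close>, whose integral is
  \<open>pi\<close>; the area factor of the substitution is absorbed by the scaling of the
  kernel.\<close>

lemma kern_zbar_approx_identity:
  fixes \<psi> :: "complex \<Rightarrow> complex"
  assumes c: "continuous_on UNIV \<psi>" and C: "\<And>z. norm (\<psi> z) \<le> C"
  shows "(\<lambda>n. \<integral>z. kern_zbar (eps n) (\<zeta> - z) * \<psi> z \<partial>lborel) \<longlonglongrightarrow> of_real pi * \<psi> \<zeta>"
    "norm (\<integral>z. kern_zbar (eps n) (\<zeta> - z) * \<psi> z \<partial>lborel) \<le> pi * C"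
proof -
  have [measurable]: "\<psi> \<in> borel_measurable borel" using c by (rule borel_measurable_continuous_onI)
  have eq: "(\<integral>z. kern_zbar (eps n) (\<zeta> - z) * \<psi> z \<partial>lborel) = (\<integral>x. kern_zbar 1 x * \<psi> (\<zeta> + of_real (eps n) * x) \<partial>lborel)" for n
  proof -
    have sc: "of_real ((eps n)\<^sup>2) * kern_zbar (eps n) (\<zeta> - (\<zeta> + of_real (eps n) * x)) = kern_zbar 1 x" for x
    proof -
      define D where "D = x * cnj x + 1"
      have e: "complex_of_real (eps n) \<noteq> 0" using eps_pos[of n] by simp
      have "(- (of_real (eps n) * x)) * cnj (- (of_real (eps n) * x)) + of_real ((eps n)\<^sup>2) = of_real ((eps n)\<^sup>2) * D"
        by (simp add: D_def algebra_simps power2_eq_square)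
      then have "kern_zbar (eps n) (- (of_real (eps n) * x)) = of_real ((eps n)\<^sup>2) / (of_real ((eps n)\<^sup>2) * D)\<^sup>2"
        unfolding kern_zbar_def by simp
      moreover have "kern_zbar 1 x = 1 / D\<^sup>2" unfolding kern_zbar_def D_def by simp
      ultimately show ?thesis using e by (simp add: power_mult_distrib power2_eq_square)
    qed
    have "(\<integral>z. kern_zbar (eps n) (\<zeta> - z) * \<psi> z \<partial>lborel) = of_real ((eps n)\<^sup>2) *
        (\<integral>x. kern_zbar (eps n) (\<zeta> - (\<zeta> + of_real (eps n) * x)) * \<psi> (\<zeta> + of_real (eps n) * x) \<partial>lborel)"
      by (rule lborel_integral_affine) (use eps_pos[of n] in auto)
    also have "\<dots> = (\<integral>x. (of_real ((eps n)\<^sup>2) * kern_zbar (eps n) (\<zeta> - (\<zeta> + of_real (eps n) * x))) * \<psi> (\<zeta> + of_real (eps n) * x) \<partial>lborel)"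
      by (simp only: mult.assoc Bochner_Integration.integral_mult_right_zero)
    finally show ?thesis unfolding sc .
  qed
  have nk: "norm (kern_zbar 1 x) = Re (kern_zbar 1 x)" for x
    unfolding kern_zbar_1 norm_of_real Re_complex_of_real by simp
  have ik: "integrable lborel (\<lambda>x. C * norm (kern_zbar 1 x))" using kern_zbar_mass(1) by simp
  have le: "norm (kern_zbar 1 x * \<psi> (\<zeta> + of_real (eps n) * x)) \<le> C * norm (kern_zbar 1 x)" for x n
    unfolding norm_mult by (subst mult.commute) (intro mult_right_mono C norm_ge_zero)
  show "(\<lambda>n. \<integral>z. kern_zbar (eps n) (\<zeta> - z) * \<psi> z \<partial>lborel) \<longlonglongrightarrow> of_real pi * \<psi> \<zeta>"
  proof -
    have "(\<lambda>n. \<integral>x. kern_zbar 1 x * \<psi> (\<zeta> + of_real (eps n) * x) \<partial>lborel) \<longlonglongrightarrow> (\<integral>x. kern_zbar 1 x * \<psi> \<zeta> \<partial>lborel)"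
    proof (rule integral_dominated_convergence[OF _ _ ik])
      show "AE x in lborel. (\<lambda>n. kern_zbar 1 x * \<psi> (\<zeta> + of_real (eps n) * x)) \<longlonglongrightarrow> kern_zbar 1 x * \<psi> \<zeta>"
      proof (rule AE_I2, intro tendsto_mult tendsto_const isCont_tendsto_compose[of \<zeta> \<psi>])
        fix x
        show "isCont \<psi> \<zeta>" using c by (simp add: continuous_on_eq_continuous_at)
        have "(\<lambda>n. \<zeta> + of_real (eps n) * x) \<longlonglongrightarrow> \<zeta> + of_real 0 * x" by (intro tendsto_intros eps_tendsto)
        then show "(\<lambda>n. \<zeta> + of_real (eps n) * x) \<longlonglongrightarrow> \<zeta>" by simp
      qed
    qed (use le in auto)
    then show ?thesis unfolding eq using kern_zbar_mass by simp
  qed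
  have "norm (\<integral>x. kern_zbar 1 x * \<psi> (\<zeta> + of_real (eps n) * x) \<partial>lborel) \<le> (\<integral>x. C * norm (kern_zbar 1 x) \<partial>lborel)"
    by (rule Bochner_Integration.integral_norm_bound_integral[OF _ ik])
      (use le in \<open>auto intro!: Bochner_Integration.integrable_bound[OF ik] AE_I2 order_trans[OF le abs_ge_self]\<close>)
  also have "\<dots> = C * Re (\<integral>x. kern_zbar 1 x \<partial>lborel)"
    unfolding nk using kern_zbar_mass(1) by simp
  also have "\<dots> = pi * C" unfolding kern_zbar_mass(2) by simp
  finally show "norm (\<integral>z. kern_zbar (eps n) (\<zeta> - z) * \<psi> z \<partial>lborel) \<le> pi * C" unfolding eq .
qed

text \<open>For fixed \<open>n\<close> the dbar derivative is minus the integral of \<open>a\<close>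
  against \<open>kern_zbar\<close>. Paired with a continuous \<open>\<psi>\<close> of compact
  support, Fubini moves the kernel onto \<open>\<psi>\<close>, where it acts as \<open>pi\<close>
  times an approximate identity. The left side is continuous while \<open>a\<close> is merely a
  representative, so equality can hold only almost everywhere.\<close>

lemma Cau_dbar_AE:
  assumes a: "Lqc q R a" and a1: "Lqc q R a1" and a2: "Lqc q R a2" and q: "q > 2"
    and weak1: "\<And>k kp kq. wirt UNIV k kp kq \<Longrightarrow> (\<integral>\<zeta>. a \<zeta> * (kp \<zeta> * 1 + kq \<zeta> * cnj 1) \<partial>lborel) = - (\<integral>\<zeta>. a1 \<zeta> * k \<zeta> \<partial>lborel)"
    and weak2: "\<And>k kp kq. wirt UNIV k kp kq \<Longrightarrow> (\<integral>\<zeta>. a \<zeta> * (kp \<zeta> * \<i> + kq \<zeta> * cnj \<i>) \<partial>lborel) = - (\<integral>\<zeta>. a2 \<zeta> * k \<zeta> \<partial>lborel)"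
  shows "AE z in lborel. (Cau a1 z + \<i> * Cau a2 z) / 2 = - (of_real pi * a z)"
proof -
  define s where "s z = (Cau a1 z + \<i> * Cau a2 z) / 2" for z
  define Q where "Q n z = (CauN n a1 z + \<i> * CauN n a2 z) / 2" for n z
  have ai: "integrable lborel a" by (rule Lqc_integrable[OF a q])
  have am[measurable]: "a \<in> borel_measurable borel" using a by (simp add: Lqc_def)
  have Qeq: "Q n z = - (\<integral>\<zeta>. a \<zeta> * kern_zbar (eps n) (\<zeta> - z) \<partial>lborel)" for n z
    unfolding Q_def using Cau_wirt(2)[OF a a1 a2 q weak1 weak2] by simp
  have sc: "continuous_on UNIV s" unfolding s_def[abs_def]
    by (intro continuous_intros Cau_continuous[OF a1 q] Cau_continuous[OF a2 q]) simp
  have Qc: "continuous_on UNIV (Q n)" for n unfolding Q_def[abs_def]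
    by (intro continuous_intros wirt_cont(1)[OF CauN_wirt[OF Lqc_integrable[OF a1 q]]] wirt_cont(1)[OF CauN_wirt[OF Lqc_integrable[OF a2 q]]]) simp
  have [measurable]: "s \<in> borel_measurable borel" "Q n \<in> borel_measurable borel" for n
    using sc Qc by (auto intro: borel_measurable_continuous_onI)
  have Qlim: "(\<lambda>n. Q n z) \<longlonglongrightarrow> s z" for z unfolding Q_def s_def
    by (intro tendsto_intros Cau_tendsto[OF a1 q] Cau_tendsto[OF a2 q]) simp
  have key: "(\<integral>z. s z * \<psi> z \<partial>lborel) = - (of_real pi * (\<integral>z. a z * \<psi> z \<partial>lborel))"
    if pc: "continuous_on UNIV \<psi>" and p0: "\<And>z. z \<notin> cball 0 R0 \<Longrightarrow> \<psi> z = 0" for \<psi> R0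
  proof -
    obtain C where C: "C \<ge> 0" "\<And>z. norm (\<psi> z) \<le> C" using compact_support_bounded[OF pc p0] by blast
    have pi: "integrable lborel \<psi>" by (rule compact_support_integrable[OF pc p0])
    have [measurable]: "\<psi> \<in> borel_measurable borel" using pi by auto
    have "\<forall>\<^sub>F n in sequentially. (\<forall>z\<in>cball 0 R0. norm (CauN n a1 z - Cau a1 z) < 1) \<and> (\<forall>z\<in>cball 0 R0. norm (CauN n a2 z - Cau a2 z) < 1)"
      by (intro eventually_conj Cau_uniform[OF a1 q] Cau_uniform[OF a2 q]) auto
    then obtain N where N: "\<And>n z. n \<ge> N \<Longrightarrow> z \<in> cball 0 R0 \<Longrightarrow> norm (CauN n a1 z - Cau a1 z) < 1 \<and> norm (CauN n a2 z - Cau a2 z) < 1"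
      unfolding eventually_sequentially by blast
    \<comment> \<open>From \<open>N\<close> on, \<open>Q n\<close> is within \<open>1\<close> of its
      limit on the disc carrying \<open>\<psi>\<close>, which yields a domination independent of
      \<open>n\<close>.\<close>
    have Qb: "norm (Q n z) \<le> norm (s z) + 1" if "n \<ge> N" "z \<in> cball 0 R0" for n z
    proof -
      have "Q n z - s z = ((CauN n a1 z - Cau a1 z) + \<i> * (CauN n a2 z - Cau a2 z)) / 2"
        unfolding Q_def s_def by (simp add: field_simps)
      then have "norm (Q n z - s z) = norm ((CauN n a1 z - Cau a1 z) + \<i> * (CauN n a2 z - Cau a2 z)) / 2"
        by (simp only: norm_divide norm_numeral)
      also have "\<dots> \<le> (norm (CauN n a1 z - Cau a1 z) + norm (CauN n a2 z - Cau a2 z)) / 2"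
        using norm_triangle_ineq[of "CauN n a1 z - Cau a1 z" "\<i> * (CauN n a2 z - Cau a2 z)"] by (simp add: norm_mult)
      also have "\<dots> \<le> 1" using N[OF that] by simp
      finally show ?thesis using norm_triangle_ineq2[of "Q n z" "s z"] by linarith
    qed
    have "(\<lambda>n. \<integral>z. Q (n + N) z * \<psi> z \<partial>lborel) \<longlonglongrightarrow> (\<integral>z. s z * \<psi> z \<partial>lborel)"
    proof (rule integral_dominated_convergence[where w="\<lambda>z. (norm (s z) + 1) * norm (\<psi> z)"])
      have "integrable lborel (\<lambda>z. of_real (norm (s z) + 1) * \<psi> z)"
        by (rule compact_support_integrable[where R=R0]) (use p0 in \<open>auto intro!: continuous_intros sc pc\<close>)
      from integrable_norm[OF this] show "integrable lborel (\<lambda>z. (norm (s z) + 1) * norm (\<psi> z))"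
        by (simp add: norm_mult del: of_real_add)
      show "AE z in lborel. (\<lambda>n. Q (n + N) z * \<psi> z) \<longlonglongrightarrow> s z * \<psi> z"
        by (intro AE_I2 tendsto_intros LIMSEQ_ignore_initial_segment Qlim)
      show "AE z in lborel. norm (Q (n + N) z * \<psi> z) \<le> (norm (s z) + 1) * norm (\<psi> z)" for n
      proof (rule AE_I2)
        fix z show "norm (Q (n + N) z * \<psi> z) \<le> (norm (s z) + 1) * norm (\<psi> z)"
          unfolding norm_mult using Qb[of "n + N" z] p0[of z] by (cases "z \<in> cball 0 R0") (auto intro!: mult_right_mono)
      qed
    qed measurable
    moreover have "(\<integral>z. Q n z * \<psi> z \<partial>lborel) = - (\<integral>\<zeta>. a \<zeta> * (\<integral>z. kern_zbar (eps n) (\<zeta> - z) * \<psi> z \<partial>lborel) \<partial>lborel)" for n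
    proof -
      let ?f = "\<lambda>\<zeta> z. a \<zeta> * kern_zbar (eps n) (\<zeta> - z) * \<psi> z"
      have b: "norm (?f \<zeta> z) \<le> (1 / (eps n)\<^sup>2 * norm (a \<zeta>)) * norm (\<psi> z)" for \<zeta> z
        unfolding norm_mult mult.commute[of "norm (a \<zeta>)"] by (intro mult_right_mono kern_bounds(3)[OF eps_pos] norm_ge_zero)
      have m: "(\<lambda>(\<zeta>, z). ?f \<zeta> z) \<in> borel_measurable (lborel \<Otimes>\<^sub>M lborel)" by measurable
      have ib: "integrable lborel (\<lambda>z. ?f \<zeta> z)" for \<zeta>
      proof (rule Bochner_Integration.integrable_bound)
        show "integrable lborel (\<lambda>z. (1 / (eps n)\<^sup>2 * norm (a \<zeta>)) * norm (\<psi> z))" using pi by simp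
        show "AE z in lborel. norm (?f \<zeta> z) \<le> norm ((1 / (eps n)\<^sup>2 * norm (a \<zeta>)) * norm (\<psi> z))"
          by (intro AE_I2 order_trans[OF b]) simp
      qed measurable
      have "integrable (lborel \<Otimes>\<^sub>M lborel) (\<lambda>(\<zeta>, z). ?f \<zeta> z)"
      proof (rule lborel_pair.Fubini_integrable[OF m])
        show "AE x in lborel. integrable lborel (\<lambda>y. case (x, y) of (\<zeta>, z) \<Rightarrow> ?f \<zeta> z)" using ib by simp
        let ?I = "\<integral>z. norm (\<psi> z) \<partial>lborel"
        show "integrable lborel (\<lambda>x. \<integral>y. norm (case (x, y) of (\<zeta>, z) \<Rightarrow> ?f \<zeta> z) \<partial>lborel)"
        proof (rule Bochner_Integration.integrable_bound[where f="\<lambda>x. (1 / (eps n)\<^sup>2 * norm (a x)) * ?I"])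
          show "integrable lborel (\<lambda>x. (1 / (eps n)\<^sup>2 * norm (a x)) * ?I)" using ai by simp
          show "(\<lambda>x. \<integral>y. norm (case (x, y) of (\<zeta>, z) \<Rightarrow> ?f \<zeta> z) \<partial>lborel) \<in> borel_measurable lborel"
            by measurable
          show "AE x in lborel. norm (\<integral>y. norm (case (x, y) of (\<zeta>, z) \<Rightarrow> ?f \<zeta> z) \<partial>lborel) \<le> norm ((1 / (eps n)\<^sup>2 * norm (a x)) * ?I)"
          proof (rule AE_I2)
            fix x
            have "(\<integral>y. norm (?f x y) \<partial>lborel) \<le> (\<integral>y. (1 / (eps n)\<^sup>2 * norm (a x)) * norm (\<psi> y) \<partial>lborel)"
              by (rule Bochner_Integration.integral_mono) (use ib b pi in auto)
            then show "norm (\<integral>y. norm (case (x, y) of (\<zeta>, z) \<Rightarrow> ?f \<zeta> z) \<partial>lborel) \<le> norm ((1 / (eps n)\<^sup>2 * norm (a x)) * ?I)"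
              by (simp add: abs_mult)
          qed
        qed
      qed
      from lborel_pair.Fubini_integral[OF this]
      have fub: "(\<integral>z. (\<integral>\<zeta>. ?f \<zeta> z \<partial>lborel) \<partial>lborel) = (\<integral>\<zeta>. (\<integral>z. ?f \<zeta> z \<partial>lborel) \<partial>lborel)" .
      have "(\<integral>z. Q n z * \<psi> z \<partial>lborel) = (\<integral>z. - (\<integral>\<zeta>. ?f \<zeta> z \<partial>lborel) \<partial>lborel)"
        unfolding Qeq by simp
      also have "\<dots> = - (\<integral>\<zeta>. (\<integral>z. ?f \<zeta> z \<partial>lborel) \<partial>lborel)" using fub by simp
      also have "(\<lambda>\<zeta>. \<integral>z. ?f \<zeta> z \<partial>lborel) = (\<lambda>\<zeta>. a \<zeta> * (\<integral>z. kern_zbar (eps n) (\<zeta> - z) * \<psi> z \<partial>lborel))"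
        by (simp add: mult.assoc)
      finally show ?thesis .
    qed
    ultimately have l1: "(\<lambda>n. - (\<integral>\<zeta>. a \<zeta> * (\<integral>z. kern_zbar (eps (n + N)) (\<zeta> - z) * \<psi> z \<partial>lborel) \<partial>lborel)) \<longlonglongrightarrow> (\<integral>z. s z * \<psi> z \<partial>lborel)"
      by simp
    have "(\<lambda>n. \<integral>\<zeta>. a \<zeta> * (\<integral>z. kern_zbar (eps n) (\<zeta> - z) * \<psi> z \<partial>lborel) \<partial>lborel) \<longlonglongrightarrow> (\<integral>\<zeta>. a \<zeta> * (of_real pi * \<psi> \<zeta>) \<partial>lborel)"
    proof (rule integral_dominated_convergence[where w="\<lambda>\<zeta>. norm (a \<zeta>) * (pi * C)"])
      show "integrable lborel (\<lambda>\<zeta>. norm (a \<zeta>) * (pi * C))" using ai by simp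
      show "AE \<zeta> in lborel. (\<lambda>n. a \<zeta> * (\<integral>z. kern_zbar (eps n) (\<zeta> - z) * \<psi> z \<partial>lborel)) \<longlonglongrightarrow> a \<zeta> * (of_real pi * \<psi> \<zeta>)"
        by (intro AE_I2 tendsto_mult tendsto_const kern_zbar_approx_identity(1)[OF pc C(2)])
      show "AE \<zeta> in lborel. norm (a \<zeta> * (\<integral>z. kern_zbar (eps n) (\<zeta> - z) * \<psi> z \<partial>lborel)) \<le> norm (a \<zeta>) * (pi * C)" for n
        unfolding norm_mult by (intro AE_I2 mult_left_mono kern_zbar_approx_identity(2)[OF pc C(2)] norm_ge_zero)
    qed measurable
    then have "(\<lambda>n. - (\<integral>\<zeta>. a \<zeta> * (\<integral>z. kern_zbar (eps (n + N)) (\<zeta> - z) * \<psi> z \<partial>lborel) \<partial>lborel)) \<longlonglongrightarrow> - (\<integral>\<zeta>. a \<zeta> * (of_real pi * \<psi> \<zeta>) \<partial>lborel)"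
      by (intro tendsto_minus LIMSEQ_ignore_initial_segment)
    from LIMSEQ_unique[OF l1 this] show ?thesis by (simp add: mult.left_commute)
  qed
  \<comment> \<open>The cutoff equals \<open>1\<close> on the disc of radius \<open>m\<close> and
    has compact support; it provides integrability, which is not known for \<open>s\<close> on the
    whole plane. Letting \<open>m\<close> vary covers every point.\<close>
  have "AE z in lborel. (s z + of_real pi * a z) * of_real (max 0 (min 1 (real m + 1 - norm z))) = 0" for m :: nat
  proof (rule integrable_zero_AE)
    let ?X = "\<lambda>z. complex_of_real (max 0 (min 1 (real m + 1 - norm z)))"
    have Xc: "continuous_on UNIV ?X" by (intro continuous_intros)
    have X0: "?X z = 0" if "z \<notin> cball 0 (real m + 1)" for z using that by simp
    have i1: "integrable lborel (\<lambda>z. s z * ?X z * \<phi> z)" if "continuous_on UNIV \<phi>" for \<phi>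
      by (rule compact_support_integrable[where R="real m + 1"]) (use that X0 in \<open>auto intro!: continuous_intros sc\<close>)
    have i2: "integrable lborel (\<lambda>z. a z * (?X z * \<phi> z))" if "continuous_on UNIV \<phi>" "\<And>z. norm (\<phi> z) \<le> 1" for \<phi>
    proof (rule Bochner_Integration.integrable_bound[OF ai])
      show "(\<lambda>z. a z * (?X z * \<phi> z)) \<in> borel_measurable lborel"
        using borel_measurable_continuous_onI[OF that(1)] by simp
      have "norm (?X z * \<phi> z) \<le> 1 * 1" for z unfolding norm_mult by (intro mult_mono that(2)) auto
      then show "AE z in lborel. norm (a z * (?X z * \<phi> z)) \<le> norm (a z)"
        by (intro AE_I2) (simp add: norm_mult[of "a _"] mult_left_le)
    qed
    show "integrable lborel (\<lambda>z. (s z + of_real pi * a z) * ?X z)"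
      using i1[of "\<lambda>_. 1"] i2[of "\<lambda>_. 1"] by (simp add: distrib_right mult.assoc)
    fix \<phi> :: "complex \<Rightarrow> complex" assume ph: "continuous_on UNIV \<phi>" "\<And>z. norm (\<phi> z) \<le> 1"
    have "(\<integral>z. (s z + of_real pi * a z) * ?X z * \<phi> z \<partial>lborel) = (\<integral>z. s z * ?X z * \<phi> z + of_real pi * (a z * (?X z * \<phi> z)) \<partial>lborel)"
      by (intro Bochner_Integration.integral_cong refl) (simp add: algebra_simps)
    also have "\<dots> = (\<integral>z. s z * (?X z * \<phi> z) \<partial>lborel) + of_real pi * (\<integral>z. a z * (?X z * \<phi> z) \<partial>lborel)"
      using i1[OF ph(1)] i2[OF ph] by (simp add: mult.assoc)
    also have "\<dots> = 0"
      by (subst key[where ?R0.0="real m + 1"]) (use X0 in \<open>auto intro!: continuous_intros ph\<close>)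
    finally show "(\<integral>z. (s z + of_real pi * a z) * ?X z * \<phi> z \<partial>lborel) = 0" .
  qed
  then have "AE z in lborel. \<forall>m::nat. (s z + of_real pi * a z) * of_real (max 0 (min 1 (real m + 1 - norm z))) = 0"
    unfolding AE_all_countable by blast
  then show ?thesis
  proof (rule eventually_mono)
    fix z assume all: "\<forall>m::nat. (s z + of_real pi * a z) * of_real (max 0 (min 1 (real m + 1 - norm z))) = 0"
    obtain m :: nat where "norm z \<le> real m" using real_arch_simple by blast
    with all[rule_format, of m] have "s z + of_real pi * a z = 0" by simp
    then show "(Cau a1 z + \<i> * Cau a2 z) / 2 = - (of_real pi * a z)" unfolding s_def by (simp add: add_eq_0_iff2)
  qed
qed

subsection \<open>Regularity of the Cauchy transform of a Sobolev function\<close>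

text \<open>
  Truncated powers, from which the spline \<open>smooth_ramp\<close> is built: it vanishes on \<open>{..1}\<close>, equals
  \<open>s - 2\<close> on \<open>{3..}\<close>, and \<open>smooth_step\<close> and \<open>hat\<close> are its first two derivatives.
\<close>

definition tpow :: "nat \<Rightarrow> real \<Rightarrow> real" where "tpow n x = max 0 x ^ n"

lemma tpow_DERIV: "(tpow (Suc (Suc n)) has_real_derivative real (Suc (Suc n)) * tpow (Suc n) x) (at x)"
proof -
  consider "x > 0" | "x < 0" | "x = 0" by linarith
  then show ?thesis
  proof cases
    case 1
    have "((\<lambda>x. x ^ Suc (Suc n)) has_real_derivative real (Suc (Suc n)) * x ^ (Suc (Suc n) - Suc 0)) (at x)"
      by (rule DERIV_pow)
    then have "((\<lambda>x. x ^ Suc (Suc n)) has_real_derivative real (Suc (Suc n)) * tpow (Suc n) x) (at x)"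
      using 1 by (simp add: tpow_def del: of_nat_Suc power_Suc)
    then show ?thesis
      by (rule has_field_derivative_transform_within_open[OF _ open_greaterThan[of 0]]) (use 1 in \<open>auto simp: tpow_def\<close>)
  next
    case 2
    have "((\<lambda>x. 0) has_real_derivative real (Suc (Suc n)) * tpow (Suc n) x) (at x)"
      using 2 by (simp add: tpow_def)
    then show ?thesis
      by (rule has_field_derivative_transform_within_open[OF _ open_lessThan[of 0]]) (use 2 in \<open>auto simp: tpow_def\<close>)
  next
    case 3
    have "((\<lambda>h. (tpow (Suc (Suc n)) (x + h) - tpow (Suc (Suc n)) x) / h) \<longlongrightarrow> 0) (at 0)"
    proof (rule tendsto_0_le[where K=1 and f="\<lambda>h. \<bar>h\<bar> ^ Suc n"])
      show "((\<lambda>h::real. \<bar>h\<bar> ^ Suc n) \<longlongrightarrow> 0) (at 0)" by (auto intro!: tendsto_eq_intros)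
      show "\<forall>\<^sub>F h in at 0. norm ((tpow (Suc (Suc n)) (x + h) - tpow (Suc (Suc n)) x) / h) \<le> norm (\<bar>h\<bar> ^ Suc n) * 1"
        using 3 by (intro always_eventually allI) (auto simp: tpow_def max_def power_abs abs_mult intro!: mult_nonpos_nonneg)
    qed
    then show ?thesis using 3 by (simp add: DERIV_def tpow_def)
  qed
qed

definition hat :: "real \<Rightarrow> real" where
  "hat s = tpow 1 (s - 1) - 2 * tpow 1 (s - 2) + tpow 1 (s - 3)"

definition smooth_step :: "real \<Rightarrow> real" where
  "smooth_step s = (tpow 2 (s - 1) - 2 * tpow 2 (s - 2) + tpow 2 (s - 3)) / 2"

definition smooth_ramp :: "real \<Rightarrow> real" where
  "smooth_ramp s = (tpow 3 (s - 1) - 2 * tpow 3 (s - 2) + tpow 3 (s - 3)) / 6"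

lemma tpow_shift_DERIV:
  "((\<lambda>s. tpow (Suc (Suc n)) (s - c)) has_real_derivative real (Suc (Suc n)) * tpow (Suc n) (s - c)) (at s)"
proof -
  have "((\<lambda>s. s - c) has_real_derivative 1) (at s)" by (auto intro!: derivative_eq_intros)
  from DERIV_chain2[OF tpow_DERIV this] show ?thesis by simp
qed

lemma smooth_step_DERIV: "(smooth_step has_real_derivative hat s) (at s)"
proof -
  have d: "((\<lambda>s. tpow 2 (s - c)) has_real_derivative 2 * tpow 1 (s - c)) (at s)" for c
    using tpow_shift_DERIV[of 0 c s] by (simp add: numeral_2_eq_2)
  show ?thesis unfolding smooth_step_def[abs_def] hat_def
    by (rule derivative_eq_intros d refl | simp add: field_simps)+
qed

lemma smooth_ramp_DERIV: "(smooth_ramp has_real_derivative smooth_step s) (at s)"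
proof -
  have d: "((\<lambda>s. tpow 3 (s - c)) has_real_derivative 3 * tpow 2 (s - c)) (at s)" for c
    using tpow_shift_DERIV[of 1 c s] by (simp add: numeral_3_eq_3 numeral_2_eq_2)
  show ?thesis unfolding smooth_ramp_def[abs_def] smooth_step_def
    by (rule derivative_eq_intros d refl | simp add: field_simps)+
qed

lemma hat_cont: "continuous_on S hat"
  unfolding hat_def tpow_def by (intro continuous_intros)

lemma smooth_step_cont: "continuous_on S smooth_step"
  unfolding smooth_step_def tpow_def by (intro continuous_intros) auto

lemma hat_nonneg: "hat s \<ge> 0"
  by (auto simp: hat_def tpow_def max_def)

lemma hat_zero: "s \<le> 1 \<or> s \<ge> 3 \<Longrightarrow> hat s = 0"
  by (auto simp: hat_def tpow_def max_def)

lemma smooth_step_zero: "s \<le> 1 \<Longrightarrow> smooth_step s = 0"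
  by (auto simp: smooth_step_def tpow_def max_def)

lemma smooth_step_one: "s \<ge> 3 \<Longrightarrow> smooth_step s = 1"
  by (auto simp: smooth_step_def tpow_def max_def power2_eq_square algebra_simps)

lemma smooth_step_range: "0 \<le> smooth_step s \<and> smooth_step s \<le> 1"
proof -
  have mono: "smooth_step x \<le> smooth_step y" if "x \<le> y" for x y
  proof (rule DERIV_nonneg_imp_nondecreasing[OF that])
    fix t show "\<exists>d. (smooth_step has_real_derivative d) (at t) \<and> 0 \<le> d"
      using smooth_step_DERIV[of t] hat_nonneg[of t] by blast
  qed
  have "smooth_step (min s 1) \<le> smooth_step s" "smooth_step s \<le> smooth_step (max s 3)" by (intro mono; simp)+
  then show ?thesis by (simp add: smooth_step_zero smooth_step_one)
qed

lemma smooth_ramp_zero: "s \<le> 1 \<Longrightarrow> smooth_ramp s = 0"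
  by (auto simp: smooth_ramp_def tpow_def max_def)

lemma smooth_ramp_large: "s \<ge> 3 \<Longrightarrow> smooth_ramp s = s - 2"
  by (auto simp: smooth_ramp_def tpow_def max_def power3_eq_cube field_simps)

lemma smooth_ramp_range: "s \<ge> 0 \<Longrightarrow> 0 \<le> smooth_ramp s \<and> smooth_ramp s \<le> s"
proof -
  assume s: "s \<ge> 0"
  have mono: "smooth_ramp x \<le> smooth_ramp y" if "x \<le> y" for x y
  proof (rule DERIV_nonneg_imp_nondecreasing[OF that])
    fix t show "\<exists>d. (smooth_ramp has_real_derivative d) (at t) \<and> 0 \<le> d"
      using smooth_ramp_DERIV[of t] smooth_step_range[of t] by blast
  qed
  have d: "((\<lambda>s. s - smooth_ramp s) has_real_derivative 1 - smooth_step x) (at x)" for x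
    by (intro DERIV_diff DERIV_ident smooth_ramp_DERIV)
  have "0 - smooth_ramp 0 \<le> s - smooth_ramp s"
  proof (rule DERIV_nonneg_imp_nondecreasing[OF s])
    fix t show "\<exists>y. ((\<lambda>s. s - smooth_ramp s) has_real_derivative y) (at t) \<and> 0 \<le> y"
      using d[of t] smooth_step_range[of t] by (intro exI[of _ "1 - smooth_step t"]) simp
  qed
  moreover have "smooth_ramp 0 \<le> smooth_ramp s" by (rule mono[OF s])
  ultimately show ?thesis by (simp add: smooth_ramp_zero)
qed

lemma cutoff_exists:
  fixes z0 :: complex
  assumes r: "r > 0"
  obtains cut cutp cutq where "wirt UNIV cut cutp cutq" "\<And>z. z \<in> ball z0 r \<Longrightarrow> cut z = 1" "\<And>z. z \<notin> cball z0 (2 * r) \<Longrightarrow> cut z = 0"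
    "\<And>z. norm (cut z) \<le> 1"
proof -
  \<comment> \<open>At least \<open>3\<close> where \<open>norm (z - z0) \<le> r\<close> and at most
    \<open>0\<close> beyond \<open>2 * r\<close>, to match the interval from \<open>1\<close> to
    \<open>3\<close> on which \<open>smooth_step\<close> rises. The squared distance is smooth also
    at the centre.\<close>
  let ?s = "\<lambda>z. 4 - (norm (z - z0))\<^sup>2 / r\<^sup>2"
  have "wirt UNIV (\<lambda>z. 4 + of_real (- 1 / r\<^sup>2) * ((z + (- z0)) * (cnj z + (- cnj z0))))
     (\<lambda>z. 0 + of_real (- 1 / r\<^sup>2) * ((1 + 0) * (cnj z + (- cnj z0)) + (z + (- z0)) * (0 + 0)))
     (\<lambda>z. 0 + of_real (- 1 / r\<^sup>2) * ((0 + 0) * (cnj z + (- cnj z0)) + (z + (- z0)) * (1 + 0)))"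
    by (intro wirt_add wirt_mult wirt_cmult wirt_const wirt_id wirt_cnj_id)
  moreover have "4 + of_real (- 1 / r\<^sup>2) * ((z + (- z0)) * (cnj z + (- cnj z0))) = complex_of_real (?s z)" for z
  proof -
    have "(z + (- z0)) * (cnj z + (- cnj z0)) = of_real ((norm (z - z0))\<^sup>2)"
      using complex_norm_square[of "z - z0"] by simp
    then show ?thesis by simp
  qed
  ultimately have w: "wirt UNIV (\<lambda>z. complex_of_real (?s z)) (\<lambda>z. 0 + of_real (- 1 / r\<^sup>2) * ((1 + 0) * (cnj z + (- cnj z0)) + (z + (- z0)) * (0 + 0)))
     (\<lambda>z. 0 + of_real (- 1 / r\<^sup>2) * ((0 + 0) * (cnj z + (- cnj z0)) + (z + (- z0)) * (1 + 0)))" by (simp only:)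
  from wirt_real_compose[OF w smooth_step_DERIV hat_cont]
  show ?thesis
  proof (rule that)
    fix z
    show "complex_of_real (smooth_step (?s z)) = 1" if "z \<in> ball z0 r"
    proof -
      have "norm (z - z0) < r" using that by (simp add: dist_norm norm_minus_commute)
      then have "(norm (z - z0))\<^sup>2 \<le> r\<^sup>2" by (intro power_mono) auto
      then have "(norm (z - z0))\<^sup>2 / r\<^sup>2 \<le> 1" using r by simp
      then show ?thesis using smooth_step_one[of "?s z"] by simp
    qed
    show "complex_of_real (smooth_step (?s z)) = 0" if "z \<notin> cball z0 (2 * r)"
    proof -
      have "norm (z - z0) > 2 * r" using that by (simp add: dist_norm norm_minus_commute)
      then have "(norm (z - z0))\<^sup>2 \<ge> (2 * r)\<^sup>2" using r by (intro power_mono) auto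
      then have "(norm (z - z0))\<^sup>2 / r\<^sup>2 \<ge> 4" using r by (simp add: power_mult_distrib field_simps)
      then show ?thesis using smooth_step_zero[of "?s z"] by simp
    qed
    show "norm (complex_of_real (smooth_step (?s z))) \<le> 1" using smooth_step_range[of "?s z"] by simp
  qed
qed

section \<open>Borel representatives of L^q functions\<close>

lemma borel_representative:
  fixes f :: "complex \<Rightarrow> complex"
  assumes "f \<in> borel_measurable lebesgue"
  obtains g where "g \<in> borel_measurable borel" "AE z in lebesgue. f z = g z"
proof -
  have "(\<lambda>z. Re (f z)) \<in> borel_measurable lebesgue" "(\<lambda>z. Im (f z)) \<in> borel_measurable lebesgue"
    using assms by measurable
  then obtain u v where u: "u \<in> borel_measurable lborel" "AE z in lborel. Re (f z) = u z"
    and v: "v \<in> borel_measurable lborel" "AE z in lborel. Im (f z) = v z"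
    using completion_ex_borel_measurable_real by metis
  show ?thesis
  proof (rule that[of "\<lambda>z. of_real (u z) + \<i> * of_real (v z)"])
    show "(\<lambda>z. complex_of_real (u z) + \<i> * complex_of_real (v z)) \<in> borel_measurable borel" using u(1) v(1) by simp
    have "AE z in lborel. f z = of_real (u z) + \<i> * of_real (v z)"
      using u(2) v(2) by eventually_elim (simp add: complex_eq_iff)
    then show "AE z in lebesgue. f z = of_real (u z) + \<i> * of_real (v z)" by (rule AE_completion)
  qed
qed

lemma Lq_on_representative:
  assumes f: "Lq_on q D f" and D: "open D" "D \<subseteq> cball 0 R" and q: "q > 0"
  obtains a where "Lqc q R a" "\<And>z. z \<notin> D \<Longrightarrow> a z = 0" "AE z in lebesgue. z \<in> D \<longrightarrow> a z = f z"
proof -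
  have m: "(\<lambda>z. indicator D z *\<^sub>R f z) \<in> borel_measurable lebesgue" and i: "integrable lebesgue (\<lambda>z. indicator D z *\<^sub>R (norm (f z) powr q))"
    using f by (auto simp: Lq_on_def set_borel_measurable_def set_integrable_def)
  obtain g where g: "g \<in> borel_measurable borel" "AE z in lebesgue. indicator D z *\<^sub>R f z = g z"
    using borel_representative[OF m] by blast
  have [measurable]: "D \<in> sets borel" using D(1) by simp
  define a where "a z = indicator D z *\<^sub>R g z" for z
  have am: "a \<in> borel_measurable borel" unfolding a_def using g(1) by measurable
  have a0: "a z = 0" if "z \<notin> D" for z using that by (simp add: a_def)
  have ae: "AE z in lebesgue. z \<in> D \<longrightarrow> a z = f z"
    using g(2) by eventually_elim (auto simp: a_def)
  have "AE z in lebesgue. indicator D z *\<^sub>R (norm (f z) powr q) = norm (a z) powr q"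
    using ae by eventually_elim (use a0 in \<open>auto simp: indicator_def\<close>)
  note pae = this
  have pm: "(\<lambda>z. norm (a z) powr q) \<in> borel_measurable borel" using am by measurable
  then have "(\<lambda>z. norm (a z) powr q) \<in> borel_measurable lebesgue" by (auto intro: measurable_completion)
  then have "integrable lebesgue (\<lambda>z. norm (a z) powr q)"
    by (rule integrable_cong_AE_imp[OF i _ pae])
  then have "integrable lborel (\<lambda>z. norm (a z) powr q)" using pm by (subst (asm) integrable_completion) auto
  moreover have "a z = 0" if "z \<notin> cball 0 R" for z using that a0 D(2) by blast
  ultimately have "Lqc q R a" using am unfolding Lqc_def by blast
  then show ?thesis using that a0 ae by blast
qed

lemma representative_integral:
  fixes a f F :: "complex \<Rightarrow> complex"
  assumes a: "a \<in> borel_measurable borel" "\<And>z. z \<notin> D \<Longrightarrow> a z = 0" "AE z in lebesgue. z \<in> D \<longrightarrow> a z = f z"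
    and F: "F \<in> borel_measurable borel"
  shows "(LINT z:D|lebesgue. f z * F z) = (\<integral>z. a z * F z \<partial>lborel)"
proof -
  have aF: "(\<lambda>z. a z * F z) \<in> borel_measurable borel" by (rule borel_measurable_times[OF a(1) F])
  have m: "(\<lambda>z. a z * F z) \<in> borel_measurable lebesgue"
    using aF by (auto intro: measurable_completion)
  have ae: "AE z in lebesgue. indicator D z *\<^sub>R (f z * F z) = a z * F z"
    using a(3) by eventually_elim (use a(2) in \<open>auto simp: indicator_def\<close>)
  \<comment> \<open>Measurability of this integrand is inferred from agreement almost everywhere
    with a Borel function, because Lebesgue measure is complete.\<close>
  have m2: "(\<lambda>z. indicator D z *\<^sub>R (f z * F z)) \<in> borel_measurable lebesgue"
    by (rule borel_measurable_AE[OF m]) (use ae in \<open>auto elim: eventually_mono\<close>)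
  have "(LINT z:D|lebesgue. f z * F z) = integral\<^sup>L lebesgue (\<lambda>z. a z * F z)"
    unfolding set_lebesgue_integral_def by (rule integral_cong_AE[OF m2 m ae])
  also have "\<dots> = (\<integral>z. a z * F z \<partial>lborel)" by (rule integral_completion) (use aF in simp)
  finally show ?thesis .
qed

lemma Lqc_mult:
  assumes a: "Lqc q R a" and q: "q > 0" and m: "m \<in> borel_measurable borel" and C: "\<And>z. norm (m z) \<le> C"
  shows "Lqc q R (\<lambda>z. a z * m z)"
proof -
  have am: "a \<in> borel_measurable borel" "integrable lborel (\<lambda>z. norm (a z) powr q)" "\<And>z. z \<notin> cball 0 R \<Longrightarrow> a z = 0"
    using a by (auto simp: Lqc_def)
  note am(1)[measurable] m[measurable]
  have le: "norm (a z * m z) powr q \<le> C powr q * norm (a z) powr q" for z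
  proof -
    have "norm (a z * m z) \<le> C * norm (a z)" unfolding norm_mult by (subst mult.commute) (intro mult_right_mono C norm_ge_zero)
    then have "norm (a z * m z) powr q \<le> (C * norm (a z)) powr q" using q by (intro powr_mono2) auto
    then show ?thesis by (simp add: powr_mult)
  qed
  have "integrable lborel (\<lambda>z. C powr q * norm (a z) powr q)" using am(2) by simp
  then have "integrable lborel (\<lambda>z. norm (a z * m z) powr q)"
  proof (rule Bochner_Integration.integrable_bound)
    show "AE z in lborel. norm (norm (a z * m z) powr q) \<le> norm (C powr q * norm (a z) powr q)"
      by (intro AE_I2 order_trans[OF _ abs_ge_self]) (use le in simp)
  qed measurable
  moreover have "(\<lambda>z. a z * m z) \<in> borel_measurable borel" by measurable
  ultimately show ?thesis using am(3) unfolding Lqc_def by simp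
qed

lemma Lqc_add:
  assumes a: "Lqc q R a" and b: "Lqc q R b" and q: "q > 0"
  shows "Lqc q R (\<lambda>z. a z + b z)"
proof -
  have am: "a \<in> borel_measurable borel" "integrable lborel (\<lambda>z. norm (a z) powr q)" "\<And>z. z \<notin> cball 0 R \<Longrightarrow> a z = 0"
    and bm: "b \<in> borel_measurable borel" "integrable lborel (\<lambda>z. norm (b z) powr q)" "\<And>z. z \<notin> cball 0 R \<Longrightarrow> b z = 0"
    using a b by (auto simp: Lqc_def)
  note am(1)[measurable] bm(1)[measurable]
  have le: "norm (a z + b z) powr q \<le> 2 powr q * (norm (a z) powr q + norm (b z) powr q)" for z
  proof -
    have "norm (a z + b z) \<le> 2 * max (norm (a z)) (norm (b z))"
      using norm_triangle_ineq[of "a z" "b z"] by (simp add: max_def)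
    then have "norm (a z + b z) powr q \<le> (2 * max (norm (a z)) (norm (b z))) powr q" using q by (intro powr_mono2) auto
    also have "\<dots> = 2 powr q * max (norm (a z)) (norm (b z)) powr q" by (rule powr_mult)
    also have "\<dots> \<le> 2 powr q * (norm (a z) powr q + norm (b z) powr q)"
      by (intro mult_left_mono) (auto simp: max_def)
    finally show ?thesis .
  qed
  have "integrable lborel (\<lambda>z. 2 powr q * (norm (a z) powr q + norm (b z) powr q))" using am(2) bm(2) by simp
  then have "integrable lborel (\<lambda>z. norm (a z + b z) powr q)"
  proof (rule Bochner_Integration.integrable_bound)
    show "AE z in lborel. norm (norm (a z + b z) powr q) \<le> norm (2 powr q * (norm (a z) powr q + norm (b z) powr q))"
      by (intro AE_I2) (use order_trans[OF le abs_ge_self] in simp)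
  qed measurable
  moreover have "(\<lambda>z. a z + b z) \<in> borel_measurable borel" by measurable
  ultimately show ?thesis using am(3) bm(3) unfolding Lqc_def by simp
qed

text \<open>The coefficients on overlapping neighbourhoods agree because the derivative determines
  them, so they can be read off from it globally: \<open>p\<close> and \<open>q\<close> are the
  usual combinations of the derivatives in \<open>x\<close> and \<open>y\<close>.\<close>

lemma wirt_local_global:
  assumes "open D" "\<And>z. z \<in> D \<Longrightarrow> \<exists>U p q. open U \<and> z \<in> U \<and> U \<subseteq> D \<and> wirt U f p q"
  obtains p q where "wirt D f p q"
proof -
  define p q where "p z = (frechet_derivative f (at z) 1 - \<i> * frechet_derivative f (at z) \<i>) / 2"
    and "q z = (frechet_derivative f (at z) 1 + \<i> * frechet_derivative f (at z) \<i>) / 2" for z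
  have eq: "p z = p' z \<and> q z = q' z" if "wirt U f p' q'" "z \<in> U" for U p' q' z
  proof -
    have "frechet_derivative f (at z) = (\<lambda>h. p' z * h + q' z * cnj h)"
      using frechet_derivative_at[OF wirt_D[OF that]] by simp
    then show ?thesis by (simp add: p_def q_def algebra_simps)
  qed
  have "wirt D f p q"
    unfolding wirt_def
  proof (intro conjI ballI)
    fix z assume "z \<in> D"
    then obtain U p' q' where U: "z \<in> U" "wirt U f p' q'" using assms(2) by blast
    show "(f has_derivative (\<lambda>h. p z * h + q z * cnj h)) (at z)"
      using wirt_D[OF U(2,1)] eq[OF U(2,1)] by simp
  next
    have "isCont p z \<and> isCont q z" if zD: "z \<in> D" for z
    proof -
      obtain U p' q' where U: "open U" "z \<in> U" "wirt U f p' q'" using assms(2)[OF zD] by blast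
      have "continuous_on U p" using wirt_cont(2)[OF U(3)] eq[OF U(3)] by (metis continuous_on_cong)
      moreover have "continuous_on U q" using wirt_cont(3)[OF U(3)] eq[OF U(3)] by (metis continuous_on_cong)
      ultimately show ?thesis using U(1,2) by (simp add: continuous_on_eq_continuous_at)
    qed
    then show "continuous_on D p" "continuous_on D q" by (auto intro: continuous_at_imp_continuous_on)
  qed
  then show ?thesis by (rule that)
qed

text \<open>For \<open>z\<close> within \<open>r / 2\<close> of \<open>z0\<close> the mass of
  \<open>c\<close> stays at distance more than \<open>r / 2\<close> from \<open>z\<close>, so only
  the part of \<open>1 / w\<close> away from its pole occurs, which is holomorphic and bounded
  together with its derivative. Hence the vanishing second coefficient.\<close>

lemma Cau_outside_wirt:
  assumes c: "integrable lborel c" and c0: "\<And>z. z \<in> ball z0 r \<Longrightarrow> c z = 0" and r: "r > 0"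
  shows "\<exists>p. wirt (ball z0 (r / 2)) (Cau c) p (\<lambda>z. 0)"
proof -
  define V where "V = {w::complex. norm w > r / 2}"
  have oV: "open V" unfolding V_def by (intro open_Collect_less continuous_intros)
  have V0: "w \<noteq> 0" if "w \<in> V" for w using that r by (auto simp: V_def)
  have kw: "wirt V (\<lambda>w. 1 / w) (\<lambda>w. - 1 / w\<^sup>2) (\<lambda>w. 0)"
  proof (rule wirt_holomorphic)
    show "((\<lambda>w. 1 / w) has_field_derivative - 1 / w\<^sup>2) (at w)" if "w \<in> V" for w
      using V0[OF that] by (auto intro!: derivative_eq_intros simp: power2_eq_square)
    show "continuous_on V (\<lambda>w. - 1 / w\<^sup>2)" using V0 by (intro continuous_intros) auto
  qed
  define C where "C = max (2 / r) (4 / r\<^sup>2)"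
  have "wirt (ball z0 (r / 2)) (\<lambda>z. \<integral>\<zeta>. c \<zeta> * (1 / (\<zeta> - z)) \<partial>lborel) (\<lambda>z. - (\<integral>\<zeta>. c \<zeta> * (- 1 / (\<zeta> - z)\<^sup>2) \<partial>lborel))
     (\<lambda>z. - (\<integral>\<zeta>. c \<zeta> * 0 \<partial>lborel))"
  proof (rule wirt_convolution[where V=V and C=C, OF c open_ball convex_ball _ oV kw])
    fix \<zeta> z assume "c \<zeta> \<noteq> 0" "z \<in> ball z0 (r / 2)"
    then have "\<zeta> \<notin> ball z0 r" "dist z0 z < r / 2" using c0 by auto
    then have "dist z0 \<zeta> \<ge> r" "dist z0 z < r / 2" by simp_all
    moreover have "dist z0 \<zeta> \<le> dist z0 z + dist \<zeta> z" by (metis dist_commute dist_triangle)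
    ultimately show "\<zeta> - z \<in> V" by (simp add: V_def dist_norm)
  next
    fix w assume "w \<in> V"
    then have w: "norm w > r / 2" by (simp add: V_def)
    then have nw: "norm w > 0" using r by linarith
    have "1 / norm w \<le> 1 / (r / 2)" using r w nw by (intro divide_left_mono mult_pos_pos) simp_all
    then show "norm (1 / w) \<le> C" by (simp add: norm_divide C_def le_max_iff_disj)
    have "(r / 2)\<^sup>2 \<le> (norm w)\<^sup>2" using w r by (intro power_mono) auto
    moreover have "(norm w)\<^sup>2 > 0" using nw by simp
    ultimately have "1 / (norm w)\<^sup>2 \<le> 1 / (r / 2)\<^sup>2" using r by (intro divide_left_mono mult_pos_pos) simp_all
    then show "norm (- 1 / w\<^sup>2) \<le> C" by (simp add: norm_divide norm_power power_divide C_def le_max_iff_disj)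
    show "norm (0::complex) \<le> C" using r by (simp add: C_def le_max_iff_disj)
  qed auto
  then show ?thesis unfolding Cau_def[abs_def] by auto
qed

text \<open>The extension of \<open>A\<close> by zero may have no weak derivatives across the
  boundary of \<open>D\<close>, so the result for the whole plane does not apply to
  \<open>a\<close>. Near a point \<open>z0\<close> the function is split by a cutoff as
  \<open>a = b + c\<close>: \<open>b\<close> has weak derivatives in the whole plane, and
  \<open>c\<close> vanishes near \<open>z0\<close>, so that its transform is holomorphic there. The
  local results are then glued.\<close>

lemma Cau_sobolev:
  assumes D: "open D" "D \<subseteq> cball 0 R" and q: "q > 2" and A: "sobolev_W1 q D A"
    and a: "Lqc q R a" and a0: "\<And>z. z \<notin> D \<Longrightarrow> a z = 0" and aA: "AE z in lebesgue. z \<in> D \<longrightarrow> a z = A z"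
  obtains P Q where "wirt D (Cau a) P Q" "AE z in lebesgue. z \<in> D \<longrightarrow> Q z = - (of_real pi * A z)"
proof -
  have q0: "q > 0" using q by simp
  obtain Ax Ay where wx: "has_weak_partial D 1 A Ax" and wy: "has_weak_partial D \<i> A Ay"
    and Lx: "Lq_on q D Ax" and Ly: "Lq_on q D Ay" using A by (auto simp: sobolev_W1_def)
  obtain ax where ax: "Lqc q R ax" "\<And>z. z \<notin> D \<Longrightarrow> ax z = 0" "AE z in lebesgue. z \<in> D \<longrightarrow> ax z = Ax z"
    using Lq_on_representative[OF Lx D q0] by blast
  obtain ay where ay: "Lqc q R ay" "\<And>z. z \<notin> D \<Longrightarrow> ay z = 0" "AE z in lebesgue. z \<in> D \<longrightarrow> ay z = Ay z"
    using Lq_on_representative[OF Ly D q0] by blast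
  have bm: "a \<in> borel_measurable borel" "ax \<in> borel_measurable borel" "ay \<in> borel_measurable borel"
    using a ax ay by (auto simp: Lqc_def)
  have ia: "integrable lborel a" by (rule Lqc_integrable[OF a q])
  have local: "\<exists>U p q'. open U \<and> z0 \<in> U \<and> U \<subseteq> D \<and> wirt U (Cau a) p q' \<and> (AE z in lborel. z \<in> U \<longrightarrow> q' z = - (of_real pi * a z))"
    if z0: "z0 \<in> D" for z0
  proof -
    obtain r' where r': "r' > 0" "cball z0 r' \<subseteq> D" using D(1) z0 open_contains_cball by blast
    define r where "r = r' / 2"
    have r: "r > 0" "cball z0 (2 * r) \<subseteq> D" using r' by (auto simp: r_def)
    obtain cut cutp cutq where X: "wirt UNIV cut cutp cutq" and X1: "\<And>z. z \<in> ball z0 r \<Longrightarrow> cut z = 1"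
      and X0: "\<And>z. z \<notin> cball z0 (2 * r) \<Longrightarrow> cut z = 0" and Xb: "\<And>z. norm (cut z) \<le> 1"
      using cutoff_exists[OF r(1)] by blast
    note Xc = wirt_cont[OF X]
    have Xm: "cut \<in> borel_measurable borel" "cutp \<in> borel_measurable borel" "cutq \<in> borel_measurable borel"
      using Xc by (auto intro: borel_measurable_continuous_onI)
    note Xm[measurable] bm[measurable]
    have cb: "cball z0 (2 * r) \<subseteq> cball 0 R" using r D by auto
    have Xz: "cutp z = 0" "cutq z = 0" if "z \<notin> cball z0 (2 * r)" for z
      using wirt_zero_outside[OF X closed_cball X0 that] by auto
    have Xz': "cutp z = 0" "cutq z = 0" if "z \<notin> cball 0 R" for z using Xz[of z] that cb by blast+
    obtain C1 where C1: "C1 \<ge> 0" "\<And>z. norm (cutp z) \<le> C1" using compact_support_bounded[OF Xc(2) Xz'(1)] by blast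
    obtain C2 where C2: "C2 \<ge> 0" "\<And>z. norm (cutq z) \<le> C2" using compact_support_bounded[OF Xc(3) Xz'(2)] by blast
    define b where "b z = a z * cut z" for z
    define bv where "bv av v z = av z * cut z + a z * (cutp z * v + cutq z * cnj v)" for av v z
    have Lb: "Lqc q R b" unfolding b_def[abs_def] by (rule Lqc_mult[OF a q0 Xm(1) Xb])
    have Lbv: "Lqc q R (bv av v)" if "Lqc q R av" for av v
      unfolding bv_def[abs_def]
    proof (intro Lqc_add Lqc_mult[OF _ q0 Xm(1) Xb] Lqc_mult[OF a q0, where C="C1 * norm v + C2 * norm v"] that q0)
      fix z
      have "norm (cutp z * v + cutq z * cnj v) \<le> norm (cutp z) * norm v + norm (cutq z) * norm v"
        by (rule order_trans[OF norm_triangle_ineq]) (simp add: norm_mult)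
      also have "\<dots> \<le> C1 * norm v + C2 * norm v" using C1 C2 by (intro add_mono mult_right_mono) auto
      finally show "norm (cutp z * v + cutq z * cnj v) \<le> C1 * norm v + C2 * norm v" .
    qed measurable
    \<comment> \<open>Product rule in weak form: testing \<open>A\<close> with
      \<open>cut * k\<close> shows that \<open>bv av v\<close> is the weak derivative of
      \<open>b\<close> in direction \<open>v\<close> on the whole plane. The cutoff provides the
      compact support in \<open>D\<close>.\<close>
    have weak: "(\<integral>\<zeta>. b \<zeta> * (kp \<zeta> * v + kq \<zeta> * cnj v) \<partial>lborel) = - (\<integral>\<zeta>. bv av v \<zeta> * k \<zeta> \<partial>lborel)"
      if wp: "has_weak_partial D v A Av" and av: "Lqc q R av" "\<And>z. z \<notin> D \<Longrightarrow> av z = 0" "AE z in lebesgue. z \<in> D \<longrightarrow> av z = Av z"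
        and k: "wirt UNIV k kp kq" for v av Av k kp kq
    proof -
      note kc = wirt_cont[OF k]
      have km: "k \<in> borel_measurable borel" "kp \<in> borel_measurable borel" "kq \<in> borel_measurable borel"
        using kc by (auto intro: borel_measurable_continuous_onI)
      note km[measurable]
      have avm[measurable]: "av \<in> borel_measurable borel" using av(1) by (simp add: Lqc_def)
      have "(LINT z:D|lebesgue. A z * ((cutp z * k z + cut z * kp z) * v + (cutq z * k z + cut z * kq z) * cnj v)) =
          - (LINT z:D|lebesgue. Av z * (cut z * k z))"
        by (rule weak_partial_C1_test[OF wp D(1) wirt_mult[OF X k] compact_cball r(2)]) (use X0 in auto)
      moreover have "(LINT z:D|lebesgue. A z * ((cutp z * k z + cut z * kp z) * v + (cutq z * k z + cut z * kq z) * cnj v))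
          = (\<integral>z. a z * ((cutp z * k z + cut z * kp z) * v + (cutq z * k z + cut z * kq z) * cnj v) \<partial>lborel)"
        by (rule representative_integral[OF bm(1) a0 aA]) measurable
      moreover have "(LINT z:D|lebesgue. Av z * (cut z * k z)) = (\<integral>z. av z * (cut z * k z) \<partial>lborel)"
        by (rule representative_integral[OF avm av(2,3)]) measurable
      ultimately have e: "(\<integral>z. a z * ((cutp z * k z + cut z * kp z) * v + (cutq z * k z + cut z * kq z) * cnj v) \<partial>lborel) = - (\<integral>z. av z * (cut z * k z) \<partial>lborel)"
        by simp
      have int: "integrable lborel (\<lambda>z. h z * g z)" if h: "integrable lborel h" and g: "continuous_on UNIV g" "\<And>z. z \<notin> cball 0 R \<Longrightarrow> g z = 0" for h g :: "complex \<Rightarrow> complex"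
      proof -
        obtain C where C: "C \<ge> 0" "\<And>z. norm (g z) \<le> C" using compact_support_bounded[OF g] by blast
        show ?thesis
        proof (rule Bochner_Integration.integrable_bound[where f="\<lambda>z. of_real C * h z"])
          show "integrable lborel (\<lambda>z. of_real C * h z)" using h by simp
          show "(\<lambda>z. h z * g z) \<in> borel_measurable lborel" using h borel_measurable_continuous_onI[OF g(1)] by auto
          show "AE z in lborel. norm (h z * g z) \<le> norm (of_real C * h z)"
            using mult_right_mono[OF C(2) norm_ge_zero] C(1) by (intro AE_I2) (simp add: norm_mult mult.commute[of "norm (h _)"])
        qed
      qed
      have X0': "cut z = 0" if "z \<notin> cball 0 R" for z using X0[of z] that cb by blast
      have i1: "integrable lborel (\<lambda>z. a z * (cut z * (kp z * v + kq z * cnj v)))"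
        by (rule int[OF ia]) (use X0' in \<open>auto intro!: continuous_intros Xc kc\<close>)
      have i2: "integrable lborel (\<lambda>z. a z * ((cutp z * v + cutq z * cnj v) * k z))"
        by (rule int[OF ia]) (use Xz' in \<open>auto intro!: continuous_intros Xc kc\<close>)
      have i3: "integrable lborel (\<lambda>z. av z * (cut z * k z))"
        by (rule int[OF Lqc_integrable[OF av(1) q]]) (use X0' in \<open>auto intro!: continuous_intros Xc kc\<close>)
      have "(\<integral>z. a z * ((cutp z * k z + cut z * kp z) * v + (cutq z * k z + cut z * kq z) * cnj v) \<partial>lborel)
         = (\<integral>z. a z * (cut z * (kp z * v + kq z * cnj v)) + a z * ((cutp z * v + cutq z * cnj v) * k z) \<partial>lborel)"
        by (intro Bochner_Integration.integral_cong refl) (simp add: algebra_simps)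
      also have "\<dots> = (\<integral>z. a z * (cut z * (kp z * v + kq z * cnj v)) \<partial>lborel) + (\<integral>z. a z * ((cutp z * v + cutq z * cnj v) * k z) \<partial>lborel)"
        by (rule Bochner_Integration.integral_add[OF i1 i2])
      finally have "(\<integral>z. a z * (cut z * (kp z * v + kq z * cnj v)) \<partial>lborel)
        = - ((\<integral>z. av z * (cut z * k z) \<partial>lborel) + (\<integral>z. a z * ((cutp z * v + cutq z * cnj v) * k z) \<partial>lborel))"
        using e by (simp add: algebra_simps eq_neg_iff_add_eq_0)
      also have "(\<integral>z. av z * (cut z * k z) \<partial>lborel) + (\<integral>z. a z * ((cutp z * v + cutq z * cnj v) * k z) \<partial>lborel)
        = (\<integral>z. av z * (cut z * k z) + a z * ((cutp z * v + cutq z * cnj v) * k z) \<partial>lborel)"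
        by (rule Bochner_Integration.integral_add[OF i3 i2, symmetric])
      finally show ?thesis unfolding b_def bv_def by (simp only: mult.assoc distrib_right)
    qed
    note w1 = weak[OF wx ax] and w2 = weak[OF wy ay]
    let ?b1 = "bv ax 1" and ?b2 = "bv ay \<i>"
    note L1 = Lbv[OF ax(1), of 1] and L2 = Lbv[OF ay(1), of \<i>]
    have W: "wirt UNIV (Cau b) (\<lambda>z. (Cau ?b1 z - \<i> * Cau ?b2 z) / 2) (\<lambda>z. (Cau ?b1 z + \<i> * Cau ?b2 z) / 2)"
      by (rule Cau_wirt(1)[OF Lb L1 L2 q w1 w2])
    have ae: "AE z in lborel. (Cau ?b1 z + \<i> * Cau ?b2 z) / 2 = - (of_real pi * b z)"
      by (rule Cau_dbar_AE[OF Lb L1 L2 q w1 w2])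
    define c where "c z = a z * (1 - cut z)" for z
    have Xb2: "norm (1 - cut z) \<le> 2" for z using norm_triangle_ineq4[of 1 "cut z"] Xb[of z] by simp
    have Lc: "Lqc q R c" unfolding c_def[abs_def] by (rule Lqc_mult[OF a q0 _ Xb2]) measurable
    obtain p where p: "wirt (ball z0 (r / 2)) (Cau c) p (\<lambda>z. 0)"
      using Cau_outside_wirt[OF Lqc_integrable[OF Lc q], of z0 r] X1 r(1) by (auto simp: c_def)
    have sum: "Cau a z = Cau b z + Cau c z" for z
    proof -
      have "a \<zeta> * (1 / (\<zeta> - z)) = b \<zeta> * (1 / (\<zeta> - z)) + c \<zeta> * (1 / (\<zeta> - z))" for \<zeta>
        by (simp add: b_def c_def algebra_simps add_divide_distrib[symmetric])
      then show ?thesis unfolding Cau_def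
        by (simp only: Bochner_Integration.integral_add[OF Cau_integrable[OF Lb q] Cau_integrable[OF Lc q]])
    qed
    let ?U = "ball z0 (r / 2)"
    have "wirt ?U (\<lambda>z. Cau b z + Cau c z) (\<lambda>z. (Cau ?b1 z - \<i> * Cau ?b2 z) / 2 + p z) (\<lambda>z. (Cau ?b1 z + \<i> * Cau ?b2 z) / 2 + 0)"
      by (rule wirt_add[OF wirt_subset[OF W] p]) simp
    then have w: "wirt ?U (Cau a) (\<lambda>z. (Cau ?b1 z - \<i> * Cau ?b2 z) / 2 + p z) (\<lambda>z. (Cau ?b1 z + \<i> * Cau ?b2 z) / 2)"
      unfolding sum[symmetric] by simp
    have "AE z in lborel. z \<in> ?U \<longrightarrow> (Cau ?b1 z + \<i> * Cau ?b2 z) / 2 = - (of_real pi * a z)"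
      using ae
    proof eventually_elim
      fix z assume e: "(Cau ?b1 z + \<i> * Cau ?b2 z) / 2 = - (of_real pi * b z)"
      show "z \<in> ?U \<longrightarrow> (Cau ?b1 z + \<i> * Cau ?b2 z) / 2 = - (of_real pi * a z)"
      proof
        assume "z \<in> ?U"
        then have "z \<in> ball z0 r" using r(1) by auto
        then show "(Cau ?b1 z + \<i> * Cau ?b2 z) / 2 = - (of_real pi * a z)" unfolding e b_def using X1 by simp
      qed
    qed
    moreover have "?U \<subseteq> D" "z0 \<in> ?U" using r by auto
    ultimately show ?thesis using w open_ball by blast
  qed
  have "\<exists>U p q. open U \<and> z \<in> U \<and> U \<subseteq> D \<and> wirt U (Cau a) p q" if z: "z \<in> D" for z
  proof -
    obtain U p q' where "open U" "z \<in> U" "U \<subseteq> D" "wirt U (Cau a) p q'" using local[OF z] by (elim exE conjE)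
    then show ?thesis by (intro exI conjI)
  qed
  then obtain P Q where PQ: "wirt D (Cau a) P Q" by (rule wirt_local_global[OF D(1)])
  \<comment> \<open>The exceptional null set found near \<open>z0\<close> depends on
    \<open>z0\<close>. Local negligibility implies negligibility, which avoids an uncountable
    union.\<close>
  have "negligible {z \<in> D. Q z \<noteq> - (of_real pi * a z)}" (is "negligible ?S")
    unfolding locally_negligible_alt[of ?S]
  proof
    fix z0 assume z0: "z0 \<in> ?S"
    then have z0D: "z0 \<in> D" by simp
    then obtain U p q' where U: "open U" "z0 \<in> U" "U \<subseteq> D" "wirt U (Cau a) p q'" and ae: "AE z in lborel. z \<in> U \<longrightarrow> q' z = - (of_real pi * a z)"
      using local[OF z0D] by (elim exE conjE)
    have "Q z = q' z" if "z \<in> U" for z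
      using wirt_unique[OF wirt_subset[OF PQ U(3)] U(4) that] by simp
    with AE_completion[OF ae] aA have "AE z in lebesgue. z \<notin> ?S \<inter> U"
      by (auto elim!: eventually_mono)
    then obtain N where "negligible N" "{z. \<not> z \<notin> ?S \<inter> U} \<subseteq> N"
      unfolding eventually_ae_filter_negligible by (auto simp: subset_iff)
    then have "negligible (?S \<inter> U)" by (auto intro: negligible_subset)
    moreover have "openin (top_of_set ?S) (?S \<inter> U)" using U(1) by (rule openin_open_Int)
    ultimately show "\<exists>U. openin (top_of_set ?S) U \<and> z0 \<in> U \<and> negligible U" using z0 U(2) by blast
  qed
  then have "?S \<in> null_sets lebesgue" by (simp add: negligible_iff_null_sets)
  then have "AE z in lebesgue. z \<notin> ?S" by (rule AE_not_in)
  then have "AE z in lebesgue. z \<in> D \<longrightarrow> Q z = - (of_real pi * A z)"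
    using aA by eventually_elim auto
  with PQ show ?thesis by (rule that)
qed

lemma T_op_C1:
  assumes D: "open D" "bounded D" and q: "q > 2" and A: "sobolev_W1 q D A"
  obtains P Q where "continuous_on UNIV (T_op D A)" "wirt D (T_op D A) P Q" "AE z in lebesgue. z \<in> D \<longrightarrow> Q z = A z"
proof -
  obtain R where R: "D \<subseteq> cball 0 R" using D(2) by (auto simp: bounded_iff subset_iff)
  have q0: "q > 0" using q by simp
  have "Lq_on q D A" using A by (simp add: sobolev_W1_def)
  then obtain a where a: "Lqc q R a" "\<And>z. z \<notin> D \<Longrightarrow> a z = 0" "AE z in lebesgue. z \<in> D \<longrightarrow> a z = A z"
    using Lq_on_representative[OF _ D(1) R q0] by blast
  obtain P Q where PQ: "wirt D (Cau a) P Q" "AE z in lebesgue. z \<in> D \<longrightarrow> Q z = - (of_real pi * A z)"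
    using Cau_sobolev[OF D(1) R q A a] by blast
  have am: "a \<in> borel_measurable borel" using a(1) by (simp add: Lqc_def)
  have T: "T_op D A = (\<lambda>z. (- (1 / of_real pi)) * Cau a z)"
  proof
    fix z
    have "(LINT \<zeta>:D|lebesgue. A \<zeta> * (1 / (\<zeta> - z))) = Cau a z"
      unfolding Cau_def by (rule representative_integral[OF am a(2,3)]) measurable
    then show "T_op D A z = (- (1 / of_real pi)) * Cau a z" by (simp add: T_op_def)
  qed
  show ?thesis
  proof (rule that)
    show "continuous_on UNIV (T_op D A)" unfolding T by (intro continuous_intros Cau_continuous[OF a(1) q])
    show "wirt D (T_op D A) (\<lambda>z. (- (1 / of_real pi)) * P z) (\<lambda>z. (- (1 / of_real pi)) * Q z)"
      unfolding T by (rule wirt_cmult[OF PQ(1)])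
    show "AE z in lebesgue. z \<in> D \<longrightarrow> (- (1 / of_real pi)) * Q z = A z"
      using PQ(2) by eventually_elim simp
  qed
qed

subsection \<open>Weak formulations\<close>

lemma continuous_extend_zero:
  fixes g :: "complex \<Rightarrow> complex"
  assumes "continuous_on D g" "open D" "closed K" "K \<subseteq> D" "\<And>z. z \<notin> K \<Longrightarrow> g z = 0"
  shows "continuous_on UNIV g"
proof -
  have "continuous_on (-K) (\<lambda>z. 0 :: complex)" by simp
  then have "continuous_on (-K) g" by (rule continuous_on_eq) (use assms in auto)
  then have "continuous_on (D \<union> -K) g"
    using assms by (intro continuous_on_open_Un) auto
  moreover have "D \<union> -K = UNIV" using assms by auto
  ultimately show ?thesis by simp
qed

lemma continuous_locally_integrable:
  assumes "continuous_on D f" shows "locally_integrable_on f D"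
  unfolding locally_integrable_on_def set_integrable_def
proof (intro allI impI)
  fix K assume K: "compact K \<and> K \<subseteq> D"
  have "integrable lborel (\<lambda>z. indicator K z *\<^sub>R f z)"
    by (rule borel_integrable_compact) (use K continuous_on_subset[OF assms] in auto)
  moreover from this have "(\<lambda>z. indicator K z *\<^sub>R f z) \<in> borel_measurable lborel" by auto
  ultimately show "integrable lebesgue (\<lambda>z. indicator K z *\<^sub>R f z)"
    using integrable_completion by blast
qed

lemma set_integral_compact_support:
  fixes F :: "complex \<Rightarrow> complex"
  assumes "continuous_on UNIV F" "\<And>z. z \<notin> D \<Longrightarrow> F z = 0"
  shows "(LINT z:D|lebesgue. F z) = (\<integral>z. F z \<partial>lborel)"
proof -
  have "(\<lambda>z. indicator D z *\<^sub>R F z) = F" using assms(2) by (auto simp: fun_eq_iff indicator_def)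
  then have "(LINT z:D|lebesgue. F z) = integral\<^sup>L lebesgue F" by (simp add: set_lebesgue_integral_def)
  also have "\<dots> = (\<integral>z. F z \<partial>lborel)"
    by (rule integral_completion) (use borel_measurable_continuous_onI[OF assms(1)] in simp)
  finally show ?thesis .
qed

lemma test_fun_wirt:
  assumes "test_fun D \<phi>"
  obtains p q where "wirt UNIV \<phi> p q" "\<And>z v. frechet_derivative \<phi> (at z) v = p z * v + q z * cnj v"
proof -
  have Ck1: "Ck (Suc 0) \<phi>" using assms by (auto simp: test_fun_def)
  then have d: "\<phi> differentiable (at z)" for z by simp
  have c: "continuous_on UNIV (\<lambda>z. frechet_derivative \<phi> (at z) 1)" "continuous_on UNIV (\<lambda>z. frechet_derivative \<phi> (at z) \<i>)"
    using Ck1 by simp_all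
  define p q where "p z = (frechet_derivative \<phi> (at z) 1 - \<i> * frechet_derivative \<phi> (at z) \<i>) / 2"
    and "q z = (frechet_derivative \<phi> (at z) 1 + \<i> * frechet_derivative \<phi> (at z) \<i>) / 2" for z
  have fd: "(\<phi> has_derivative frechet_derivative \<phi> (at z)) (at z)" for z
    using d frechet_derivative_works by blast
  have e: "frechet_derivative \<phi> (at z) v = p z * v + q z * cnj v" for z v
  proof -
    interpret bounded_linear "frechet_derivative \<phi> (at z)" using fd by (rule has_derivative_bounded_linear)
    have "v = Re v *\<^sub>R 1 + Im v *\<^sub>R \<i>" by (simp add: complex_eq_iff)
    then have "frechet_derivative \<phi> (at z) v = frechet_derivative \<phi> (at z) (Re v *\<^sub>R 1 + Im v *\<^sub>R \<i>)" by simp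
    also have "\<dots> = of_real (Re v) * frechet_derivative \<phi> (at z) 1 + of_real (Im v) * frechet_derivative \<phi> (at z) \<i>"
      by (simp only: add scale) (simp only: scaleR_conv_of_real)
    finally have 1: "frechet_derivative \<phi> (at z) v = of_real (Re v) * frechet_derivative \<phi> (at z) 1 + of_real (Im v) * frechet_derivative \<phi> (at z) \<i>" .
    have alg: "of_real (Re v) * x + of_real (Im v) * y = (x - \<i> * y) / 2 * v + (x + \<i> * y) / 2 * cnj v" for x y
      by (simp add: complex_eq_iff field_simps)
    show ?thesis unfolding 1 p_def q_def by (rule alg)
  qed
  have "wirt UNIV \<phi> p q" unfolding wirt_def
  proof (intro conjI ballI)
    show "(\<phi> has_derivative (\<lambda>h. p z * h + q z * cnj h)) (at z)" for z
      using fd[of z] unfolding e[abs_def] by (simp add: e[abs_def] fun_eq_iff)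
    show "continuous_on UNIV p" "continuous_on UNIV q" unfolding p_def[abs_def] q_def[abs_def]
      by (intro continuous_intros c; simp)+
  qed
  then show ?thesis using e that by blast
qed

text \<open>The product \<open>f * \<phi>\<close> extends by zero to a C^1 function of compact
  support on the plane, so its derivative integrates to \<open>0\<close>, whatever \<open>f\<close>
  does near the boundary.\<close>

lemma wirt_weak_partial:
  assumes D: "open D" and f: "wirt D f p q"
  shows "has_weak_partial D v f (\<lambda>z. p z * v + q z * cnj v)"
  unfolding has_weak_partial_def
proof (intro conjI allI impI)
  note fc = wirt_cont[OF f]
  show "locally_integrable_on f D" by (rule continuous_locally_integrable[OF fc(1)])
  show "locally_integrable_on (\<lambda>z. p z * v + q z * cnj v) D"
    by (intro continuous_locally_integrable continuous_intros fc)
  fix \<phi> assume t: "test_fun D \<phi>"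
  obtain r s where \<phi>: "wirt UNIV \<phi> r s" and fd: "\<And>z v. frechet_derivative \<phi> (at z) v = r z * v + s z * cnj v"
    using test_fun_wirt[OF t] by blast
  define K where "K = closure {z. \<phi> z \<noteq> 0}"
  have K: "compact K" "K \<subseteq> D" using t by (auto simp: K_def test_fun_def)
  have cK: "closed K" using K(1) by (rule compact_imp_closed)
  have z: "\<phi> z = 0" if "z \<notin> K" for z using that closure_subset[of "{z. \<phi> z \<noteq> 0}"] by (auto simp: K_def)
  have rs: "r z = 0" "s z = 0" if "z \<notin> K" for z using wirt_zero_outside[OF \<phi> cK z that] by auto
  obtain R where R: "K \<subseteq> cball 0 R" using compact_imp_bounded[OF K(1)] by (auto simp: bounded_iff subset_iff)
  note \<phi>c = continuous_on_subset[OF wirt_cont(1)[OF \<phi>] subset_UNIV] continuous_on_subset[OF wirt_cont(2)[OF \<phi>] subset_UNIV]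
    continuous_on_subset[OF wirt_cont(3)[OF \<phi>] subset_UNIV]
  have notK: "z \<notin> K" if "z \<notin> cball 0 R" for z using R that by blast
  have F: "wirt UNIV (\<lambda>z. f z * \<phi> z) (\<lambda>z. p z * \<phi> z + f z * r z) (\<lambda>z. q z * \<phi> z + f z * s z)"
    by (rule wirt_extend_zero[OF wirt_mult[OF f wirt_subset[OF \<phi>]] D cK K(2)]) (use z rs in auto)
  have 0: "(\<integral>z. (p z * \<phi> z + f z * r z) * v + (q z * \<phi> z + f z * s z) * cnj v \<partial>lborel) = 0"
    by (rule integral_derivative_compact_support[OF F, of R]) (use z[OF notK] in simp)
  have c1: "continuous_on UNIV (\<lambda>z. f z * (r z * v + s z * cnj v))"
    by (rule continuous_extend_zero[OF _ D cK K(2)]) (use rs in \<open>auto intro!: continuous_intros fc \<phi>c\<close>)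
  have c2: "continuous_on UNIV (\<lambda>z. (p z * v + q z * cnj v) * \<phi> z)"
    by (rule continuous_extend_zero[OF _ D cK K(2)]) (use z in \<open>auto intro!: continuous_intros fc \<phi>c\<close>)
  have z1: "f z * (r z * v + s z * cnj v) = 0" "(p z * v + q z * cnj v) * \<phi> z = 0" if "z \<notin> K" for z
    using z[OF that] rs[OF that] by auto
  have i1: "integrable lborel (\<lambda>z. f z * (r z * v + s z * cnj v))"
    by (rule compact_support_integrable[OF c1, of R]) (use z1[OF notK] in simp)
  have i2: "integrable lborel (\<lambda>z. (p z * v + q z * cnj v) * \<phi> z)"
    by (rule compact_support_integrable[OF c2, of R]) (use z1[OF notK] in simp)
  have "(\<integral>z. f z * (r z * v + s z * cnj v) + (p z * v + q z * cnj v) * \<phi> z \<partial>lborel) = 0"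
    unfolding 0[symmetric] by (intro Bochner_Integration.integral_cong refl) (simp add: algebra_simps)
  then have "(\<integral>z. f z * (r z * v + s z * cnj v) \<partial>lborel) = - (\<integral>z. (p z * v + q z * cnj v) * \<phi> z \<partial>lborel)"
    using i1 i2 by (simp add: eq_neg_iff_add_eq_0)
  moreover have "(LINT z:D|lebesgue. f z * frechet_derivative \<phi> (at z) v) = (\<integral>z. f z * (r z * v + s z * cnj v) \<partial>lborel)"
    unfolding fd by (rule set_integral_compact_support[OF c1], rule z1) (use K in blast)
  moreover have "(LINT z:D|lebesgue. (p z * v + q z * cnj v) * \<phi> z) = (\<integral>z. (p z * v + q z * cnj v) * \<phi> z \<partial>lborel)"
    by (rule set_integral_compact_support[OF c2], rule z1) (use K in blast)
  ultimately show "(LINT z:D|lebesgue. f z * frechet_derivative \<phi> (at z) v) = - (LINT z:D|lebesgue. (p z * v + q z * cnj v) * \<phi> z)"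
    by simp
qed

lemma wirt_weak_dbar:
  assumes "open D" "wirt D f p q"
  shows "has_weak_dbar D f q"
  unfolding has_weak_dbar_def
proof (intro exI conjI)
  show "has_weak_partial D 1 f (\<lambda>z. p z * 1 + q z * cnj 1)" "has_weak_partial D \<i> f (\<lambda>z. p z * \<i> + q z * cnj \<i>)"
    by (rule wirt_weak_partial[OF assms])+
  show "AE z in lebesgue. z \<in> D \<longrightarrow> q z = 1 / 2 * (p z * 1 + q z * cnj 1 + \<i> * (p z * \<i> + q z * cnj \<i>))"
    by (intro AE_I2) (simp add: algebra_simps)
qed

section \<open>Moving dbar from a weak solution onto C^1 test functions\<close>

lemma locally_integrable_mult:
  fixes f h :: "complex \<Rightarrow> complex"
  assumes f: "locally_integrable_on f D" and K: "compact K" "K \<subseteq> D" and h: "continuous_on UNIV h" "\<And>z. z \<notin> K \<Longrightarrow> h z = 0"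
  shows "integrable lebesgue (\<lambda>z. indicator D z *\<^sub>R (f z * h z))"
proof -
  obtain R where R: "K \<subseteq> cball 0 R" using compact_imp_bounded[OF K(1)] by (auto simp: bounded_iff subset_iff)
  have hR: "h z = 0" if "z \<notin> cball 0 R" for z using h(2) R that by blast
  obtain C where C: "C \<ge> 0" "\<And>z. norm (h z) \<le> C" using compact_support_bounded[OF h(1) hR] by blast
  have i: "integrable lebesgue (\<lambda>z. indicator K z *\<^sub>R f z)"
    using f K by (auto simp: locally_integrable_on_def set_integrable_def)
  have hm: "h \<in> borel_measurable lebesgue"
    using borel_measurable_continuous_onI[OF h(1)] by (auto intro: measurable_completion)
  have eq: "(\<lambda>z. indicator D z *\<^sub>R (f z * h z)) = (\<lambda>z. (indicator K z *\<^sub>R f z) * h z)"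
    using K h(2) by (auto simp: fun_eq_iff indicator_def)
  show ?thesis unfolding eq
  proof (rule Bochner_Integration.integrable_bound)
    show "integrable lebesgue (\<lambda>z. of_real C * (indicator K z *\<^sub>R f z))" using i by (rule integrable_mult_right)
    show "(\<lambda>z. (indicator K z *\<^sub>R f z) * h z) \<in> borel_measurable lebesgue" using i hm by (intro borel_measurable_times) auto
    show "AE z in lebesgue. norm ((indicator K z *\<^sub>R f z) * h z) \<le> norm (of_real C * (indicator K z *\<^sub>R f z))"
    proof (rule AE_I2)
      fix z
      have "norm (indicator K z *\<^sub>R f z) * norm (h z) \<le> norm (indicator K z *\<^sub>R f z) * C"
        by (intro mult_left_mono C(2) norm_ge_zero)
      then show "norm ((indicator K z *\<^sub>R f z) * h z) \<le> norm (of_real C * (indicator K z *\<^sub>R f z))"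
        unfolding norm_mult norm_of_real using C(1) by (simp add: mult.commute)
    qed
  qed
qed

text \<open>The right-hand integrand is passed as a separate \<open>G\<close>, fixed up to null
  sets: in the application \<open>g\<close> involves \<open>A\<close>, which is replaced there by
  the continuous function \<open>Bq\<close> so that the single terms are integrable.\<close>

lemma weak_dbar_C1_test:
  assumes w: "has_weak_dbar D w g" and D: "open D"
    and \<psi>: "wirt UNIV \<psi> p q" and K: "compact K" "K \<subseteq> D" and z: "\<And>z. z \<notin> K \<Longrightarrow> \<psi> z = 0"
    and G: "integrable lebesgue (\<lambda>z. indicator D z *\<^sub>R G z)" "AE z in lebesgue. z \<in> D \<longrightarrow> G z = g z * \<psi> z"
  shows "(LINT z:D|lebesgue. w z * q z) = - (LINT z:D|lebesgue. G z)"
proof -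
  obtain wx wy where wx: "has_weak_partial D 1 w wx" and wy: "has_weak_partial D \<i> w wy"
    and g: "AE z in lebesgue. z \<in> D \<longrightarrow> g z = 1 / 2 * (wx z + \<i> * wy z)"
    using w by (auto simp: has_weak_dbar_def)
  have li: "locally_integrable_on w D" "locally_integrable_on wx D" "locally_integrable_on wy D"
    using wx wy by (auto simp: has_weak_partial_def)
  note c = wirt_cont[OF \<psi>]
  have pq: "p z = 0" "q z = 0" if "z \<notin> K" for z
    using wirt_zero_outside[OF \<psi> compact_imp_closed[OF K(1)] z that] by auto
  have e1: "(LINT z:D|lebesgue. w z * (p z * 1 + q z * cnj 1)) = - (LINT z:D|lebesgue. wx z * \<psi> z)"
    by (rule weak_partial_C1_test[OF wx D \<psi> K z])
  have e2: "(LINT z:D|lebesgue. w z * (p z * \<i> + q z * cnj \<i>)) = - (LINT z:D|lebesgue. wy z * \<psi> z)"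
    by (rule weak_partial_C1_test[OF wy D \<psi> K z])
  have i1: "integrable lebesgue (\<lambda>z. indicator D z *\<^sub>R (w z * (p z * 1 + q z * cnj 1)))"
    by (rule locally_integrable_mult[OF li(1) K]) (use pq in \<open>auto intro!: continuous_intros c\<close>)
  have i2: "integrable lebesgue (\<lambda>z. indicator D z *\<^sub>R (w z * (p z * \<i> + q z * cnj \<i>)))"
    by (rule locally_integrable_mult[OF li(1) K]) (use pq in \<open>auto intro!: continuous_intros c\<close>)
  have i3: "integrable lebesgue (\<lambda>z. indicator D z *\<^sub>R (wx z * \<psi> z))"
    by (rule locally_integrable_mult[OF li(2) K c(1) z])
  have i4: "integrable lebesgue (\<lambda>z. indicator D z *\<^sub>R (wy z * \<psi> z))"
    by (rule locally_integrable_mult[OF li(3) K c(1) z])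
  have "(LINT z:D|lebesgue. w z * q z) = integral\<^sup>L lebesgue (\<lambda>z. (1/2) * (indicator D z *\<^sub>R (w z * (p z * 1 + q z * cnj 1)) + \<i> * (indicator D z *\<^sub>R (w z * (p z * \<i> + q z * cnj \<i>)))))"
    unfolding set_lebesgue_integral_def by (intro Bochner_Integration.integral_cong refl) (simp add: indicator_def algebra_simps)
  also have "\<dots> = (1/2) * ((LINT z:D|lebesgue. w z * (p z * 1 + q z * cnj 1)) + \<i> * (LINT z:D|lebesgue. w z * (p z * \<i> + q z * cnj \<i>)))"
    unfolding set_lebesgue_integral_def
    by (simp only: Bochner_Integration.integral_mult_right_zero Bochner_Integration.integral_add[OF i1 integrable_mult_right[OF i2]])
  also have "\<dots> = - ((1/2) * ((LINT z:D|lebesgue. wx z * \<psi> z) + \<i> * (LINT z:D|lebesgue. wy z * \<psi> z)))"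
    unfolding e1 e2 by (simp add: algebra_simps)
  also have "(1/2) * ((LINT z:D|lebesgue. wx z * \<psi> z) + \<i> * (LINT z:D|lebesgue. wy z * \<psi> z))
     = integral\<^sup>L lebesgue (\<lambda>z. (1/2) * (indicator D z *\<^sub>R (wx z * \<psi> z) + \<i> * (indicator D z *\<^sub>R (wy z * \<psi> z))))"
    unfolding set_lebesgue_integral_def
    by (simp only: Bochner_Integration.integral_mult_right_zero Bochner_Integration.integral_add[OF i3 integrable_mult_right[OF i4]])
  also have "\<dots> = (LINT z:D|lebesgue. G z)"
    unfolding set_lebesgue_integral_def
  proof (rule integral_cong_AE)
    have "integrable lebesgue (\<lambda>z. (1/2) * (indicator D z *\<^sub>R (wx z * \<psi> z) + \<i> * (indicator D z *\<^sub>R (wy z * \<psi> z))))"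
      by (intro integrable_mult_right Bochner_Integration.integrable_add i3 i4)
    then show "(\<lambda>z. (1/2) * (indicator D z *\<^sub>R (wx z * \<psi> z) + \<i> * (indicator D z *\<^sub>R (wy z * \<psi> z)))) \<in> borel_measurable lebesgue" by auto
    show "(\<lambda>z. indicator D z *\<^sub>R G z) \<in> borel_measurable lebesgue" using G(1) by auto
    show "AE z in lebesgue. (1/2) * (indicator D z *\<^sub>R (wx z * \<psi> z) + \<i> * (indicator D z *\<^sub>R (wy z * \<psi> z))) = indicator D z *\<^sub>R G z"
      using g G(2) by eventually_elim (auto simp: indicator_def algebra_simps)
  qed
  finally show ?thesis .
qed

text \<open>Weak form of the substitution \<open>w = e\<^sup>B u\<close>: dbar of
  \<open>exp (- B) * \<phi>\<close> is \<open>exp (- B)\<close> times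
  \<open>\<phi>1 - A * \<phi>\<close>, and the second summand cancels the term with \<open>A\<close>
  in the equation. As \<open>exp (- B)\<close> is only C^1, the two first-order equations are tested
  one after the other, the one for \<open>w\<close> with \<open>exp (- B) * \<phi>1\<close> and the
  one for \<open>v\<close> with \<open>exp (- B) * \<phi>\<close>.\<close>

lemma dbar_minus_twice_test:
  assumes D: "open D" and B: "wirt D B Bp Bq" and BA: "AE z in lebesgue. z \<in> D \<longrightarrow> Bq z = A z"
    and w: "dbar_minus A D w v" and v: "dbar_minus A D v (\<lambda>_. 0)"
    and \<phi>: "wirt UNIV \<phi> p \<phi>1" and \<phi>1: "wirt UNIV \<phi>1 p1 \<phi>2"
    and K: "compact K" "K \<subseteq> D" and z: "\<And>z. z \<notin> K \<Longrightarrow> \<phi> z = 0"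
  shows "(LINT z:D|lebesgue. w z * exp (- B z) * \<phi>2 z) = 0"
proof -
  obtain g where g: "has_weak_dbar D w g" "AE z in lebesgue. z \<in> D \<longrightarrow> v z = g z - A z * w z"
    using w by (auto simp: dbar_minus_def)
  obtain g' where g': "has_weak_dbar D v g'" "AE z in lebesgue. z \<in> D \<longrightarrow> 0 = g' z - A z * v z"
    using v by (auto simp: dbar_minus_def)
  have li: "locally_integrable_on w D" "locally_integrable_on v D"
    using g(1) g'(1) by (auto simp: has_weak_dbar_def has_weak_partial_def)
  have cK: "closed K" using K(1) by (rule compact_imp_closed)
  have z1: "\<phi>1 z = 0" if "z \<notin> K" for z using wirt_zero_outside[OF \<phi> cK z that] by auto
  have z2: "\<phi>2 z = 0" "p1 z = 0" if "z \<notin> K" for z using wirt_zero_outside[OF \<phi>1 cK z1 that] by auto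
  have zp: "p z = 0" if "z \<notin> K" for z using wirt_zero_outside[OF \<phi> cK z that] by auto
  have E: "wirt D (\<lambda>z. exp (- B z)) (\<lambda>z. exp (- B z) * - Bp z) (\<lambda>z. exp (- B z) * - Bq z)"
    using wirt_exp[OF wirt_cmult[OF B, of "-1"]] by simp
  note Ec = wirt_cont[OF E] and Bc = wirt_cont[OF B]
  have cD: "continuous_on D \<phi>" "continuous_on D \<phi>1" "continuous_on D \<phi>2"
    using wirt_cont[OF \<phi>] wirt_cont[OF \<phi>1] by (auto intro: continuous_on_subset)
  have W1: "wirt UNIV (\<lambda>z. exp (- B z) * \<phi>1 z) (\<lambda>z. exp (- B z) * - Bp z * \<phi>1 z + exp (- B z) * p1 z) (\<lambda>z. exp (- B z) * - Bq z * \<phi>1 z + exp (- B z) * \<phi>2 z)"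
    by (rule wirt_extend_zero[OF wirt_mult[OF E wirt_subset[OF \<phi>1]] D cK K(2)]) (use z1 z2 in auto)
  have W2: "wirt UNIV (\<lambda>z. exp (- B z) * \<phi> z) (\<lambda>z. exp (- B z) * - Bp z * \<phi> z + exp (- B z) * p z) (\<lambda>z. exp (- B z) * - Bq z * \<phi> z + exp (- B z) * \<phi>1 z)"
    by (rule wirt_extend_zero[OF wirt_mult[OF E wirt_subset[OF \<phi>]] D cK K(2)]) (use z z1 zp in auto)
  have I: "integrable lebesgue (\<lambda>z. indicator D z *\<^sub>R (f z * h z))"
    if "locally_integrable_on f D" "continuous_on D h" "\<And>z. z \<notin> K \<Longrightarrow> h z = 0" for f h
    by (rule locally_integrable_mult[OF that(1) K continuous_extend_zero[OF that(2) D cK K(2) that(3)] that(3)])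
  let ?e = "\<lambda>z. exp (- B z)"
  have I1: "integrable lebesgue (\<lambda>z. indicator D z *\<^sub>R (w z * (?e z * \<phi>2 z)))"
    and I2: "integrable lebesgue (\<lambda>z. indicator D z *\<^sub>R (w z * (Bq z * ?e z * \<phi>1 z)))"
    and I3: "integrable lebesgue (\<lambda>z. indicator D z *\<^sub>R (v z * (?e z * \<phi>1 z)))"
    and I4: "integrable lebesgue (\<lambda>z. indicator D z *\<^sub>R (v z * (Bq z * ?e z * \<phi> z)))"
    by (rule I; use li z z1 z2 in \<open>auto intro!: continuous_intros Ec(1) Bc cD\<close>)+
  note I1' = I1[folded set_integrable_def] and I2' = I2[folded set_integrable_def]
    and I3' = I3[folded set_integrable_def] and I4' = I4[folded set_integrable_def]
  have "(LINT z:D|lebesgue. w z * (?e z * - Bq z * \<phi>1 z + ?e z * \<phi>2 z)) = - (LINT z:D|lebesgue. v z * (?e z * \<phi>1 z) + w z * (Bq z * ?e z * \<phi>1 z))"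
  proof (rule weak_dbar_C1_test[OF g(1) D W1 K])
    show "integrable lebesgue (\<lambda>z. indicator D z *\<^sub>R (v z * (?e z * \<phi>1 z) + w z * (Bq z * ?e z * \<phi>1 z)))"
      unfolding scaleR_add_right by (rule Bochner_Integration.integrable_add[OF I3 I2])
    show "AE z in lebesgue. z \<in> D \<longrightarrow> v z * (?e z * \<phi>1 z) + w z * (Bq z * ?e z * \<phi>1 z) = g z * (?e z * \<phi>1 z)"
      using g(2) BA by eventually_elim (auto simp: left_diff_distrib right_diff_distrib mult_ac)
  qed (use z1 in auto)
  also have "(LINT z:D|lebesgue. w z * (?e z * - Bq z * \<phi>1 z + ?e z * \<phi>2 z)) = (LINT z:D|lebesgue. w z * (?e z * \<phi>2 z) - w z * (Bq z * ?e z * \<phi>1 z))"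
    by (simp add: algebra_simps)
  also have "\<dots> = (LINT z:D|lebesgue. w z * (?e z * \<phi>2 z)) - (LINT z:D|lebesgue. w z * (Bq z * ?e z * \<phi>1 z))"
    by (rule set_integral_diff(2)[OF I1' I2'])
  also have "(LINT z:D|lebesgue. v z * (?e z * \<phi>1 z) + w z * (Bq z * ?e z * \<phi>1 z)) = (LINT z:D|lebesgue. v z * (?e z * \<phi>1 z)) + (LINT z:D|lebesgue. w z * (Bq z * ?e z * \<phi>1 z))"
    by (rule set_integral_add(2)[OF I3' I2'])
  finally have A1: "(LINT z:D|lebesgue. w z * (?e z * \<phi>2 z)) = - (LINT z:D|lebesgue. v z * (?e z * \<phi>1 z))" by simp
  have "(LINT z:D|lebesgue. v z * (?e z * - Bq z * \<phi> z + ?e z * \<phi>1 z)) = - (LINT z:D|lebesgue. v z * (Bq z * ?e z * \<phi> z))"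
  proof (rule weak_dbar_C1_test[OF g'(1) D W2 K _ I4])
    show "AE z in lebesgue. z \<in> D \<longrightarrow> v z * (Bq z * ?e z * \<phi> z) = g' z * (?e z * \<phi> z)"
      using g'(2) BA by eventually_elim (auto simp: mult_ac)
  qed (use z in auto)
  also have "(LINT z:D|lebesgue. v z * (?e z * - Bq z * \<phi> z + ?e z * \<phi>1 z)) = (LINT z:D|lebesgue. v z * (?e z * \<phi>1 z) - v z * (Bq z * ?e z * \<phi> z))"
    by (simp add: algebra_simps)
  also have "\<dots> = (LINT z:D|lebesgue. v z * (?e z * \<phi>1 z)) - (LINT z:D|lebesgue. v z * (Bq z * ?e z * \<phi> z))"
    by (rule set_integral_diff(2)[OF I3' I4'])
  finally have "(LINT z:D|lebesgue. v z * (?e z * \<phi>1 z)) = 0" by simp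
  with A1 show ?thesis by (simp add: mult.assoc)
qed

text \<open>Conjugation by \<open>exp B\<close> turns \<open>dbar - A\<close> into dbar, which maps
  \<open>p0 + cnj z * p1\<close> to \<open>p1\<close> and then to \<open>0\<close>. The intermediate
  function is \<open>exp B * p1\<close>.\<close>

lemma bianalytic_solution:
  assumes D: "open D" and B: "continuous_on UNIV B" "wirt D B Bp Bq" and BA: "AE z in lebesgue. z \<in> D \<longrightarrow> Bq z = A z"
    and h: "\<And>z. z \<in> \<Gamma> \<Longrightarrow> h z = poly p0 z + cnj z * poly p1 z"
  shows "dirichlet_solution A D \<Gamma> (\<lambda>z. exp (B z) * h z) (\<lambda>z. exp (B z) * (poly p0 z + cnj z * poly p1 z))"
  unfolding dirichlet_solution_def
proof (intro conjI exI ballI)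
  show "continuous_on (closure D) (\<lambda>z. exp (B z) * (poly p0 z + cnj z * poly p1 z))"
    by (intro continuous_intros continuous_on_subset[OF B(1)]) auto
  have P: "wirt D (poly p) (poly (pderiv p)) (\<lambda>z. 0)" for p
    by (rule wirt_holomorphic) (auto intro!: poly_DERIV continuous_intros)
  have E: "wirt D (\<lambda>z. exp (B z)) (\<lambda>z. exp (B z) * Bp z) (\<lambda>z. exp (B z) * Bq z)" by (rule wirt_exp[OF B(2)])
  have U: "wirt D (\<lambda>z. poly p0 z + cnj z * poly p1 z) (\<lambda>z. poly (pderiv p0) z + cnj z * poly (pderiv p1) z) (poly p1)"
    using wirt_add[OF P wirt_mult[OF wirt_cnj_id P], of p0 p1] by simp
  show "dbar_minus A D (\<lambda>z. exp (B z) * (poly p0 z + cnj z * poly p1 z)) (\<lambda>z. exp (B z) * poly p1 z)"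
    unfolding dbar_minus_def
  proof (intro exI conjI)
    show "has_weak_dbar D (\<lambda>z. exp (B z) * (poly p0 z + cnj z * poly p1 z)) (\<lambda>z. exp (B z) * Bq z * (poly p0 z + cnj z * poly p1 z) + exp (B z) * poly p1 z)"
      by (rule wirt_weak_dbar[OF D wirt_mult[OF E U]])
    show "AE z in lebesgue. z \<in> D \<longrightarrow> exp (B z) * poly p1 z = exp (B z) * Bq z * (poly p0 z + cnj z * poly p1 z) + exp (B z) * poly p1 z - A z * (exp (B z) * (poly p0 z + cnj z * poly p1 z))"
      using BA by eventually_elim (auto simp: algebra_simps)
  qed
  show "dbar_minus A D (\<lambda>z. exp (B z) * poly p1 z) (\<lambda>_. 0)"
    unfolding dbar_minus_def
  proof (intro exI conjI)
    show "has_weak_dbar D (\<lambda>z. exp (B z) * poly p1 z) (\<lambda>z. exp (B z) * Bq z * poly p1 z + exp (B z) * 0)"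
      by (rule wirt_weak_dbar[OF D wirt_mult[OF E P]])
    show "AE z in lebesgue. z \<in> D \<longrightarrow> 0 = exp (B z) * Bq z * poly p1 z + exp (B z) * 0 - A z * (exp (B z) * poly p1 z)"
      using BA by eventually_elim (auto simp: algebra_simps)
  qed
  show "exp (B z) * (poly p0 z + cnj z * poly p1 z) = exp (B z) * h z" if "z \<in> \<Gamma>" for z using h[OF that] by simp
qed

subsection \<open>Polynomials in z and its conjugate on a conic\<close>

text \<open>Functions rather than formal polynomials: only values are compared, and the arguments
  are inductions over monomials and sums.\<close>

inductive bipoly :: "(complex \<Rightarrow> complex) \<Rightarrow> bool" where
  monom: "bipoly (\<lambda>z. c * (z ^ j * cnj z ^ k))"
| add: "bipoly f \<Longrightarrow> bipoly g \<Longrightarrow> bipoly (\<lambda>z. f z + g z)"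

lemma bipoly_const: "bipoly (\<lambda>z. c)"
  using bipoly.monom[of c 0 0] by simp

lemma bipoly_mult:
  assumes "bipoly f" "bipoly g" shows "bipoly (\<lambda>z. f z * g z)"
  using assms(1)
proof induction
  case (monom c j k)
  show ?case using assms(2)
  proof induction
    case (monom c' j' k')
    have "bipoly (\<lambda>z. (c * c') * (z ^ (j + j') * cnj z ^ (k + k')))" by (rule bipoly.monom)
    then show ?case by (simp add: power_add mult_ac)
  next
    case (add f g)
    then show ?case using bipoly.add[of "\<lambda>z. c * (z ^ j * cnj z ^ k) * f z" "\<lambda>z. c * (z ^ j * cnj z ^ k) * g z"]
      by (simp add: distrib_left)
  qed
next
  case (add f f')
  then show ?case using bipoly.add[of "\<lambda>z. f z * g z" "\<lambda>z. f' z * g z"] by (simp add: distrib_right)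
qed

lemma bipoly_Re: "bipoly (\<lambda>z. of_real (Re z))"
proof -
  have "bipoly (\<lambda>z. (1/2) * (z ^ 1 * cnj z ^ 0) + (1/2) * (z ^ 0 * cnj z ^ 1))" by (intro bipoly.intros)
  moreover have "(1/2) * (z ^ 1 * cnj z ^ 0) + (1/2) * (z ^ 0 * cnj z ^ 1) = of_real (Re z)" for z
    by (simp add: complex_eq_iff)
  ultimately show ?thesis by simp
qed

lemma bipoly_Im: "bipoly (\<lambda>z. of_real (Im z))"
proof -
  have "bipoly (\<lambda>z. (-\<i>/2) * (z ^ 1 * cnj z ^ 0) + (\<i>/2) * (z ^ 0 * cnj z ^ 1))" by (intro bipoly.intros)
  moreover have "(-\<i>/2) * (z ^ 1 * cnj z ^ 0) + (\<i>/2) * (z ^ 0 * cnj z ^ 1) = of_real (Im z)" for z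
    by (simp add: complex_eq_iff)
  ultimately show ?thesis by simp
qed

lemma bipoly_poly_xy: "bipoly (poly_xy P)"
proof -
  have 1: "bipoly (\<lambda>z. poly p (of_real (Re z)))" for p
  proof (induction p)
    case (pCons a p)
    then show ?case using bipoly.add[OF bipoly_const[of a] bipoly_mult[OF bipoly_Re pCons(2)]] by simp
  qed (simp add: bipoly_const)
  have "bipoly (\<lambda>z. poly (poly P [:of_real (Im z):]) (of_real (Re z)))"
  proof (induction P)
    case (pCons a P)
    then show ?case using bipoly.add[OF 1[of a] bipoly_mult[OF bipoly_Im pCons(2)]] by simp
  qed (simp add: bipoly_const)
  then show ?thesis by (simp add: poly_xy_def[abs_def])
qed

text \<open>Interface to the Stone-Weierstrass theorem, which is phrased with polynomials in real
  linear functionals; each such functional on the plane is a combination of \<open>Re\<close> and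
  \<open>Im\<close>.\<close>

lemma bipoly_polynomial_function:
  fixes g :: "complex \<Rightarrow> complex"
  assumes "polynomial_function g" shows "bipoly g"
proof -
  have r: "bipoly (\<lambda>z. of_real (p z))" if "real_polynomial_function p" for p :: "complex \<Rightarrow> real"
    using that
  proof induction
    case (linear p)
    then interpret bounded_linear p .
    have lin: "p z = Re z * p 1 + Im z * p \<i>" for z
    proof -
      have "p z = p (Re z *\<^sub>R 1 + Im z *\<^sub>R \<i>)" by (rule arg_cong[of _ _ p]) (simp add: complex_eq_iff)
      then show ?thesis by (simp only: add scale) simp
    qed
    have eq: "(\<lambda>z. complex_of_real (p z)) = (\<lambda>z. of_real (Re z) * of_real (p 1) + of_real (Im z) * of_real (p \<i>))"
    proof
      fix z show "complex_of_real (p z) = of_real (Re z) * of_real (p 1) + of_real (Im z) * of_real (p \<i>)"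
        unfolding lin[of z] by simp
    qed
    show ?case unfolding eq by (intro bipoly.add bipoly_mult bipoly_Re bipoly_Im bipoly_const)
  next
    case (const c) then show ?case by (rule bipoly_const)
  next
    case (add f g) then show ?case using bipoly.add by simp
  next
    case (mult f g) then show ?case using bipoly_mult by simp
  qed
  have "real_polynomial_function (\<lambda>z. Re (g z))" "real_polynomial_function (\<lambda>z. Im (g z))"
    using assms bounded_linear_Re bounded_linear_Im by (auto simp: polynomial_function_def comp_def)
  from r[OF this(1)] r[OF this(2)] have "bipoly (\<lambda>z. of_real (Re (g z)) + \<i> * of_real (Im (g z)))"
    by (intro bipoly.add bipoly_mult bipoly_const)
  then show ?thesis by (simp add: complex_eq[symmetric])
qed

text \<open>\<open>g1\<close> and \<open>g2\<close> are the first and second derivatives of \<open>g\<close> with respect to \<open>cnj z\<close>.\<close>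

definition smooth2 :: "(complex \<Rightarrow> complex) \<Rightarrow> (complex \<Rightarrow> complex) \<Rightarrow> (complex \<Rightarrow> complex) \<Rightarrow> bool" where
  "smooth2 g g1 g2 \<longleftrightarrow> (\<exists>p. wirt UNIV g p g1) \<and> (\<exists>p. wirt UNIV g1 p g2)"

lemma smooth2_add: "smooth2 f f1 f2 \<Longrightarrow> smooth2 g g1 g2 \<Longrightarrow> smooth2 (\<lambda>z. f z + g z) (\<lambda>z. f1 z + g1 z) (\<lambda>z. f2 z + g2 z)"
  unfolding smooth2_def using wirt_add by meson

lemma smooth2_cmult: "smooth2 f f1 f2 \<Longrightarrow> smooth2 (\<lambda>z. c * f z) (\<lambda>z. c * f1 z) (\<lambda>z. c * f2 z)"
  unfolding smooth2_def using wirt_cmult by meson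

lemma wirt_monom: "\<exists>p. wirt UNIV (\<lambda>z. z ^ j * cnj z ^ k) p (\<lambda>z. of_nat k * (z ^ j * cnj z ^ (k - 1)))"
proof -
  have h: "wirt UNIV (\<lambda>z. z ^ n) (\<lambda>z. of_nat n * z ^ (n - 1)) (\<lambda>z. 0)" for n
    by (rule wirt_holomorphic) (auto intro!: derivative_eq_intros continuous_intros)
  have "wirt UNIV (\<lambda>z. cnj (z ^ k)) (\<lambda>z. cnj 0) (\<lambda>z. cnj (of_nat k * z ^ (k - 1)))" by (rule wirt_cnj[OF h])
  from wirt_mult[OF h[of j] this] show ?thesis
    by (intro exI) (simp add: mult_ac)
qed

lemma smooth2_monom:
  "smooth2 (\<lambda>z. z ^ j * cnj z ^ k) (\<lambda>z. of_nat k * (z ^ j * cnj z ^ (k - 1)))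
     (\<lambda>z. of_nat k * (of_nat (k - 1) * (z ^ j * cnj z ^ (k - 1 - 1))))"
  unfolding smooth2_def using wirt_monom wirt_cmult by meson

section \<open>The quadratic polynomial of the conic in z and its conjugate\<close>

context
  fixes b0 l1 l0 m2 m1 m0 :: complex
  assumes b0: "b0 \<noteq> 0"
begin

text \<open>Written as a quadratic in \<open>cnj z\<close> whose coefficients are polynomials in
  \<open>z\<close>: a constant, a linear and a quadratic one. That the leading one is a nonzero
  constant is what permits division by it.\<close>

definition Quad :: "complex \<Rightarrow> complex" where
  "Quad z = b0 * (cnj z)\<^sup>2 + (l1 * z + l0) * cnj z + (m2 * z\<^sup>2 + m1 * z + m0)"

definition Quad_z :: "complex \<Rightarrow> complex" where
  "Quad_z z = l1 * cnj z + 2 * m2 * z + m1"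

definition Quad_zbar :: "complex \<Rightarrow> complex" where
  "Quad_zbar z = 2 * b0 * cnj z + (l1 * z + l0)"

lemma Quad_wirt: "wirt UNIV Quad Quad_z Quad_zbar" "wirt UNIV Quad_zbar (\<lambda>z. l1) (\<lambda>z. 2 * b0)"
proof -
  have L: "wirt UNIV (\<lambda>z. l1 * z + l0) (\<lambda>z. l1 * 1 + 0) (\<lambda>z. l1 * 0 + 0)"
    by (intro wirt_add wirt_cmult wirt_id wirt_const)
  have c2: "wirt UNIV (\<lambda>z. b0 * (cnj z * cnj z)) (\<lambda>z. b0 * (0 * cnj z + cnj z * 0)) (\<lambda>z. b0 * (1 * cnj z + cnj z * 1))"
    by (intro wirt_cmult wirt_mult wirt_cnj_id)
  have M: "wirt UNIV (\<lambda>z. m2 * (z * z) + m1 * z + m0) (\<lambda>z. m2 * (1 * z + z * 1) + m1 * 1 + 0) (\<lambda>z. m2 * (0 * z + z * 0) + m1 * 0 + 0)"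
    by (intro wirt_add wirt_cmult wirt_mult wirt_id wirt_const)
  show "wirt UNIV Quad Quad_z Quad_zbar"
    by (rule wirt_cong[OF wirt_add[OF wirt_add[OF c2 wirt_mult[OF L wirt_cnj_id]] M]])
      (auto simp: Quad_def Quad_z_def Quad_zbar_def power2_eq_square algebra_simps)
  show "wirt UNIV Quad_zbar (\<lambda>z. l1) (\<lambda>z. 2 * b0)"
    by (rule wirt_cong[OF wirt_add[OF wirt_cmult[OF wirt_cnj_id, of UNIV "2 * b0"] L]])
      (auto simp: Quad_zbar_def)
qed

lemma bipoly_on_conic:
  assumes "bipoly f"
  shows "\<exists>p0 p1. \<forall>z. Quad z = 0 \<longrightarrow> f z = poly p0 z + cnj z * poly p1 z"
  using assms
proof induction
  case (monom c j k)
  show ?case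
  proof (induction k)
    case 0
    show ?case by (rule exI[of _ "Polynomial.monom c j"], rule exI[of _ 0]) (simp add: poly_monom)
  next
    case (Suc k)
    then obtain p0 p1 where p: "\<And>z. Quad z = 0 \<Longrightarrow> c * (z ^ j * cnj z ^ k) = poly p0 z + cnj z * poly p1 z" by blast
    \<comment> \<open>On the conic \<open>(cnj z)\<^sup>2 = L * cnj z + M\<close>, by division
      through \<open>b0\<close>. One more factor \<open>cnj z\<close> produces a single square to be
      replaced.\<close>
    define L M where "L = smult (- 1 / b0) [:l0, l1:]" and "M = smult (- 1 / b0) [:m0, m1, m2:]"
    have "c * (z ^ j * cnj z ^ Suc k) = poly (M * p1) z + cnj z * poly (p0 + L * p1) z" if Qz: "Quad z = 0" for z
    proof -
      have "b0 * (cnj z)\<^sup>2 = - ((l1 * z + l0) * cnj z + (m2 * z\<^sup>2 + m1 * z + m0))"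
        using Qz unfolding Quad_def by (simp only: add.assoc eq_neg_iff_add_eq_0)
      then have "(cnj z)\<^sup>2 = - ((l1 * z + l0) * cnj z + (m2 * z\<^sup>2 + m1 * z + m0)) / b0"
        using b0 by (simp add: field_simps)
      also have "\<dots> = poly L z * cnj z + poly M z"
        using b0 by (simp add: L_def M_def field_simps power2_eq_square)
      finally have sq: "cnj z * cnj z = poly L z * cnj z + poly M z" by (simp add: power2_eq_square)
      have "c * (z ^ j * cnj z ^ Suc k) = cnj z * (c * (z ^ j * cnj z ^ k))" by (simp add: mult_ac)
      also have "\<dots> = cnj z * poly p0 z + (cnj z * cnj z) * poly p1 z" unfolding p[OF Qz] by (simp add: algebra_simps)
      also have "\<dots> = poly (M * p1) z + cnj z * poly (p0 + L * p1) z" unfolding sq by (simp add: algebra_simps)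
      finally show ?thesis .
    qed
    then show ?case by blast
  qed
next
  case (add f g)
  then obtain p0 p1 r0 r1 where "\<And>z. Quad z = 0 \<Longrightarrow> f z = poly p0 z + cnj z * poly p1 z" "\<And>z. Quad z = 0 \<Longrightarrow> g z = poly r0 z + cnj z * poly r1 z" by blast
  then have "\<forall>z. Quad z = 0 \<longrightarrow> f z + g z = poly (p0 + r0) z + cnj z * poly (p1 + r1) z" by (simp add: algebra_simps)
  then show ?case by blast
qed

text \<open>The right-hand side is the second derivative of \<open>Quad * g\<close> with respect to \<open>cnj z\<close>.\<close>

definition solvable :: "(complex \<Rightarrow> complex) \<Rightarrow> bool" where
  "solvable f \<longleftrightarrow> (\<exists>g g1 g2. smooth2 g g1 g2 \<and> (\<forall>z. f z = Quad z * g2 z + 2 * Quad_zbar z * g1 z + 2 * b0 * g z))"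

lemma solvableI:
  "smooth2 g g1 g2 \<Longrightarrow> (\<And>z. f z = Quad z * g2 z + 2 * Quad_zbar z * g1 z + 2 * b0 * g z) \<Longrightarrow> solvable f"
  unfolding solvable_def by blast

lemma solvable_add:
  assumes "solvable f" "solvable g" shows "solvable (\<lambda>z. f z + g z)"
proof -
  obtain u u1 u2 where u: "smooth2 u u1 u2" "\<And>z. f z = Quad z * u2 z + 2 * Quad_zbar z * u1 z + 2 * b0 * u z"
    using assms(1) solvable_def by blast
  obtain v v1 v2 where v: "smooth2 v v1 v2" "\<And>z. g z = Quad z * v2 z + 2 * Quad_zbar z * v1 z + 2 * b0 * v z"
    using assms(2) solvable_def by blast
  show ?thesis
    by (rule solvableI[OF smooth2_add[OF u(1) v(1)]]) (simp add: u(2) v(2) algebra_simps)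
qed

lemma solvable_cmult:
  assumes "solvable f" shows "solvable (\<lambda>z. c * f z)"
proof -
  obtain u u1 u2 where u: "smooth2 u u1 u2" "\<And>z. f z = Quad z * u2 z + 2 * Quad_zbar z * u1 z + 2 * b0 * u z"
    using assms(1) solvable_def by blast
  show ?thesis
    by (rule solvableI[OF smooth2_cmult[OF u(1)]]) (simp add: u(2) algebra_simps)
qed

text \<open>
  The operator \<open>g \<mapsto> (\<partial>/\<partial>cnj z)\<^sup>2 (Quad * g)\<close> is triangular with respect to the degree in \<open>cnj z\<close>, with
  diagonal entries \<open>b0 (k + 1) (k + 2)\<close>.
\<close>

lemma solvable_monom: "solvable (\<lambda>z. z ^ j * cnj z ^ k)"
proof (induction k arbitrary: j rule: less_induct)
  case (less k)
  define K where "K = (of_nat k :: complex)"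
  have z0: "solvable (\<lambda>z. 0)" using solvable_cmult[of "\<lambda>z. Quad z * 0 + 2 * Quad_zbar z * 0 + 2 * b0 * 1" 0]
    unfolding solvable_def smooth2_def using wirt_const[of UNIV 0] by (intro exI[of _ "\<lambda>_. 0"]) auto
  have lower1: "solvable (\<lambda>z. K * (K + 1) * (l1 * (z ^ (j + 1) * cnj z ^ (k - 1)) + l0 * (z ^ j * cnj z ^ (k - 1))))"
  proof (cases "k = 0")
    case False
    then show ?thesis by (intro solvable_cmult solvable_add less) auto
  qed (use z0 in \<open>simp add: K_def\<close>)
  have lower2: "solvable (\<lambda>z. K * (K - 1) * (m2 * (z ^ (j + 2) * cnj z ^ (k - 2)) + (m1 * (z ^ (j + 1) * cnj z ^ (k - 2)) + m0 * (z ^ j * cnj z ^ (k - 2)))))"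
  proof (cases "k = 0 \<or> k = 1")
    case False
    then show ?thesis by (intro solvable_cmult solvable_add less) auto
  qed (use z0 in \<open>auto simp: K_def\<close>)
  have main: "solvable (\<lambda>z. Quad z * (K * (of_nat (k - 1) * (z ^ j * cnj z ^ (k - 1 - 1)))) + 2 * Quad_zbar z * (K * (z ^ j * cnj z ^ (k - 1))) + 2 * b0 * (z ^ j * cnj z ^ k))"
    unfolding solvable_def K_def using smooth2_monom[of j k] by blast
  \<comment> \<open>The leading coefficient is \<open>b0\<close> times
    \<open>K * (K - 1) + 4 * K + 2 = (K + 1) * (K + 2)\<close>, the next one is
    \<open>K * (K - 1) + 2 * K = K * (K + 1)\<close>. Truncated exponents for \<open>k < 2\<close>
    are harmless because their factors vanish.\<close>
  have eq: "Quad z * (K * (of_nat (k - 1) * (z ^ j * cnj z ^ (k - 1 - 1)))) + 2 * Quad_zbar z * (K * (z ^ j * cnj z ^ (k - 1))) + 2 * b0 * (z ^ j * cnj z ^ k)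
     = b0 * (K + 1) * (K + 2) * (z ^ j * cnj z ^ k)
       + K * (K + 1) * (l1 * (z ^ (j + 1) * cnj z ^ (k - 1)) + l0 * (z ^ j * cnj z ^ (k - 1)))
       + K * (K - 1) * (m2 * (z ^ (j + 2) * cnj z ^ (k - 2)) + (m1 * (z ^ (j + 1) * cnj z ^ (k - 2)) + m0 * (z ^ j * cnj z ^ (k - 2))))" for z
  proof -
    consider "k = 0" | "k = 1" | n where "k = Suc (Suc n)" by (metis One_nat_def not0_implies_Suc)
    then show ?thesis
    proof cases
      case 3
      define N where "N = (of_nat n :: complex)"
      have K: "K = N + 2" "of_nat (k - 1) = N + 1" using 3 by (simp_all add: K_def N_def)
      define x where "x = z ^ j" define y where "y = cnj z ^ n"
      show ?thesis unfolding K Quad_def Quad_zbar_def using 3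
        by (simp add: x_def[symmetric] y_def[symmetric] power_add) (simp add: algebra_simps power2_eq_square)
    qed (simp_all add: K_def Quad_def Quad_zbar_def algebra_simps power2_eq_square)
  qed
  have K0: "(K + 1) * (K + 2) \<noteq> 0"
  proof -
    have "K + 1 = of_nat (k + 1)" "K + 2 = of_nat (k + 2)" by (simp_all add: K_def)
    then show ?thesis by (metis mult_eq_0_iff of_nat_eq_0_iff add_is_0 one_neq_zero zero_neq_numeral)
  qed
  have "solvable (\<lambda>z. (1 / (b0 * ((K + 1) * (K + 2)))) * ((Quad z * (K * (of_nat (k - 1) * (z ^ j * cnj z ^ (k - 1 - 1)))) + 2 * Quad_zbar z * (K * (z ^ j * cnj z ^ (k - 1))) + 2 * b0 * (z ^ j * cnj z ^ k))
     + ((-1) * (K * (K + 1) * (l1 * (z ^ (j + 1) * cnj z ^ (k - 1)) + l0 * (z ^ j * cnj z ^ (k - 1))))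
     + (-1) * (K * (K - 1) * (m2 * (z ^ (j + 2) * cnj z ^ (k - 2)) + (m1 * (z ^ (j + 1) * cnj z ^ (k - 2)) + m0 * (z ^ j * cnj z ^ (k - 2))))))))"
    by (intro solvable_cmult solvable_add main lower1 lower2)
  note sol = this
  have alg: "(1 / (b0 * C)) * ((b0 * C * x + s + t) + ((-1) * s + (-1) * t)) = x" if "C \<noteq> 0" for C x s t :: complex
    using that b0 by simp
  from sol show ?case unfolding eq mult.assoc[of b0 "K + 1"] alg[OF K0] .
qed

lemma bipoly_solvable: "bipoly f \<Longrightarrow> solvable f"
  by (induction rule: bipoly.induct) (rule solvable_cmult[OF solvable_monom], rule solvable_add)

lemma compact_support_integral_z:
  assumes F: "wirt UNIV F p q" and z: "\<And>z. z \<notin> cball 0 R \<Longrightarrow> F z = 0"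
  shows "(\<integral>z. p z \<partial>lborel) = 0"
proof -
  have z': "p z = 0" "q z = 0" if "z \<notin> cball 0 R" for z
    using wirt_zero_outside[OF F closed_cball z that] by auto
  have ip: "integrable lborel p" by (rule compact_support_integrable[OF wirt_cont(2)[OF F] z'(1)])
  have iq: "integrable lborel q" by (rule compact_support_integrable[OF wirt_cont(3)[OF F] z'(2)])
  have "(\<integral>z. p z * 1 + q z * cnj 1 \<partial>lborel) = 0" "(\<integral>z. p z * \<i> + q z * cnj \<i> \<partial>lborel) = 0"
    by (rule integral_derivative_compact_support[OF F z]; assumption)+
  then have 1: "(\<integral>z. p z \<partial>lborel) + (\<integral>z. q z \<partial>lborel) = 0" and 2: "(\<integral>z. p z \<partial>lborel) - (\<integral>z. q z \<partial>lborel) = 0"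
    using ip iq by (simp_all flip: left_diff_distrib)
  from 2 have "(\<integral>z. q z \<partial>lborel) = (\<integral>z. p z \<partial>lborel)" by simp
  with 1 show ?thesis by simp
qed

text \<open>
  The test functions are \<open>g * smooth_ramp (N s) / N\<close> with \<open>s = - Qr\<close>, which tend to \<open>- Quad * g\<close>. Their second
  derivative contains a term \<open>N * hat (N s)\<close> concentrated near the boundary, where \<open>u\<close> is small. Its total
  mass stays bounded, because integrating the derivative of \<open>smooth_step (N s) * Quad_zbar\<close> gives \<open>0\<close>.
\<close>

lemma bianalytic_orthogonal:
  fixes Qr :: "complex \<Rightarrow> real" and u :: "complex \<Rightarrow> complex"
  defines "D \<equiv> {z. Qr z < 0}"
  assumes Qr: "\<And>z. Quad z = of_real (Qr z)" and bD: "bounded D"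
    and uc: "continuous_on (closure D) u" and u0: "\<And>z. z \<in> closure D \<Longrightarrow> Qr z = 0 \<Longrightarrow> u z = 0"
    and H: "\<And>\<phi> p \<phi>1 p1 \<phi>2 K. wirt UNIV \<phi> p \<phi>1 \<Longrightarrow> wirt UNIV \<phi>1 p1 \<phi>2 \<Longrightarrow> compact K \<Longrightarrow> K \<subseteq> D \<Longrightarrow>
      (\<And>z. z \<notin> K \<Longrightarrow> \<phi> z = 0) \<Longrightarrow> (LINT z:D|lebesgue. u z * \<phi>2 z) = 0"
    and f: "bipoly f"
  shows "(\<integral>z. (indicator D z *\<^sub>R u z) * f z \<partial>lborel) = 0" "integrable lborel (\<lambda>z. (indicator D z *\<^sub>R u z) * f z)"
proof -
  have QRC: "wirt UNIV (\<lambda>z. of_real (Qr z)) Quad_z Quad_zbar" using Quad_wirt(1) unfolding Qr[abs_def, symmetric] .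
  have "continuous_on UNIV (\<lambda>z. Re (complex_of_real (Qr z)))" by (intro continuous_intros wirt_cont(1)[OF QRC])
  then have Qc: "continuous_on UNIV Qr" by simp
  have oD: "open D" unfolding D_def by (intro open_Collect_less Qc continuous_intros)
  have cD: "compact (closure D)" using bD by (simp add: compact_closure)
  obtain R where R: "D \<subseteq> cball 0 R" using bD by (auto simp: bounded_iff subset_iff)
  define U where "U z = indicator D z *\<^sub>R u z" for z
  have Um[measurable]: "U \<in> borel_measurable borel"
  proof -
    have "(\<lambda>z. indicator D z *\<^sub>R u z) \<in> borel_measurable borel"
      by (rule borel_measurable_continuous_on_indicator) (use oD continuous_on_subset[OF uc closure_subset] in auto)
    then show ?thesis by (simp add: U_def[abs_def])
  qed
  obtain M where M: "M \<ge> 0" "\<And>z. norm (U z) \<le> M"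
  proof -
    have "compact (u ` closure D)" by (rule compact_continuous_image[OF uc cD])
    then obtain M where "\<And>z. z \<in> closure D \<Longrightarrow> norm (u z) \<le> M" by (metis compact_imp_bounded bounded_iff image_eqI)
    then have "norm (U z) \<le> max 0 M" for z using closure_subset[of D] by (auto simp: U_def indicator_def le_max_iff_disj)
    then show ?thesis by (intro that[of "max 0 M"]) auto
  qed
  have U0: "U z = 0" if "z \<notin> D" for z using that by (simp add: U_def)
  have bnd: "\<exists>C\<ge>0. \<forall>z\<in>D. norm (h z) \<le> C" if hc: "continuous_on UNIV h" for h :: "complex \<Rightarrow> complex"
  proof -
    have "compact (h ` cball 0 R)" by (intro compact_continuous_image compact_cball continuous_on_subset[OF hc]) auto
    then obtain C where "\<And>z. z \<in> cball 0 R \<Longrightarrow> norm (h z) \<le> C" by (metis compact_imp_bounded bounded_iff image_eqI)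
    then show ?thesis using R by (intro exI[of _ "max 0 C"]) (auto simp: le_max_iff_disj)
  qed
  have iD: "integrable lborel (indicat_real D)"
  proof (rule integrable_real_indicator)
    have "emeasure lborel D \<le> emeasure lborel (cball (0::complex) R)" by (rule emeasure_mono[OF R]) simp
    also have "\<dots> < \<infinity>" by (rule emeasure_lborel_cball_finite)
    finally show "emeasure lborel D < \<infinity>" .
  qed (use oD in simp)
  have UI: "integrable lborel (\<lambda>z. U z * h z)" if hc: "continuous_on UNIV h" for h
  proof -
    obtain C where C: "C \<ge> 0" "\<And>z. z \<in> D \<Longrightarrow> norm (h z) \<le> C" using bnd[OF hc] by blast
    have hm[measurable]: "h \<in> borel_measurable borel" using hc by (rule borel_measurable_continuous_onI)
    show ?thesis
    proof (rule Bochner_Integration.integrable_bound[where f="\<lambda>z. (M * C) * indicat_real D z"])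
      show "integrable lborel (\<lambda>z. (M * C) * indicat_real D z)" using iD by simp
      show "AE z in lborel. norm (U z * h z) \<le> norm ((M * C) * indicat_real D z)"
      proof (rule AE_I2)
        fix z show "norm (U z * h z) \<le> norm ((M * C) * indicat_real D z)"
        proof (cases "z \<in> D")
          case True
          have "norm (U z) * norm (h z) \<le> M * C" by (intro mult_mono M C True norm_ge_zero)
          then show ?thesis using True M C by (simp add: norm_mult)
        qed (simp add: U0)
      qed
    qed measurable
  qed
  have UL: "(LINT z:D|lebesgue. u z * h z) = (\<integral>z. U z * h z \<partial>lborel)" if hc: "continuous_on UNIV h" for h
  proof -
    have m: "(\<lambda>z. U z * h z) \<in> borel_measurable lborel" using UI[OF hc] by auto
    have "(LINT z:D|lebesgue. u z * h z) = integral\<^sup>L lebesgue (\<lambda>z. U z * h z)"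
      unfolding set_lebesgue_integral_def U_def by simp
    also have "\<dots> = (\<integral>z. U z * h z \<partial>lborel)" by (rule integral_completion[OF m])
    finally show ?thesis .
  qed
  obtain g g1 g2 where sm: "smooth2 g g1 g2" and fe: "\<And>z. f z = Quad z * g2 z + 2 * Quad_zbar z * g1 z + 2 * b0 * g z"
    using bipoly_solvable[OF f] unfolding solvable_def by blast
  obtain gp g1p where gw: "wirt UNIV g gp g1" and g1w: "wirt UNIV g1 g1p g2" using sm by (auto simp: smooth2_def)
  note gc = wirt_cont(1)[OF gw] wirt_cont(1)[OF g1w] wirt_cont(3)[OF g1w]
  note Quc = wirt_cont(1)[OF Quad_wirt(1)] wirt_cont(3)[OF Quad_wirt(1)]
  have fc: "continuous_on UNIV f" unfolding fe[abs_def] by (intro continuous_intros gc Quc)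
  define s where "s z = - Qr z" for z
  have sw: "wirt UNIV (\<lambda>z. of_real (s z)) (\<lambda>z. - Quad_z z) (\<lambda>z. - Quad_zbar z)"
    using wirt_cmult[OF QRC, of "-1"] by (simp add: s_def)
  have sc: "continuous_on UNIV s" unfolding s_def[abs_def] by (intro continuous_intros Qc)
  have sD: "z \<in> D \<longleftrightarrow> s z > 0" for z by (simp add: D_def s_def)
  \<comment> \<open>\<open>Quad\<close> is real-valued, so its two Wirtinger derivatives are
    conjugate. This makes \<open>Quad_z * Quad_zbar\<close> the nonnegative function
    \<open>(norm (Quad_zbar z))\<^sup>2\<close>, on which the mass bound rests.\<close>
  have QzQ: "Quad_z z = cnj (Quad_zbar z)" for z
  proof -
    have "wirt UNIV (\<lambda>z. cnj (of_real (Qr z))) (\<lambda>z. cnj (Quad_zbar z)) (\<lambda>z. cnj (Quad_z z))" by (rule wirt_cnj[OF QRC])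
    then have "wirt UNIV (\<lambda>z. of_real (Qr z)) (\<lambda>z. cnj (Quad_zbar z)) (\<lambda>z. cnj (Quad_z z))" by simp
    show ?thesis by (rule conjunct1[OF wirt_unique[OF QRC \<open>wirt UNIV (\<lambda>z. of_real (Qr z)) (\<lambda>z. cnj (Quad_zbar z)) _\<close> UNIV_I]])
  qed
  define N where "N n = real (Suc n)" for n
  have N0: "N n > 0" for n by (simp add: N_def)
  define Rn where "Rn n z = complex_of_real (smooth_ramp (N n * s z) / N n)" for n z
  define Sn where "Sn n z = complex_of_real (smooth_step (N n * s z))" for n z
  define Hn where "Hn n z = complex_of_real (N n * hat (N n * s z))" for n z
  have dN: "((\<lambda>t. N n * t) has_real_derivative N n) (at t)" for n t by (auto intro!: derivative_eq_intros)
  have Rw: "wirt UNIV (Rn n) (\<lambda>z. Sn n z * - Quad_z z) (\<lambda>z. Sn n z * - Quad_zbar z)" for n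
    unfolding Rn_def[abs_def] Sn_def
  proof (rule wirt_real_compose[OF sw])
    show "((\<lambda>t. smooth_ramp (N n * t) / N n) has_real_derivative smooth_step (N n * t)) (at t)" for t
      using DERIV_cdivide[OF DERIV_chain2[OF smooth_ramp_DERIV dN], of n "N n" t] N0[of n] by simp
    show "continuous_on UNIV (\<lambda>t. smooth_step (N n * t))"
      by (intro continuous_on_compose2[OF smooth_step_cont[of UNIV]] continuous_intros) auto
  qed
  have Sw: "wirt UNIV (Sn n) (\<lambda>z. Hn n z * - Quad_z z) (\<lambda>z. Hn n z * - Quad_zbar z)" for n
    unfolding Sn_def[abs_def] Hn_def
  proof (rule wirt_real_compose[OF sw])
    show "((\<lambda>t. smooth_step (N n * t)) has_real_derivative N n * hat (N n * t)) (at t)" for t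
      using DERIV_chain2[OF smooth_step_DERIV dN, of n t] by (simp add: mult.commute)
    show "continuous_on UNIV (\<lambda>t. N n * hat (N n * t))"
      by (intro continuous_intros continuous_on_compose2[OF hat_cont[of UNIV]]) auto
  qed
  \<comment> \<open>The threshold \<open>1 / N n\<close> is where
    \<open>smooth_ramp (N n * s z)\<close> starts to grow, so that the approximations of
    \<open>- Quad * g\<close> are supported in a compact subset of \<open>D\<close>.\<close>
  define Kn where "Kn n = {z. s z \<ge> 1 / N n}" for n
  have KD: "Kn n \<subseteq> D" for n
  proof
    fix z assume "z \<in> Kn n"
    then have "s z \<ge> 1 / N n" by (simp add: Kn_def)
    moreover have "1 / N n > 0" using N0 by simp
    ultimately show "z \<in> D" unfolding sD by linarith
  qed
  have cK: "compact (Kn n)" for n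
    unfolding compact_eq_bounded_closed
  proof
    show "bounded (Kn n)" using bounded_subset[OF bD KD] .
    show "closed (Kn n)" unfolding Kn_def by (intro closed_Collect_le continuous_intros sc)
  qed
  have Ns: "N n * s z \<le> 1" if "z \<notin> Kn n" for n z
  proof -
    have "s z < 1 / N n" using that by (simp add: Kn_def)
    then show ?thesis using N0[of n] by (simp add: field_simps)
  qed
  have out: "Rn n z = 0" "Sn n z = 0" "Hn n z = 0" if "z \<notin> Kn n" for n z
    using Ns[OF that] by (simp_all add: Rn_def Sn_def Hn_def smooth_ramp_zero smooth_step_zero hat_zero)
  have Sle: "norm (Sn n z) \<le> indicat_real D z" for n z
  proof (cases "z \<in> D")
    case True then show ?thesis using smooth_step_range[of "N n * s z"] by (simp add: Sn_def)
  next
    case False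
    then have "z \<notin> Kn n" using KD by blast
    then show ?thesis using out by simp
  qed
  have Rle: "norm (Rn n z) \<le> norm (Quad z)" if "z \<in> D" for n z
  proof -
    have s: "s z > 0" using that sD by simp
    then have "0 \<le> N n * s z" using N0[of n] by simp
    from smooth_ramp_range[OF this] have "smooth_ramp (N n * s z) / N n \<le> s z" "0 \<le> smooth_ramp (N n * s z) / N n"
      using N0[of n] by (auto simp: field_simps)
    then show ?thesis unfolding Rn_def Qr norm_of_real s_def by linarith
  qed
  \<comment> \<open>The second derivative of \<open>Rn n * g\<close> is split into \<open>E\<close>,
    the term with \<open>hat\<close> that concentrates at the boundary, and \<open>F\<close>, which
    on \<open>D\<close> stays dominated and tends to \<open>- f\<close>.\<close>
  define E where "E n z = Hn n z * (Quad_zbar z * Quad_zbar z * g z)" for n z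
  define F where "F n z = Sn n z * (- (2 * b0 * g z + 2 * Quad_zbar z * g1 z)) + Rn n z * g2 z" for n z
  have Snc: "continuous_on UNIV (Sn n)" and Rnc: "continuous_on UNIV (Rn n)" for n
    using wirt_cont(1)[OF Sw] wirt_cont(1)[OF Rw] by auto
  have Hnc: "continuous_on UNIV (Hn n)" for n unfolding Hn_def[abs_def]
    by (intro continuous_intros continuous_on_compose2[OF hat_cont[of UNIV]] sc) auto
  have Ec: "continuous_on UNIV (E n)" for n unfolding E_def[abs_def] by (intro continuous_intros Hnc Quc gc)
  have Fc: "continuous_on UNIV (F n)" for n unfolding F_def[abs_def] by (intro continuous_intros Snc Rnc Quc gc)
  have sum0: "(\<integral>z. U z * E n z \<partial>lborel) + (\<integral>z. U z * F n z \<partial>lborel) = 0" for n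
  proof -
    have W1: "wirt UNIV (\<lambda>z. Rn n z * g z) (\<lambda>z. Sn n z * - Quad_z z * g z + Rn n z * gp z) (\<lambda>z. Sn n z * - Quad_zbar z * g z + Rn n z * g1 z)"
      by (rule wirt_mult[OF Rw gw])
    have mQ: "wirt UNIV (\<lambda>z. - Quad_zbar z) (\<lambda>z. - l1) (\<lambda>z. - (2 * b0))"
      using wirt_cmult[OF Quad_wirt(2), of "-1"] by simp
    have W2: "wirt UNIV (\<lambda>z. Sn n z * - Quad_zbar z * g z + Rn n z * g1 z)
       (\<lambda>z. (Hn n z * - Quad_z z * - Quad_zbar z + Sn n z * - l1) * g z + Sn n z * - Quad_zbar z * gp z + (Sn n z * - Quad_z z * g1 z + Rn n z * g1p z))
       (\<lambda>z. (Hn n z * - Quad_zbar z * - Quad_zbar z + Sn n z * - (2 * b0)) * g z + Sn n z * - Quad_zbar z * g1 z + (Sn n z * - Quad_zbar z * g1 z + Rn n z * g2 z))"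
      by (rule wirt_add[OF wirt_mult[OF wirt_mult[OF Sw mQ] gw] wirt_mult[OF Rw g1w]])
    have "(LINT z:D|lebesgue. u z * ((Hn n z * - Quad_zbar z * - Quad_zbar z + Sn n z * - (2 * b0)) * g z + Sn n z * - Quad_zbar z * g1 z + (Sn n z * - Quad_zbar z * g1 z + Rn n z * g2 z))) = 0"
      by (rule H[OF W1 W2 cK[of n] KD[of n]]) (simp add: out)
    moreover have "(Hn n z * - Quad_zbar z * - Quad_zbar z + Sn n z * - (2 * b0)) * g z + Sn n z * - Quad_zbar z * g1 z + (Sn n z * - Quad_zbar z * g1 z + Rn n z * g2 z) = E n z + F n z" for z
      by (simp add: E_def F_def algebra_simps)
    ultimately have "(LINT z:D|lebesgue. u z * (E n z + F n z)) = 0" by simp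
    then have "(\<integral>z. U z * (E n z + F n z) \<partial>lborel) = 0"
      by (subst (asm) UL) (intro continuous_intros Ec Fc)
    then show ?thesis using UI[OF Ec] UI[OF Fc] by (simp add: distrib_left)
  qed
  have Flim: "(\<lambda>n. \<integral>z. U z * F n z \<partial>lborel) \<longlonglongrightarrow> (\<integral>z. U z * (- f z) \<partial>lborel)"
  proof (rule integral_dominated_convergence[where w="\<lambda>z. norm (U z * (2 * b0 * g z + 2 * Quad_zbar z * g1 z)) + norm (U z * (Quad z * g2 z))"])
    show "(\<lambda>z. U z * - f z) \<in> borel_measurable lborel" using borel_measurable_integrable[OF UI[OF continuous_on_minus[OF fc]]] .
    show "(\<lambda>z. U z * F n z) \<in> borel_measurable lborel" for n using UI[OF Fc] by auto
    show "integrable lborel (\<lambda>z. norm (U z * (2 * b0 * g z + 2 * Quad_zbar z * g1 z)) + norm (U z * (Quad z * g2 z)))"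
      by (intro Bochner_Integration.integrable_add integrable_norm UI continuous_intros Quc gc)
    show "AE z in lborel. norm (U z * F n z) \<le> norm (U z * (2 * b0 * g z + 2 * Quad_zbar z * g1 z)) + norm (U z * (Quad z * g2 z))" for n
    proof (rule AE_I2)
      fix z
      show "norm (U z * F n z) \<le> norm (U z * (2 * b0 * g z + 2 * Quad_zbar z * g1 z)) + norm (U z * (Quad z * g2 z))"
      proof (cases "z \<in> D")
        case True
        have "norm (F n z) \<le> norm (Sn n z) * norm (2 * b0 * g z + 2 * Quad_zbar z * g1 z) + norm (Rn n z) * norm (g2 z)"
          unfolding F_def by (rule order_trans[OF norm_triangle_ineq]) (simp only: norm_mult norm_minus_cancel)
        also have "\<dots> \<le> 1 * norm (2 * b0 * g z + 2 * Quad_zbar z * g1 z) + norm (Quad z) * norm (g2 z)"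
          by (intro add_mono mult_right_mono Rle[OF True]) (use Sle[of n z] True in auto)
        finally have "norm (U z) * norm (F n z) \<le> norm (U z) * (norm (2 * b0 * g z + 2 * Quad_zbar z * g1 z) + norm (Quad z) * norm (g2 z))"
          by (intro mult_left_mono) auto
        then show ?thesis by (simp only: norm_mult distrib_left[of "norm (U z)"])
      qed (simp add: U0)
    qed
    show "AE z in lborel. (\<lambda>n. U z * F n z) \<longlonglongrightarrow> U z * - f z"
    proof (rule AE_I2)
      fix z
      show "(\<lambda>n. U z * F n z) \<longlonglongrightarrow> U z * - f z"
      proof (cases "z \<in> D")
        case True
        then have s: "s z > 0" using sD by simp
        \<comment> \<open>From \<open>3\<close> on, \<open>smooth_step\<close> equals
          \<open>1\<close> and \<open>smooth_ramp\<close> equals its argument minus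
          \<open>2\<close>; after division by \<open>N n\<close> this offset tends to
          \<open>0\<close>.\<close>
        obtain n0 where n0: "3 / s z \<le> real n0" using real_arch_simple by blast
        have big: "N n * s z \<ge> 3" if "n \<ge> n0" for n
        proof -
          have "N n \<ge> 3 / s z" using n0 that by (simp add: N_def)
          then show ?thesis using s by (simp add: field_simps)
        qed
        have "(\<lambda>n. of_real 1 * (- (2 * b0 * g z + 2 * Quad_zbar z * g1 z)) + of_real (s z - 2 * (1 / N n)) * g2 z) \<longlonglongrightarrow>
            of_real 1 * (- (2 * b0 * g z + 2 * Quad_zbar z * g1 z)) + of_real (s z - 2 * 0) * g2 z"
          unfolding N_def using LIMSEQ_Suc[OF lim_1_over_n[where 'a=real]] by (intro tendsto_intros) simp
        moreover have "\<forall>\<^sub>F n in sequentially. of_real 1 * (- (2 * b0 * g z + 2 * Quad_zbar z * g1 z)) + of_real (s z - 2 * (1 / N n)) * g2 z = F n z"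
        proof (rule eventually_sequentiallyI[of n0])
          fix n assume "n0 \<le> n"
          from big[OF this] have "Sn n z = of_real 1" "Rn n z = of_real (s z - 2 * (1 / N n))"
            using N0[of n] by (simp_all only: Sn_def Rn_def smooth_step_one smooth_ramp_large) (simp add: field_simps)
          then show "of_real 1 * (- (2 * b0 * g z + 2 * Quad_zbar z * g1 z)) + of_real (s z - 2 * (1 / N n)) * g2 z = F n z"
            unfolding F_def by simp
        qed
        ultimately have "(\<lambda>n. F n z) \<longlonglongrightarrow> of_real 1 * (- (2 * b0 * g z + 2 * Quad_zbar z * g1 z)) + of_real (s z - 2 * 0) * g2 z"
          by (rule Lim_transform_eventually)
        also have "of_real 1 * (- (2 * b0 * g z + 2 * Quad_zbar z * g1 z)) + of_real (s z - 2 * 0) * g2 z = - f z"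
          unfolding fe Qr s_def by (simp add: algebra_simps)
        finally show ?thesis by (intro tendsto_intros)
      qed (simp add: U0)
    qed
  qed
  define J where "J n = (\<integral>z. N n * hat (N n * s z) * (norm (Quad_zbar z))\<^sup>2 \<partial>lborel)" for n
  have iJ: "integrable lborel (\<lambda>z. N n * hat (N n * s z) * (norm (Quad_zbar z))\<^sup>2)" for n
  proof -
    have "integrable lborel (\<lambda>z. Hn n z * of_real ((norm (Quad_zbar z))\<^sup>2))"
    proof (rule compact_support_integrable[where R=R])
      show "continuous_on UNIV (\<lambda>z. Hn n z * of_real ((norm (Quad_zbar z))\<^sup>2))" by (intro continuous_intros Hnc Quc)
      fix z :: complex assume "z \<notin> cball 0 R"
      then have "z \<notin> Kn n" using R KD by blast
      then show "Hn n z * of_real ((norm (Quad_zbar z))\<^sup>2) = 0" using out by simp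
    qed
    from integrable_Re[OF this] show ?thesis by (simp add: Hn_def)
  qed
  have Jle: "J n \<le> norm l1 * measure lborel D" for n
  proof -
    \<comment> \<open>The derivative used here is the one with respect to \<open>z\<close>: it
      produces \<open>- Hn n\<close> times \<open>(norm (Quad_zbar z))\<^sup>2\<close>, and
      \<open>Quad_zbar\<close> contributes only the constant \<open>l1\<close>. Thus
      \<open>J n\<close> equals \<open>l1\<close> times the integral of \<open>Sn n\<close>, whose
      norm is at most the indicator of \<open>D\<close>.\<close>
    have W: "wirt UNIV (\<lambda>z. Sn n z * Quad_zbar z) (\<lambda>z. Hn n z * - Quad_z z * Quad_zbar z + Sn n z * l1) (\<lambda>z. Hn n z * - Quad_zbar z * Quad_zbar z + Sn n z * (2 * b0))"
      by (rule wirt_mult[OF Sw Quad_wirt(2)])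
    have "(\<integral>z. Hn n z * - Quad_z z * Quad_zbar z + Sn n z * l1 \<partial>lborel) = 0"
    proof (rule compact_support_integral_z[OF W, of R])
      fix z :: complex assume "z \<notin> cball 0 R"
      then have "z \<notin> Kn n" using R KD by blast
      then show "Sn n z * Quad_zbar z = 0" using out by simp
    qed
    moreover have "Hn n z * - Quad_z z * Quad_zbar z + Sn n z * l1 = - of_real (N n * hat (N n * s z) * (norm (Quad_zbar z))\<^sup>2) + Sn n z * l1" for z
    proof -
      have "Quad_z z * Quad_zbar z = of_real ((norm (Quad_zbar z))\<^sup>2)"
        unfolding QzQ using complex_norm_square[of "Quad_zbar z"] by (simp add: mult.commute)
      then show ?thesis by (simp add: Hn_def mult.assoc)
    qed
    ultimately have z0: "(\<integral>z. - complex_of_real (N n * hat (N n * s z) * (norm (Quad_zbar z))\<^sup>2) + Sn n z * l1 \<partial>lborel) = 0" by simp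
    have iS: "integrable lborel (Sn n)"
    proof (rule compact_support_integrable[OF Snc, of R])
      fix z :: complex assume "z \<notin> cball 0 R"
      then have "z \<notin> Kn n" using R KD by blast
      then show "Sn n z = 0" using out by simp
    qed
    have iJc: "integrable lborel (\<lambda>z. complex_of_real (N n * hat (N n * s z) * (norm (Quad_zbar z))\<^sup>2))" by (rule integrable_of_real[OF iJ])
    have "(\<integral>z. - complex_of_real (N n * hat (N n * s z) * (norm (Quad_zbar z))\<^sup>2) + Sn n z * l1 \<partial>lborel)
      = - (\<integral>z. complex_of_real (N n * hat (N n * s z) * (norm (Quad_zbar z))\<^sup>2) \<partial>lborel) + (\<integral>z. Sn n z \<partial>lborel) * l1"
      by (subst Bochner_Integration.integral_add) (use iJc iS in auto)
    with z0 have "(\<integral>z. complex_of_real (N n * hat (N n * s z) * (norm (Quad_zbar z))\<^sup>2) \<partial>lborel) = (\<integral>z. Sn n z \<partial>lborel) * l1"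
      by (simp add: add_eq_0_iff2)
    then have "complex_of_real (J n) = (\<integral>z. Sn n z \<partial>lborel) * l1"
      unfolding J_def by (simp only: integral_complex_of_real)
    then have "norm (complex_of_real (J n)) = norm (\<integral>z. Sn n z \<partial>lborel) * norm l1" by (simp only: norm_mult)
    moreover have "norm (\<integral>z. Sn n z \<partial>lborel) \<le> (\<integral>z. indicat_real D z \<partial>lborel)"
      by (rule Bochner_Integration.integral_norm_bound_integral[OF iS iD Sle])
    moreover have "(\<integral>z. indicat_real D z \<partial>lborel) = measure lborel D" by simp
    ultimately have "norm (complex_of_real (J n)) \<le> measure lborel D * norm l1" by (simp add: mult_right_mono)
    then show ?thesis by (simp add: mult.commute)
  qed
  \<comment> \<open>Otherwise there would be points of \<open>D\<close> with
    \<open>norm (u z) > \<eta>\<close> and \<open>s z\<close> tending to \<open>0\<close>; by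
    compactness of the closure they accumulate at a point where \<open>s\<close> and hence
    \<open>u\<close> vanishes, against continuity.\<close>
  have small: "\<exists>n0. \<forall>n\<ge>n0. \<forall>z\<in>D. s z < 3 / N n \<longrightarrow> norm (u z) \<le> \<eta>" if eta: "\<eta> > 0" for \<eta>
  proof (rule ccontr)
    assume "\<not> ?thesis"
    then have "\<forall>n0. \<exists>z. z \<in> D \<and> s z < 3 / N n0 \<and> norm (u z) > \<eta>"
    proof (intro allI)
      fix n0
      assume "\<not> (\<exists>n0. \<forall>n\<ge>n0. \<forall>z\<in>D. s z < 3 / N n \<longrightarrow> norm (u z) \<le> \<eta>)"
      then obtain n z where n: "n \<ge> n0" "z \<in> D" "s z < 3 / N n" "\<not> norm (u z) \<le> \<eta>" by blast
      have "3 / N n \<le> 3 / N n0" using n(1) by (intro divide_left_mono) (auto simp: N_def)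
      then show "\<exists>z. z \<in> D \<and> s z < 3 / N n0 \<and> norm (u z) > \<eta>" using n by (intro exI[of _ z]) auto
    qed
    then obtain Z where Z: "\<And>n. Z n \<in> D" "\<And>n. s (Z n) < 3 / N n" "\<And>n. norm (u (Z n)) > \<eta>" by metis
    have ZC: "Z n \<in> closure D" for n using Z(1) closure_subset by blast
    obtain l r where l: "l \<in> closure D" "strict_mono (r :: nat \<Rightarrow> nat)" "(Z \<circ> r) \<longlonglongrightarrow> l"
      using cD ZC unfolding compact_def by metis
    have "(\<lambda>n. s ((Z \<circ> r) n)) \<longlonglongrightarrow> s l"
      using sc by (intro isCont_tendsto_compose[OF _ l(3)]) (simp add: continuous_on_eq_continuous_at)
    moreover have "(\<lambda>n. s ((Z \<circ> r) n)) \<longlonglongrightarrow> 0"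
    proof (rule tendsto_sandwich[OF _ _ tendsto_const])
      show "\<forall>\<^sub>F n in sequentially. 0 \<le> s ((Z \<circ> r) n)" using Z(1) by (auto simp: sD less_imp_le)
      show "\<forall>\<^sub>F n in sequentially. s ((Z \<circ> r) n) \<le> 3 / N n"
      proof (rule always_eventually, rule allI)
        fix n
        have "3 / N (r n) \<le> 3 / N n" using seq_suble[OF l(2), of n] by (intro divide_left_mono) (auto simp: N_def)
        then show "s ((Z \<circ> r) n) \<le> 3 / N n" using Z(2)[of "r n"] by (simp add: order.trans less_imp_le)
      qed
      have "(\<lambda>n. 3 * (1 / N n)) \<longlonglongrightarrow> 3 * 0"
        unfolding N_def using LIMSEQ_Suc[OF lim_1_over_n[where 'a=real]] by (intro tendsto_intros) simp
      then show "(\<lambda>n. 3 / N n) \<longlonglongrightarrow> 0" by simp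
    qed
    ultimately have "s l = 0" by (rule LIMSEQ_unique)
    then have ul: "u l = 0" using u0[OF l(1)] by (simp add: s_def)
    have "(\<lambda>n. u ((Z \<circ> r) n)) \<longlonglongrightarrow> u l"
      by (rule continuous_on_tendsto_compose[OF uc l(3,1)]) (use ZC in auto)
    then have "(\<lambda>n. norm (u ((Z \<circ> r) n))) \<longlonglongrightarrow> 0" using ul tendsto_norm_zero by metis
    then have "\<eta> \<le> 0" by (rule LIMSEQ_le_const) (use Z(3) in \<open>auto simp: less_imp_le\<close>)
    then show False using eta by simp
  qed
  obtain Cg where Cg: "Cg \<ge> 0" "\<And>z. z \<in> D \<Longrightarrow> norm (g z) \<le> Cg" using bnd[OF gc(1)] by blast
  have Elim: "(\<lambda>n. \<integral>z. U z * E n z \<partial>lborel) \<longlonglongrightarrow> 0"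
    unfolding tendsto_iff
  proof (intro allI impI)
    fix e :: real assume e: "e > 0"
    define X where "X = Cg * (norm l1 * measure lborel D) + 1"
    have X: "X > 0" using Cg(1) by (auto simp: X_def intro!: add_nonneg_pos mult_nonneg_nonneg)
    define \<eta> where "\<eta> = e / (2 * X)"
    have eta: "\<eta> > 0" using e X by (simp add: \<eta>_def)
    obtain n0 where n0: "\<And>n z. n \<ge> n0 \<Longrightarrow> z \<in> D \<Longrightarrow> s z < 3 / N n \<Longrightarrow> norm (u z) \<le> \<eta>" using small[OF eta] by blast
    show "\<forall>\<^sub>F n in sequentially. dist (\<integral>z. U z * E n z \<partial>lborel) 0 < e"
    proof (rule eventually_sequentiallyI[of n0])
      fix n assume n: "n0 \<le> n"
      have "norm (U z * E n z) \<le> (\<eta> * Cg) * (N n * hat (N n * s z) * (norm (Quad_zbar z))\<^sup>2)" for z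
      proof (cases "z \<in> D \<and> s z < 3 / N n")
        case True
        then have 1: "norm (U z) \<le> \<eta>" using n0[OF n] by (simp add: U_def)
        have h0: "0 \<le> N n * hat (N n * s z) * (norm (Quad_zbar z))\<^sup>2" using N0[of n] hat_nonneg by (intro mult_nonneg_nonneg) auto
        have "norm (U z * E n z) = (norm (U z) * norm (g z)) * (N n * hat (N n * s z) * (norm (Quad_zbar z))\<^sup>2)"
          unfolding E_def norm_mult Hn_def norm_of_real using N0[of n] hat_nonneg[of "N n * s z"] by (simp add: power2_eq_square)
        also have "\<dots> \<le> (\<eta> * Cg) * (N n * hat (N n * s z) * (norm (Quad_zbar z))\<^sup>2)"
          by (intro mult_right_mono[OF _ h0] mult_mono 1 Cg(2)) (use True eta in auto)
        finally show ?thesis .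
      next
        case False
        have h0: "0 \<le> (\<eta> * Cg) * (N n * hat (N n * s z) * (norm (Quad_zbar z))\<^sup>2)"
          using N0[of n] hat_nonneg eta Cg(1) by (intro mult_nonneg_nonneg) auto
        have "U z * E n z = 0"
        proof (cases "z \<in> D")
          case True
          then have "s z \<ge> 3 / N n" using False by simp
          then have "N n * s z \<ge> 3" using N0[of n] by (simp add: field_simps)
          then show ?thesis by (simp add: E_def Hn_def hat_zero)
        qed (simp add: U0)
        then show ?thesis using h0 by (simp only: norm_zero)
      qed
      then have "norm (\<integral>z. U z * E n z \<partial>lborel) \<le> (\<integral>z. (\<eta> * Cg) * (N n * hat (N n * s z) * (norm (Quad_zbar z))\<^sup>2) \<partial>lborel)"
        by (intro Bochner_Integration.integral_norm_bound_integral UI[OF Ec] integrable_mult_right iJ)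
      also have "\<dots> = (\<eta> * Cg) * J n" unfolding J_def by (rule Bochner_Integration.integral_mult_right_zero)
      also have "\<dots> \<le> (\<eta> * Cg) * (norm l1 * measure lborel D)" using eta Cg(1) by (intro mult_left_mono Jle) auto
      also have "\<dots> \<le> \<eta> * X" using eta by (simp add: X_def algebra_simps)
      also have "\<dots> = e / 2" using X by (simp add: \<eta>_def)
      also have "\<dots> < e" using e by simp
      finally show "dist (\<integral>z. U z * E n z \<partial>lborel) 0 < e" by simp
    qed
  qed
  have "(\<lambda>n. (\<integral>z. U z * E n z \<partial>lborel) + (\<integral>z. U z * F n z \<partial>lborel)) \<longlonglongrightarrow> 0 + (\<integral>z. U z * (- f z) \<partial>lborel)"
    by (rule tendsto_add[OF Elim Flim])
  then have "0 + (\<integral>z. U z * (- f z) \<partial>lborel) = 0" unfolding sum0 by (simp add: LIMSEQ_const_iff)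
  then have "(\<integral>z. U z * f z \<partial>lborel) = 0" by simp
  then show "(\<integral>z. (indicator D z *\<^sub>R u z) * f z \<partial>lborel) = 0" by (simp add: U_def)
  show "integrable lborel (\<lambda>z. (indicator D z *\<^sub>R u z) * f z)" using UI[OF fc] by (simp add: U_def)
qed

end

subsection \<open>Geometry of the conic and the Dirichlet problem\<close>

text \<open>A polynomial uniformly within \<open>e\<close> of \<open>cnj u\<close> on the closure
  bounds the integral of \<open>(norm (u z))\<^sup>2\<close> over \<open>D\<close> by
  \<open>e\<close> times that of \<open>norm (u z)\<close>, for every \<open>e > 0\<close>. So
  \<open>u\<close> vanishes almost everywhere in \<open>D\<close>, and then everywhere, since the
  subset where it does not is open.\<close>

lemma orthogonal_bipoly_zero:
  fixes u :: "complex \<Rightarrow> complex"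
  assumes D: "open D" "bounded D" and uc: "continuous_on (closure D) u"
    and orth: "\<And>f. bipoly f \<Longrightarrow> (\<integral>z. (indicator D z *\<^sub>R u z) * f z \<partial>lborel) = 0"
    and int: "\<And>f. bipoly f \<Longrightarrow> integrable lborel (\<lambda>z. (indicator D z *\<^sub>R u z) * f z)"
    and z: "z \<in> D"
  shows "u z = 0"
proof -
  define U where "U z = indicator D z *\<^sub>R u z" for z
  have cD: "compact (closure D)" using D(2) by (simp add: compact_closure)
  have Ui: "integrable lborel U" using int[OF bipoly_const[of 1]] by (simp add: U_def[abs_def])
  have [measurable]: "U \<in> borel_measurable borel" using Ui by auto
  have [measurable]: "cnj \<in> borel_measurable borel" by (intro borel_measurable_continuous_onI continuous_intros)
  have "compact (u ` closure D)" by (rule compact_continuous_image[OF uc cD])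
  then obtain M where M: "\<And>z. z \<in> closure D \<Longrightarrow> norm (u z) \<le> M" by (metis compact_imp_bounded bounded_iff image_eqI)
  have iUU: "integrable lborel (\<lambda>z. U z * cnj (U z))"
  proof (rule Bochner_Integration.integrable_bound[where f="\<lambda>z. of_real M * U z"])
    show "integrable lborel (\<lambda>z. of_real M * U z)" using Ui by simp
    show "AE z in lborel. norm (U z * cnj (U z)) \<le> norm (of_real M * U z)"
    proof (rule AE_I2)
      fix z show "norm (U z * cnj (U z)) \<le> norm (of_real M * U z)"
      proof (cases "z \<in> D")
        case True
        then have "norm (U z) \<le> \<bar>M\<bar>" using M[of z] closure_subset[of D] by (auto simp: U_def)
        then show ?thesis by (simp add: norm_mult mult_right_mono)
      qed (simp add: U_def)
    qed
  qed measurable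
  have key: "norm (\<integral>z. U z * cnj (U z) \<partial>lborel) \<le> e * (\<integral>z. norm (U z) \<partial>lborel)" if e: "e > 0" for e
  proof -
    have "continuous_on (closure D) (\<lambda>z. cnj (u z))" by (intro continuous_intros uc)
    from Stone_Weierstrass_polynomial_function[OF cD this e]
    obtain g :: "complex \<Rightarrow> complex" where g1: "polynomial_function g" and g2: "\<forall>z\<in>closure D. norm (cnj (u z) - g z) < e"
      by (elim exE conjE)
    note g = g1 g2[rule_format]
    have bg: "bipoly g" by (rule bipoly_polynomial_function[OF g(1)])
    have ig: "integrable lborel (\<lambda>z. U z * g z)" using int[OF bg] by (simp add: U_def)
    have "(\<integral>z. U z * g z \<partial>lborel) = 0" using orth[OF bg] by (simp add: U_def)
    then have "(\<integral>z. U z * cnj (U z) \<partial>lborel) = (\<integral>z. U z * cnj (U z) - U z * g z \<partial>lborel)"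
      using iUU ig by simp
    also have "norm \<dots> \<le> (\<integral>z. e * norm (U z) \<partial>lborel)"
    proof (rule Bochner_Integration.integral_norm_bound_integral)
      show "integrable lborel (\<lambda>z. U z * cnj (U z) - U z * g z)" using iUU ig by simp
      show "integrable lborel (\<lambda>z. e * norm (U z))" using Ui by simp
      show "norm (U z * cnj (U z) - U z * g z) \<le> e * norm (U z)" for z
      proof (cases "z \<in> D")
        case True
        have "norm (U z * cnj (U z) - U z * g z) = norm (U z) * norm (cnj (u z) - g z)"
          using True by (simp add: U_def norm_mult[symmetric] right_diff_distrib)
        also have "\<dots> \<le> norm (U z) * e"
          using g(2)[of z] True closure_subset[of D] by (intro mult_left_mono) (auto simp: less_imp_le)
        finally show ?thesis by (simp add: mult.commute)
      qed (simp add: U_def)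
    qed
    finally show ?thesis by simp
  qed
  have "norm (\<integral>z. U z * cnj (U z) \<partial>lborel) \<le> 0"
  proof (rule field_le_epsilon)
    fix e :: real assume e: "e > 0"
    define I where "I = (\<integral>z. norm (U z) \<partial>lborel)"
    have I: "I \<ge> 0" by (simp add: I_def)
    have "norm (\<integral>z. U z * cnj (U z) \<partial>lborel) \<le> e / (I + 1) * I"
      unfolding I_def[symmetric] using key[of "e / (I + 1)"] e I by (simp add: I_def[symmetric] add_nonneg_pos)
    also have "\<dots> \<le> e" using e I by (simp add: field_simps)
    finally show "norm (\<integral>z. U z * cnj (U z) \<partial>lborel) \<le> 0 + e" by simp
  qed
  then have z0: "(\<integral>z. U z * cnj (U z) \<partial>lborel) = 0" by simp
  have UU: "U z * cnj (U z) = of_real ((norm (U z))\<^sup>2)" for z using complex_norm_square[of "U z"] by simp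
  have "(\<integral>z. (norm (U z))\<^sup>2 \<partial>lborel) = 0" using z0 unfolding UU by (simp only: integral_complex_of_real of_real_eq_0_iff)
  moreover have "integrable lborel (\<lambda>z. (norm (U z))\<^sup>2)" using integrable_Re[OF iUU] unfolding UU by simp
  ultimately have "AE z in lborel. (norm (U z))\<^sup>2 = 0"
    by (subst (asm) integral_nonneg_eq_0_iff_AE) auto
  then have "AE z in lebesgue. z \<notin> {z \<in> D. u z \<noteq> 0}"
    by (intro AE_completion) (auto simp: U_def elim!: eventually_mono)
  then obtain N where N: "negligible N" "{z. \<not> z \<notin> {z \<in> D. u z \<noteq> 0}} \<subseteq> N"
    unfolding eventually_ae_filter_negligible by (elim exE conjE)
  then have neg: "negligible {z \<in> D. u z \<noteq> 0}" by (auto intro: negligible_subset)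
  have "continuous_on D u" using uc closure_subset continuous_on_subset by blast
  then have "open (D \<inter> u -` (- {0}))" by (intro continuous_open_preimage D) auto
  moreover have "D \<inter> u -` (- {0}) = {z \<in> D. u z \<noteq> 0}" by auto
  ultimately have "open {z \<in> D. u z \<noteq> 0}" by simp
  then have "{z \<in> D. u z \<noteq> 0} = {}" using neg open_not_negligible by blast
  then show ?thesis using z by blast
qed

section \<open>Which points a conic encloses\<close>

lemma ray_not_inside:
  fixes p v :: complex
  assumes v: "v \<noteq> 0" and ray: "\<And>t. t \<ge> 0 \<Longrightarrow> p + of_real t * v \<notin> S"
  shows "p \<notin> inside S"
proof
  assume "p \<in> inside S"
  then have b: "bounded (connected_component_set (- S) p)" by (simp add: inside_def)
  let ?R = "(\<lambda>t. p + of_real t * v) ` {0..}"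
  have "connected ?R" by (intro connected_continuous_image continuous_intros) simp
  moreover have "p \<in> ?R" by (rule image_eqI[of _ _ 0]) auto
  moreover have "?R \<subseteq> - S" using ray by auto
  ultimately have "?R \<subseteq> connected_component_set (- S) p" by (intro connected_component_maximal)
  then have "bounded ?R" using b bounded_subset by blast
  then obtain B where B: "\<And>t. t \<ge> 0 \<Longrightarrow> norm (p + of_real t * v) \<le> B" by (auto simp: bounded_iff)
  define t where "t = (\<bar>B\<bar> + norm p + 1) / norm v"
  have t: "t \<ge> 0" by (simp add: t_def)
  have "norm (of_real t * v) = t * norm v" using t by (simp add: norm_mult)
  also have "\<dots> = \<bar>B\<bar> + norm p + 1" using v by (simp add: t_def)
  finally have "norm (of_real t * v) = \<bar>B\<bar> + norm p + 1" .
  moreover have "norm (of_real t * v) \<le> norm (p + of_real t * v) + norm p"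
    by (metis add_diff_cancel_left' norm_triangle_ineq4)
  ultimately show False using B[OF t] by linarith
qed

lemma conic_poly_ray:
  "conic_poly a b c d e f (Re (p + of_real t * v)) (Im (p + of_real t * v)) =
    conic_poly a b c d e f (Re p) (Im p)
    + t * (2 * a * Re p * Re v + b * (Re p * Im v + Im p * Re v) + 2 * c * Im p * Im v + d * Re v + e * Im v)
    + t\<^sup>2 * (a * (Re v)\<^sup>2 + b * Re v * Im v + c * (Im v)\<^sup>2)"
  by (simp add: conic_poly_def algebra_simps power2_eq_square)

text \<open>Along a ray from \<open>p\<close> the polynomial is quadratic in \<open>t\<close> with
  positive constant term and nonnegative leading coefficient. Reversing the direction changes only
  the sign of the linear term, so one of the two rays stays in the positive region and escapes to
  infinity off the curve.\<close>

lemma conic_ray_not_inside: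
  assumes p: "conic_poly a b c d e f (Re p) (Im p) > 0" and v: "v \<noteq> 0"
    and q: "a * (Re v)\<^sup>2 + b * Re v * Im v + c * (Im v)\<^sup>2 \<ge> 0"
  shows "p \<notin> inside (conic_curve a b c d e f)"
proof -
  let ?L = "\<lambda>v. 2 * a * Re p * Re v + b * (Re p * Im v + Im p * Re v) + 2 * c * Im p * Im v + d * Re v + e * Im v"
  have L: "?L (- v) = - ?L v" by (simp add: algebra_simps)
  obtain w where w: "w \<noteq> 0" "?L w \<ge> 0" "a * (Re w)\<^sup>2 + b * Re w * Im w + c * (Im w)\<^sup>2 \<ge> 0"
  proof (cases "?L v \<ge> 0")
    case True then show ?thesis using that v q by blast
  next
    case False
    then have "?L (- v) \<ge> 0" unfolding L by linarith
    then show ?thesis using that[of "- v"] v q by simp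
  qed
  show ?thesis
  proof (rule ray_not_inside[OF w(1)])
    fix t :: real assume t: "t \<ge> 0"
    have "conic_poly a b c d e f (Re (p + of_real t * w)) (Im (p + of_real t * w)) > 0"
      unfolding conic_poly_ray using p mult_nonneg_nonneg[OF t w(2)] mult_nonneg_nonneg[OF zero_le_power2[of t] w(3)] by linarith
    then show "p + of_real t * w \<notin> conic_curve a b c d e f" by (simp add: conic_curve_def)
  qed
qed

lemma conic_curve_uminus: "conic_curve (-a) (-b) (-c) (-d) (-e) (-f) = conic_curve a b c d e f"
proof -
  have "conic_poly (-a) (-b) (-c) (-d) (-e) (-f) x y = - conic_poly a b c d e f x y" for x y
    by (simp add: conic_poly_def)
  then show ?thesis by (simp add: conic_curve_def)
qed

text \<open>If \<open>b\<^sup>2 - 4 * a * c\<close> were nonnegative, the quadratic part would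
  vanish in some direction \<open>v\<close>, and the ray argument would apply to the polynomial or
  to its negative, whichever is positive at the point. Enclosing a nonempty region thus forces the
  elliptic case.\<close>

lemma inside_conic_discriminant:
  assumes "inside (conic_curve a b c d e f) \<noteq> {}"
  shows "b\<^sup>2 < 4 * a * c"
proof (rule ccontr)
  assume "\<not> ?thesis"
  then have disc: "b\<^sup>2 - 4 * a * c \<ge> 0" by simp
  obtain v :: complex where v: "v \<noteq> 0" "a * (Re v)\<^sup>2 + b * Re v * Im v + c * (Im v)\<^sup>2 = 0"
  proof (cases "a = 0")
    case True then show ?thesis using that[of 1] by simp
  next
    case False
    \<comment> \<open>The direction \<open>Complex (s - b) (2 * a)\<close> comes from the quadratic
      formula for the ratio of the coordinates.\<close>
    define s where "s = sqrt (b\<^sup>2 - 4 * a * c)"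
    have s: "s\<^sup>2 = b\<^sup>2 - 4 * a * c" using disc by (simp add: s_def)
    have "a * (s - b)\<^sup>2 + b * (s - b) * (2 * a) + c * (2 * a)\<^sup>2 = a * (s\<^sup>2 - (b\<^sup>2 - 4 * a * c))"
      by (simp add: algebra_simps power2_eq_square)
    also have "\<dots> = 0" using s by simp
    finally show ?thesis using False that[of "Complex (s - b) (2 * a)"] by (simp add: complex_eq_iff)
  qed
  obtain p where p: "p \<in> inside (conic_curve a b c d e f)" using assms by blast
  then have "p \<notin> conic_curve a b c d e f" using inside_no_overlap by blast
  then have "conic_poly a b c d e f (Re p) (Im p) \<noteq> 0" by (simp add: conic_curve_def)
  then consider "conic_poly a b c d e f (Re p) (Im p) > 0" | "conic_poly (-a) (-b) (-c) (-d) (-e) (-f) (Re p) (Im p) > 0"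
    by (fastforce simp: conic_poly_def)
  then show False
  proof cases
    case 1 then show False using conic_ray_not_inside[OF 1 v(1)] v(2) p by simp
  next
    case 2
    have "p \<notin> inside (conic_curve (-a) (-b) (-c) (-d) (-e) (-f))"
      by (rule conic_ray_not_inside[OF 2 v(1)]) (use v(2) in \<open>simp add: algebra_simps\<close>)
    then show False using p unfolding conic_curve_uminus by simp
  qed
qed

lemma conic_neg_bounded_coord:
  assumes a: "a > 0" and disc: "b\<^sup>2 < 4 * a * c"
  shows "\<exists>Y. \<forall>x y. conic_poly a b c d e f x y < 0 \<longrightarrow> \<bar>y\<bar> \<le> Y"
proof -
  \<comment> \<open>Completing the square in \<open>x\<close> writes \<open>4 * a\<close> times the
    polynomial as a square plus \<open>k * y\<^sup>2 + m * y + n\<close>. Where the polynomial is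
    negative, so is this quadratic in \<open>y\<close>, and \<open>k > 0\<close> bounds
    \<open>y\<close>.\<close>
  define k m n where "k = 4 * a * c - b\<^sup>2" and "m = 4 * a * e - 2 * b * d" and "n = 4 * a * f - d\<^sup>2"
  have k: "k > 0" using disc by (simp add: k_def)
  have "\<bar>y\<bar> \<le> 1 + (\<bar>m\<bar> + \<bar>n\<bar>) / k" if neg: "conic_poly a b c d e f x y < 0" for x y
  proof (cases "\<bar>y\<bar> \<le> 1")
    case True
    have "(\<bar>m\<bar> + \<bar>n\<bar>) / k \<ge> 0" using k by simp
    then show ?thesis using True by linarith
  next
    case False
    have "4 * a * conic_poly a b c d e f x y = (2 * a * x + b * y + d)\<^sup>2 + (k * y\<^sup>2 + m * y + n)"
      by (simp add: conic_poly_def k_def m_def n_def algebra_simps power2_eq_square)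
    moreover have "4 * a * conic_poly a b c d e f x y < 0" using a neg by (simp add: mult_pos_neg)
    ultimately have "k * y\<^sup>2 + m * y + n < 0" using zero_le_power2[of "2 * a * x + b * y + d"] by linarith
    then have "k * y\<^sup>2 < \<bar>m\<bar> * \<bar>y\<bar> + \<bar>n\<bar>" using abs_ge_self[of "- (m * y)"] abs_ge_self[of "- n"] by (simp add: abs_mult)
    also have "\<dots> \<le> \<bar>m\<bar> * \<bar>y\<bar> + \<bar>n\<bar> * \<bar>y\<bar>" using False mult_left_mono[of 1 "\<bar>y\<bar>" "\<bar>n\<bar>"] by simp
    finally have "k * \<bar>y\<bar> * \<bar>y\<bar> < (\<bar>m\<bar> + \<bar>n\<bar>) * \<bar>y\<bar>" by (simp add: power2_eq_square algebra_simps)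
    then have "k * \<bar>y\<bar> < \<bar>m\<bar> + \<bar>n\<bar>" using False mult_less_cancel_right_pos[of "\<bar>y\<bar>" "k * \<bar>y\<bar>" "\<bar>m\<bar> + \<bar>n\<bar>"] by linarith
    then have "\<bar>y\<bar> < (\<bar>m\<bar> + \<bar>n\<bar>) / k" using k by (simp add: field_simps)
    then show ?thesis by simp
  qed
  then show ?thesis by blast
qed

lemma conic_neg_bounded:
  assumes a: "a > 0" and disc: "b\<^sup>2 < 4 * a * c"
  shows "bounded {z. conic_poly a b c d e f (Re z) (Im z) < 0}"
proof -
  have c: "c > 0"
  proof -
    have "0 < 4 * a * c" using disc zero_le_power2[of b] by linarith
    then show ?thesis using a by (simp add: zero_less_mult_iff)
  qed
  obtain Y where Y: "\<And>x y. conic_poly a b c d e f x y < 0 \<Longrightarrow> \<bar>y\<bar> \<le> Y" using conic_neg_bounded_coord[OF a disc] by blast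
  have disc': "b\<^sup>2 < 4 * c * a" using disc by (simp add: mult_ac)
  have sw: "conic_poly c b a e d f y x = conic_poly a b c d e f x y" for x y by (simp add: conic_poly_def algebra_simps)
  obtain X where X: "\<And>x y. conic_poly c b a e d f y x < 0 \<Longrightarrow> \<bar>x\<bar> \<le> X" using conic_neg_bounded_coord[OF c disc'] by blast
  have "norm z \<le> X + Y" if "conic_poly a b c d e f (Re z) (Im z) < 0" for z
  proof -
    have "\<bar>Im z\<bar> \<le> Y" by (rule Y[OF that])
    moreover have "\<bar>Re z\<bar> \<le> X" by (rule X[of "Im z"]) (simp add: sw that)
    ultimately show ?thesis using cmod_le[of z] by linarith
  qed
  then show ?thesis by (auto simp: bounded_iff)
qed

lemma conic_poly_continuous: "continuous_on S (\<lambda>z. conic_poly a b c d e f (Re z) (Im z))"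
  unfolding conic_poly_def by (intro continuous_intros)

text \<open>A point with positive value escapes along a horizontal ray, because
  \<open>a > 0\<close>. The polynomial has constant sign on a component of the complement of the
  curve, so a component with a negative value stays in the bounded negative set.\<close>

lemma inside_ellipse:
  assumes a: "a > 0" and disc: "b\<^sup>2 < 4 * a * c"
  shows "inside (conic_curve a b c d e f) = {z. conic_poly a b c d e f (Re z) (Im z) < 0}"
proof (intro set_eqI iffI)
  let ?q = "\<lambda>z. conic_poly a b c d e f (Re z) (Im z)"
  fix p
  {
    assume p: "p \<in> inside (conic_curve a b c d e f)"
    then have "p \<notin> conic_curve a b c d e f" using inside_no_overlap by blast
    then have ne: "?q p \<noteq> 0" by (simp add: conic_curve_def)
    have "\<not> ?q p > 0"
    proof
      assume "?q p > 0"
      then have "p \<notin> inside (conic_curve a b c d e f)"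
        by (rule conic_ray_not_inside[of _ _ _ _ _ _ _ 1]) (use a in auto)
      then show False using p by simp
    qed
    then show "p \<in> {z. ?q z < 0}" using ne by simp
  }
  assume "p \<in> {z. ?q z < 0}"
  then have p: "?q p < 0" by simp
  let ?C = "connected_component_set (- conic_curve a b c d e f) p"
  have pC: "p \<in> - conic_curve a b c d e f" using p by (simp add: conic_curve_def)
  have "?C \<subseteq> {z. ?q z < 0}"
  proof (rule ccontr)
    assume "\<not> ?C \<subseteq> {z. ?q z < 0}"
    then obtain w where w: "w \<in> ?C" "\<not> ?q w < 0" by blast
    have C: "?C \<subseteq> - conic_curve a b c d e f" by (rule connected_component_subset)
    then have "?q w \<noteq> 0" using w(1) by (auto simp: conic_curve_def)
    then have w': "?q w > 0" using w(2) by simp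
    have "?C \<subseteq> {z. ?q z < 0} \<union> {z. ?q z > 0}" using C by (auto simp: conic_curve_def)
    moreover have "open {z. ?q z < 0}" "open {z. ?q z > 0}"
      by (intro open_Collect_less conic_poly_continuous continuous_intros)+
    moreover have "{z. ?q z < 0} \<inter> {z. ?q z > 0} \<inter> ?C = {}" by auto
    ultimately have "{z. ?q z < 0} \<inter> ?C = {} \<or> {z. ?q z > 0} \<inter> ?C = {}"
      by (intro connectedD[OF connected_connected_component])
    moreover have "p \<in> ?C" using pC by simp
    ultimately show False using p w w' by blast
  qed
  then have "bounded ?C" using conic_neg_bounded[OF a disc] bounded_subset by blast
  then show "p \<in> inside (conic_curve a b c d e f)" using pC by (simp add: inside_def)
qed

text \<open>Substitutes \<open>x = (z + cnj z) / 2\<close> and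
  \<open>y = (z - cnj z) / (2 * \<i>)\<close>. The coefficient of \<open>(cnj z)\<^sup>2\<close>
  becomes \<open>(a - c + \<i> * b) / 4\<close>, which vanishes exactly when \<open>a = c\<close>
  and \<open>b = 0\<close>.\<close>

lemma conic_poly_complex:
  assumes "(of_real (a - c) + \<i> * of_real b) / (4 :: complex) \<noteq> 0"
  shows "Quad ((of_real (a - c) + \<i> * of_real b) / 4) (of_real (a + c) / 2) ((of_real d + \<i> * of_real e) / 2)
     ((of_real (a - c) - \<i> * of_real b) / 4) ((of_real d - \<i> * of_real e) / 2) (of_real f) z
    = complex_of_real (conic_poly a b c d e f (Re z) (Im z))"
  unfolding Quad_def[OF assms]
  by (simp add: conic_poly_def complex_eq_iff power2_eq_square field_simps)

theorem theorem2p13: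
  fixes a b c d e f q :: real
    and \<Gamma> D :: "complex set"
    and P :: "complex poly poly"
    and A :: "complex \<Rightarrow> complex"
  assumes "nondegenerate_conic a b c d e f"
    and "\<not> (a = c \<and> b = 0)"
    and "\<Gamma> = conic_curve a b c d e f"
    and "D = inside \<Gamma>" and "D \<noteq> {}"
    and "q > 2" and "sobolev_W1 q D A"
  shows "\<exists>w. dirichlet_solution A D \<Gamma> (\<lambda>z. exp (T_op D A z) * poly_xy P z) w \<and>
           (\<forall>w'. dirichlet_solution A D \<Gamma> (\<lambda>z. exp (T_op D A z) * poly_xy P z) w' \<longrightarrow>
                 (\<forall>z\<in>closure D. w' z = w z))"
proof -
  have disc: "b\<^sup>2 < 4 * a * c" by (rule inside_conic_discriminant) (use assms in simp)
  have a0: "a \<noteq> 0" using disc by auto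
  \<comment> \<open>The sign of the equation is normalised, so that the enclosed region is the one
    where the polynomial is negative.\<close>
  obtain a' b' c' d' e' f' where a': "a' > 0" and disc': "b'\<^sup>2 < 4 * a' * c'" and nc: "\<not> (a' = c' \<and> b' = 0)"
    and \<Gamma>: "\<Gamma> = conic_curve a' b' c' d' e' f'"
  proof (cases "a > 0")
    case True then show ?thesis using that disc assms by blast
  next
    case False
    show ?thesis by (rule that[of "-a" "-b" "-c" "-d" "-e" "-f"]) (use False a0 disc assms conic_curve_uminus in auto)
  qed
  define Qr where "Qr z = conic_poly a' b' c' d' e' f' (Re z) (Im z)" for z
  define b0 where "b0 = (of_real (a' - c') + \<i> * of_real b') / (4 :: complex)"
  define l1 where "l1 = (of_real (a' + c') / 2 :: complex)"
  define l0 where "l0 = (of_real d' + \<i> * of_real e') / (2 :: complex)"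
  define m2 where "m2 = (of_real (a' - c') - \<i> * of_real b') / (4 :: complex)"
  define m1 where "m1 = (of_real d' - \<i> * of_real e') / (2 :: complex)"
  define m0 where "m0 = complex_of_real f'"
  have b0: "b0 \<noteq> 0" using nc by (auto simp: b0_def complex_eq_iff)
  have Quad: "Quad b0 l1 l0 m2 m1 m0 z = of_real (Qr z)" for z
    unfolding Qr_def b0_def l1_def l0_def m2_def m1_def m0_def by (rule conic_poly_complex) (use b0 in \<open>simp add: b0_def\<close>)
  have D: "D = {z. Qr z < 0}" unfolding Qr_def assms(4) \<Gamma> by (rule inside_ellipse[OF a' disc'])
  have \<Gamma>Q: "z \<in> \<Gamma> \<longleftrightarrow> Qr z = 0" for z by (simp add: \<Gamma> Qr_def conic_curve_def)
  have oD: "open D" unfolding D Qr_def by (intro open_Collect_less conic_poly_continuous continuous_intros)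
  have bD: "bounded D" unfolding D Qr_def by (rule conic_neg_bounded[OF a' disc'])
  define B where "B = T_op D A"
  obtain Bp Bq where B: "continuous_on UNIV B" "wirt D B Bp Bq" "AE z in lebesgue. z \<in> D \<longrightarrow> Bq z = A z"
    using T_op_C1[OF oD bD assms(6,7)] unfolding B_def by blast
  let ?h = "\<lambda>z. exp (B z) * poly_xy P z"
  obtain p0 p1 where "\<And>z. Quad b0 l1 l0 m2 m1 m0 z = 0 \<Longrightarrow> poly_xy P z = poly p0 z + cnj z * poly p1 z"
    using bipoly_on_conic[OF b0 bipoly_poly_xy] by blast
  then have p: "poly_xy P z = poly p0 z + cnj z * poly p1 z" if "z \<in> \<Gamma>" for z
    using that \<Gamma>Q[of z] Quad[of z] by simp
  define w where "w z = exp (B z) * (poly p0 z + cnj z * poly p1 z)" for z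
  have w: "dirichlet_solution A D \<Gamma> ?h w"
    unfolding w_def[abs_def] by (rule bianalytic_solution[OF oD B p])
  have "w' z = w z" if w': "dirichlet_solution A D \<Gamma> ?h w'" and z: "z \<in> closure D" for w' z
  proof -
    have wc: "continuous_on (closure D) w" "continuous_on (closure D) w'" using w w' by (auto simp: dirichlet_solution_def)
    obtain v where v: "dbar_minus A D w v" "dbar_minus A D v (\<lambda>_. 0)" using w by (auto simp: dirichlet_solution_def)
    obtain v' where v': "dbar_minus A D w' v'" "dbar_minus A D v' (\<lambda>_. 0)" using w' by (auto simp: dirichlet_solution_def)
    have li: "locally_integrable_on w D" "locally_integrable_on w' D"
      by (intro continuous_locally_integrable continuous_on_subset[OF wc(1) closure_subset] continuous_on_subset[OF wc(2) closure_subset])+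
    define u where "u z = exp (- B z) * (w' z - w z)" for z
    have uc: "continuous_on (closure D) u"
      unfolding u_def[abs_def] by (intro continuous_intros wc continuous_on_subset[OF B(1)]) simp
    have u0: "u z = 0" if "z \<in> closure D" "Qr z = 0" for z
    proof -
      have "z \<in> \<Gamma>" using that \<Gamma>Q by simp
      then have "w' z = ?h z" "w z = ?h z" using w w' by (auto simp: dirichlet_solution_def)
      then show ?thesis by (simp add: u_def)
    qed
    \<comment> \<open>No equation for the difference is derived: the weak identity is applied to
      each of the two solutions with its own intermediate function, and the results are
      subtracted.\<close>
    have H: "(LINT z:D|lebesgue. u z * \<phi>2 z) = 0"
      if \<phi>: "wirt UNIV \<phi> p \<phi>1" "wirt UNIV \<phi>1 p1 \<phi>2" and K: "compact K" "K \<subseteq> D" and \<phi>0: "\<And>z. z \<notin> K \<Longrightarrow> \<phi> z = 0"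
      for \<phi> p \<phi>1 p1 \<phi>2 K
    proof -
      have cK: "closed K" using K(1) by (rule compact_imp_closed)
      have z1: "\<phi>1 z = 0" if "z \<notin> K" for z using wirt_zero_outside[OF \<phi>(1) cK \<phi>0 that] by auto
      have z2: "\<phi>2 z = 0" if "z \<notin> K" for z using wirt_zero_outside[OF \<phi>(2) cK z1 that] by auto
      have c: "continuous_on UNIV (\<lambda>z. exp (- B z) * \<phi>2 z)" by (intro continuous_intros B(1) wirt_cont(3)[OF \<phi>(2)])
      have i: "set_integrable lebesgue D (\<lambda>z. y z * (exp (- B z) * \<phi>2 z))" if "locally_integrable_on y D" for y
        unfolding set_integrable_def by (rule locally_integrable_mult[OF that K c]) (simp add: z2)
      have "(LINT z:D|lebesgue. u z * \<phi>2 z) = (LINT z:D|lebesgue. w' z * (exp (- B z) * \<phi>2 z) - w z * (exp (- B z) * \<phi>2 z))"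
        by (simp add: u_def algebra_simps)
      also have "\<dots> = (LINT z:D|lebesgue. w' z * (exp (- B z) * \<phi>2 z)) - (LINT z:D|lebesgue. w z * (exp (- B z) * \<phi>2 z))"
        by (rule set_integral_diff(2)[OF i[OF li(2)] i[OF li(1)]])
      also have "\<dots> = 0"
        using dbar_minus_twice_test[OF oD B(2,3) v \<phi> K \<phi>0] dbar_minus_twice_test[OF oD B(2,3) v' \<phi> K \<phi>0]
        by (simp add: mult.assoc)
      finally show ?thesis .
    qed
    have "u z = 0" if "z \<in> D" for z
    proof (rule orthogonal_bipoly_zero[OF oD bD uc _ _ that])
      fix f assume f: "bipoly f"
      note o = bianalytic_orthogonal[OF b0 Quad, folded D, OF bD uc u0 H f]
      show "(\<integral>z. (indicator D z *\<^sub>R u z) * f z \<partial>lborel) = 0" by (rule o(1))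
      show "integrable lborel (\<lambda>z. (indicator D z *\<^sub>R u z) * f z)" by (rule o(2))
    qed
    then have "w' z - w z = 0" if "z \<in> D" for z using that by (simp add: u_def)
    moreover have "continuous_on (closure D) (\<lambda>z. w' z - w z)" by (intro continuous_intros wc)
    ultimately have "w' z - w z = 0" using z continuous_constant_on_closure[of D "\<lambda>z. w' z - w z" 0] by blast
    then show ?thesis by simp
  qed
  then show ?thesis using w unfolding B_def by blast
qed

end
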